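(* Let $1/3<\beta\le1/2$, $\gamma>1/\beta$, $\omega(s,t)=|t-s|$, $\sigma\in\mathrm{Lip}^{\gamma-1}(\mathbb{R}^n\times\mathbb{R}^n,\mathcal{L}(\mathbb{R}^d,\mathbb{R}^n))$, $\xi\in\mathbb{R}^n$. Let $A:\mathcal{C}^{\beta}([0,T],\mathbb{R}^n\,|\,x_0=\xi)\to C([0,T],\mathbb{R}^n)$ satisfy: (a) for all $0\le t\le T$, $(A(x)_s)_{0\le s\le t}$ depends only on $(x_s)_{0\le s\le t}$; (b) there is $1/3<\beta_0<\beta$ such that $A$ extends to a continuous mapping (still denoted $A$) from $\mathcal{C}^{\beta_0}([0,T],\mathbb{R}^n\,|\,x_0=\xi)$ to $C([0,T],\mathbb{R}^n)$ with the uniform norm; (c) there is a non-decreasing positive continuous function $F$ on $[0,\infty)$ with $\|A(x)\|_{1\text{-}var,[s,t]}\le F(\|x\|_{(1/\beta_0)\text{-}var,[s,t]})\|x\|_{\infty\text{-}var,[s,t]}$ for all $x\in\mathcal{C}^{\beta_0}([0,T],\mathbb{R}^n\,|\,x_0=\xi)$ and $0\le s\le t\le T$. Consider the RDE $$Z_t=\xi+\int_0^t\sigma(Z_s,A(Z)_s)d\mathbf{X}_s,\quad Z'_t=\sigma(Z_t,A(Z)_t),\quad 0\le t\le T,$$ with $(Z,Z')\in\mathscr{D}^{2\beta}_X(\mathbb{R}^n)$, and assume that its solution is unique whenever $\mathbf{X}$ is a smooth rough path; denote by $Z(h)$ the solution driven by the smooth rough path of a Lipschitz path $h$. Let $\nu$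 be a probability measure on $\mathscr{C}^\beta_g(\mathbb{R}^d)$ and let $S$ be a subset of $\mathscr{C}^\beta_g(\mathbb{R}^d)$. Assume $\mathrm{Supp}\,\nu=\mathscr{C}^\beta_g(\mathbb{R}^d)$ and $\nu(S)=1$. Let $\mathcal{I}:S\to\mathcal{C}^{\beta-}([0,T],\mathbb{R}^n)$, $\mathbf{X}\mapsto Z(\mathbf{X})\in Sol_\infty(\mathbf{X})$, be a mapping measurable with respect to the $\nu$-completed Borel $\sigma$-field. Then $$\mathrm{Supp}\,(\mathcal{I}_*\nu)=\overline{\{Z(h)\,|\,h\in\mathcal{C}^1\}}^{\,\mathcal{C}^{\beta-}},$$ where $\mathrm{Supp}\,(\mathcal{I}_*\nu)$ denotes the topological support of the image measure of $\nu$ under $\mathcal{I}$.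
   Context: Fix $T>0$. Here $\omega(s,t)=|t-s|$, so H\"older norms are the usual ones. For a continuous path $x$ in a finite-dimensional normed space, $x_{s,t}=x_t-x_s$, $\|x\|_{\infty\text{-}var,[s,t]}=\max_{s\le u\le v\le t}|x_{u,v}|$, $\|x\|_{p\text{-}var,[s,t]}$ is the usual $p$-variation norm, $\|x\|_\theta=\sup_{s<t}|x_{s,t}|/|t-s|^\theta$; similarly for two-parameter functions. $\mathcal{C}^\theta([0,T],E)$ is the space of $\theta$-H\"older paths (so $\mathcal{C}^1$ is the space of Lipschitz paths, here in $\mathbb{R}^d$), $\mathcal{C}^\theta([0,T],E\,|\,x_0=\xi)$ the subset starting at $\xi$, and $\mathcal{C}^{\theta-}=\cap_{0<\epsilon<\theta}\mathcal{C}^{\theta-\epsilon}$ with its natural Fr\'echet topology. For $\gamma=m+\theta$ ($m\in\mathbb{N}\cup\{0\}$, $0<\theta\le1$), $\mathrm{Lip}^\gamma(E,F)$ is the set of bounded $f:E\to F$, $m$ times continuously differentiable with bounded derivatives up to order $m$ and $D^mf$ $\theta$-H\"older. $\mathscr{C}^\beta(\mathbb{R}^d)$: $\beta$-H\"older rough paths $\mathbf{X}=(X_{s,t},\mathbb{X}_{s,t})$ (Chen's relation, $\|X\|_\beta<\infty$, $\|\mathbb{X}\|_{2\beta}<\infty$), with topology given by $|||\mathbf{X}-\mathbf{Y}|||_\beta=\|X-Y\|_\beta+\sqrt{\|\mathbb{X}-\mathbb{Y}\|_{2\beta}}$. The smooth rough path $\mathbf{h}$ of a Lipschitz path $h\in\mathcal{C}^1$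 is $\mathbf h_{s,t}=(h_{s,t},\int_s^t(h_u-h_s)\otimes dh_u)$. $\mathscr{C}^\beta_g(\mathbb{R}^d)$ (geometric rough paths) is the closure of the set of smooth rough paths in $\mathscr{C}^\beta(\mathbb{R}^d)$. $\mathscr{D}^{2\beta}_X(\mathbb{R}^n)$: pairs $(Z,Z')\in\mathcal{C}^\beta([0,T],\mathbb{R}^n)\times\mathcal{C}^\beta([0,T],\mathcal{L}(\mathbb{R}^d,\mathbb{R}^n))$ with $R^Z_{s,t}=Z_t-Z_s-Z'_sX_{s,t}$ satisfying $\|R^Z\|_{2\beta}<\infty$. For such $(Z,Z')$ and a continuous bounded variation path $\Psi$, $\int_s^t\sigma(Z_u,\Psi_u)d\mathbf{X}_u$ is the limit, as the mesh of partitions of $[s,t]$ tends to $0$, of $\sum_i\Xi_{t_{i-1},t_i}$ with $\Xi_{s,t}=\sigma(Z_s,\Psi_s)X_{s,t}+(D_1\sigma)(Z_s,\Psi_s)Z'_s\mathbb{X}_{s,t}+(D_2\sigma)(Z_s,\Psi_s)\int_s^t\Psi_{s,r}\otimes dX_r$ (Young integral in the last term). For $\mathbf{X}=\mathbf{h}$ the RDE is the integral equation $Z_t=\xi+\int_0^t\sigma(Z_s,A(Z)_s)dh_s$. $Sol_\infty(\mathbf{X})$, for $\mathbf{X}\in\mathscr{C}^\beta_g(\mathbb{R}^d)$, is the set of all accumulation points in $\mathcal{C}^{\beta-}([0,T],\mathbb{R}^n)$ of sequences $\{Z(h_N)\}$, where $\{\mathbf{h}_N\}$ ranges over sequences of smooth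 rough paths with $\lim_{N\to\infty}|||\mathbf{h}_N-\mathbf{X}|||_\beta=0$. *)

theory Defs
  imports "HOL-Probability.Probability"
begin

text \<open>
  Paths on \<open>[0,T]\<close> are functions on \<open>real\<close> that are \<^const>\<open>extensional\<close> on \<open>{0..T}\<close>, and two-parameter
  functions are functions of a pair \<open>(s,t)\<close> that are extensional on the simplex \<open>0 \<le> s \<le> t \<le> T\<close>; thus
  equality of HOL functions is equality of paths. Variation and Hoelder norms take values in
  \<^typ>\<open>ennreal\<close>, so that an unbounded supremum is \<open>\<infinity>\<close>.
\<close>

section \<open>Partitions and limits along vanishing mesh\<close>

definition partitions :: "real \<Rightarrow> real \<Rightarrow> real list set" where
  "partitions a b = {ts. ts \<noteq> [] \<and> hd ts = a \<and> last ts = b \<and> sorted_wrt (<) ts}"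

definition mesh_filter :: "real \<Rightarrow> real \<Rightarrow> real list filter" where
  "mesh_filter a b = (INF \<delta>\<in>{0<..}. principal
     {ts \<in> partitions a b. \<forall>i < length ts - 1. ts ! Suc i - ts ! i < \<delta>})"

definition partition_sum :: "(real \<Rightarrow> real \<Rightarrow> 'a::comm_monoid_add) \<Rightarrow> real list \<Rightarrow> 'a" where
  "partition_sum \<Xi> ts = (\<Sum>i < length ts - 1. \<Xi> (ts ! i) (ts ! Suc i))"

section \<open>Variation and Hoelder norms\<close>

definition p_variation :: "real \<Rightarrow> (real \<Rightarrow> 'a::real_normed_vector) \<Rightarrow> real \<Rightarrow> real \<Rightarrow> ennreal" where
  "p_variation p x s t =
     (SUP ts \<in> partitions s t.
        ennreal ((partition_sum (\<lambda>u v. norm (x v - x u) powr p) ts) powr (1 / p)))"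

definition infty_variation :: "(real \<Rightarrow> 'a::real_normed_vector) \<Rightarrow> real \<Rightarrow> real \<Rightarrow> ennreal" where
  "infty_variation x s t =
     (SUP (u, v) \<in> {(u, v). s \<le> u \<and> u \<le> v \<and> v \<le> t}. ennreal (norm (x v - x u)))"

definition simplex2 :: "real \<Rightarrow> (real \<times> real) set" where
  "simplex2 T = {(s, t). 0 \<le> s \<and> s \<le> t \<and> t \<le> T}"

definition holder2_norm :: "real \<Rightarrow> real \<Rightarrow> (real \<times> real \<Rightarrow> 'a::real_normed_vector) \<Rightarrow> ennreal" where
  "holder2_norm \<theta> T g =
     (SUP (s, t) \<in> {(s, t). 0 \<le> s \<and> s < t \<and> t \<le> T}. ennreal (norm (g (s, t)) / (t - s) powr \<theta>))"

definition holder_norm :: "real \<Rightarrow> real \<Rightarrow> (real \<Rightarrow> 'a::real_normed_vector) \<Rightarrow> ennreal" where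
  "holder_norm \<theta> T x = holder2_norm \<theta> T (\<lambda>(s, t). x t - x s)"

definition holder_paths :: "real \<Rightarrow> real \<Rightarrow> (real \<Rightarrow> 'a::real_normed_vector) set" where
  "holder_paths \<theta> T = {x \<in> extensional {0..T}. holder_norm \<theta> T x < \<infinity>}"

definition holder_paths_from :: "real \<Rightarrow> real \<Rightarrow> 'a \<Rightarrow> (real \<Rightarrow> 'a::real_normed_vector) set" where
  "holder_paths_from \<theta> T \<xi> = {x \<in> holder_paths \<theta> T. x 0 = \<xi>}"

definition holder_dist :: "real \<Rightarrow> real \<Rightarrow> (real \<Rightarrow> 'a::real_normed_vector) \<Rightarrow> (real \<Rightarrow> 'a) \<Rightarrow> real" where
  "holder_dist \<theta> T x y = norm (x 0 - y 0) + enn2real (holder_norm \<theta> T (\<lambda>t. x t - y t))"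

definition holder_topology :: "real \<Rightarrow> real \<Rightarrow> (real \<Rightarrow> 'a::real_normed_vector) topology" where
  "holder_topology \<theta> T = Metric_space.mtopology (holder_paths \<theta> T) (holder_dist \<theta> T)"

text \<open>\<open>\<theta>\<close>-minus Hoelder paths with the Frechet topology, i.e. the one generated by the balls of
  the \<open>(\<theta> - \<epsilon>)\<close>-Hoelder norms.\<close>

definition holder_minus_paths :: "real \<Rightarrow> real \<Rightarrow> (real \<Rightarrow> 'a::real_normed_vector) set" where
  "holder_minus_paths \<theta> T = (\<Inter>\<epsilon> \<in> {0<..<\<theta>}. holder_paths (\<theta> - \<epsilon>) T)"

definition holder_minus_topology :: "real \<Rightarrow> real \<Rightarrow> (real \<Rightarrow> 'a::real_normed_vector) topology" where
  "holder_minus_topology \<theta> T = topology_generated_by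
     {{y \<in> holder_minus_paths \<theta> T. holder_dist (\<theta> - \<epsilon>) T x y < r} | x \<epsilon> r.
        x \<in> holder_minus_paths \<theta> T \<and> 0 < \<epsilon> \<and> \<epsilon> < \<theta> \<and> 0 < r}"

section \<open>The classes Lip\<close>

text \<open>\<open>iter_deriv [v\<^sub>1, \<dots>, v\<^sub>k] f x\<close> is \<open>D\<^sup>k f(x)[v\<^sub>1, \<dots>, v\<^sub>k]\<close>. The domain is finite-dimensional, so a map
  into the \<open>k\<close>-linear maps is continuous, resp. differentiable, iff all its evaluations are.
  Bounds by \<open>C * prod_list (map norm vs)\<close> are bounds by \<open>C\<close> on the operator norm.\<close>

primrec iter_deriv :: "'a list \<Rightarrow> ('a::euclidean_space \<Rightarrow> 'b::real_normed_vector) \<Rightarrow> 'a \<Rightarrow> 'b" where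
  "iter_deriv [] f = f"
| "iter_deriv (v # vs) f = (\<lambda>x. frechet_derivative (iter_deriv vs f) (at x) v)"

definition continuously_differentiable_upto ::
    "nat \<Rightarrow> ('a::euclidean_space \<Rightarrow> 'b::real_normed_vector) \<Rightarrow> bool" where
  "continuously_differentiable_upto m f \<longleftrightarrow>
     (\<forall>vs. length vs < m \<longrightarrow> (\<forall>x. iter_deriv vs f differentiable (at x))) \<and>
     (\<forall>vs. length vs \<le> m \<longrightarrow> continuous_on UNIV (iter_deriv vs f))"

definition lip_class :: "real \<Rightarrow> ('a::euclidean_space \<Rightarrow> 'b::real_normed_vector) set" where
  "lip_class \<gamma> = {f. \<exists>(m::nat) \<theta>. \<gamma> = real m + \<theta> \<and> 0 < \<theta> \<and> \<theta> \<le> 1 \<and>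
     continuously_differentiable_upto m f \<and>
     (\<exists>C. \<forall>vs x. length vs \<le> m \<longrightarrow> norm (iter_deriv vs f x) \<le> C * prod_list (map norm vs)) \<and>
     (\<exists>C. \<forall>vs x y. length vs = m \<longrightarrow>
        norm (iter_deriv vs f x - iter_deriv vs f y) \<le> C * norm (x - y) powr \<theta> * prod_list (map norm vs))}"

section \<open>Rough paths\<close>

definition tensor :: "real^'a \<Rightarrow> real^'d \<Rightarrow> real^'d^'a" where
  "tensor x y = (\<chi> i j. x $ i * y $ j)"

text \<open>The action on a tensor of a linear \<open>L\<close> from \<open>E\<close> to \<open>\<L>(F, G)\<close>, viewed as a linear map on \<open>E \<otimes> F\<close>:
  \<open>tensor_apply L (tensor x y) = L x y\<close>.\<close>

definition tensor_apply ::
    "(real^'a \<Rightarrow> (real^'d) \<Rightarrow>\<^sub>L (real^'n)) \<Rightarrow> real^'d^'a \<Rightarrow> real^'n" where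
  "tensor_apply L M = (\<Sum>i\<in>UNIV. \<Sum>j\<in>UNIV. (M $ i $ j) *\<^sub>R blinfun_apply (L (axis i 1)) (axis j 1))"

type_synonym 'd rough_path = "(real \<times> real \<Rightarrow> real^'d) \<times> (real \<times> real \<Rightarrow> real^'d^'d)"

definition rough_paths :: "real \<Rightarrow> real \<Rightarrow> ('d::finite) rough_path set" where
  "rough_paths \<beta> T = {(X, XX).
     X \<in> extensional (simplex2 T) \<and> XX \<in> extensional (simplex2 T) \<and>
     (\<forall>s u t. 0 \<le> s \<and> s \<le> u \<and> u \<le> t \<and> t \<le> T \<longrightarrow>
        X (s, t) = X (s, u) + X (u, t) \<and>
        XX (s, t) = XX (s, u) + XX (u, t) + tensor (X (s, u)) (X (u, t))) \<and>
     holder2_norm \<beta> T X < \<infinity> \<and> holder2_norm (2 * \<beta>) T XX < \<infinity>}"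

definition rough_dist :: "real \<Rightarrow> real \<Rightarrow> ('d::finite) rough_path \<Rightarrow> 'd rough_path \<Rightarrow> real" where
  "rough_dist \<beta> T = (\<lambda>(X, XX) (Y, YY).
     enn2real (holder2_norm \<beta> T (\<lambda>p. X p - Y p)) +
     sqrt (enn2real (holder2_norm (2 * \<beta>) T (\<lambda>p. XX p - YY p))))"

definition rough_topology :: "real \<Rightarrow> real \<Rightarrow> ('d::finite) rough_path topology" where
  "rough_topology \<beta> T = Metric_space.mtopology (rough_paths \<beta> T) (rough_dist \<beta> T)"

text \<open>\<open>\<integral>\<^sub>s\<^sup>t (\<Psi>\<^sub>r - \<Psi>\<^sub>s) \<otimes> dX\<^sub>r\<close> where \<open>X\<close> is given by its increments. Left-point Riemann sums suffice:
  one of the two paths has bounded variation and both are continuous in all uses below.\<close>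

definition tensor_integral ::
    "(real \<Rightarrow> real^'a) \<Rightarrow> (real \<times> real \<Rightarrow> real^'d) \<Rightarrow> real \<Rightarrow> real \<Rightarrow> real^'d^'a" where
  "tensor_integral \<Psi> X s t =
     Lim (mesh_filter s t) (partition_sum (\<lambda>u v. tensor (\<Psi> u - \<Psi> s) (X (u, v))))"

definition smooth_rough_path :: "real \<Rightarrow> (real \<Rightarrow> real^'d) \<Rightarrow> ('d::finite) rough_path" where
  "smooth_rough_path T h =
     (restrict (\<lambda>(s, t). h t - h s) (simplex2 T),
      restrict (\<lambda>(s, t). tensor_integral h (\<lambda>(u, v). h v - h u) s t) (simplex2 T))"

definition geometric_rough_paths :: "real \<Rightarrow> real \<Rightarrow> ('d::finite) rough_path set" where
  "geometric_rough_paths \<beta> T =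
     rough_topology \<beta> T closure_of (smooth_rough_path T ` holder_paths 1 T)"

definition geometric_topology :: "real \<Rightarrow> real \<Rightarrow> ('d::finite) rough_path topology" where
  "geometric_topology \<beta> T = subtopology (rough_topology \<beta> T) (geometric_rough_paths \<beta> T)"

section \<open>Controlled paths and the path-dependent rough differential equation\<close>

definition controlled_paths ::
    "real \<Rightarrow> real \<Rightarrow> (real \<times> real \<Rightarrow> real^'d) \<Rightarrow>
     ((real \<Rightarrow> real^'n) \<times> (real \<Rightarrow> (real^'d) \<Rightarrow>\<^sub>L (real^'n))) set" where
  "controlled_paths \<beta> T X = {(Z, Z'). Z \<in> holder_paths \<beta> T \<and> Z' \<in> holder_paths \<beta> T \<and>
     holder2_norm (2 * \<beta>) T (\<lambda>(s, t). Z t - Z s - blinfun_apply (Z' s) (X (s, t))) < \<infinity>}"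

definition rough_germ ::
    "((real^'n) \<times> (real^'n) \<Rightarrow> (real^'d) \<Rightarrow>\<^sub>L (real^'n)) \<Rightarrow> (real \<Rightarrow> real^'n) \<Rightarrow>
     (real \<Rightarrow> (real^'d) \<Rightarrow>\<^sub>L (real^'n)) \<Rightarrow> (real \<Rightarrow> real^'n) \<Rightarrow> ('d::finite) rough_path \<Rightarrow>
     real \<Rightarrow> real \<Rightarrow> real^'n" where
  "rough_germ \<sigma> Z Z' \<Psi> = (\<lambda>(X, XX) s t.
     blinfun_apply (\<sigma> (Z s, \<Psi> s)) (X (s, t)) +
     tensor_apply (\<lambda>v. frechet_derivative (\<lambda>z. \<sigma> (z, \<Psi> s)) (at (Z s)) (blinfun_apply (Z' s) v))
       (XX (s, t)) +
     tensor_apply (frechet_derivative (\<lambda>\<psi>. \<sigma> (Z s, \<psi>)) (at (\<Psi> s))) (tensor_integral \<Psi> X s t))"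

definition has_rough_integral ::
    "((real^'n) \<times> (real^'n) \<Rightarrow> (real^'d) \<Rightarrow>\<^sub>L (real^'n)) \<Rightarrow> (real \<Rightarrow> real^'n) \<Rightarrow>
     (real \<Rightarrow> (real^'d) \<Rightarrow>\<^sub>L (real^'n)) \<Rightarrow> (real \<Rightarrow> real^'n) \<Rightarrow> ('d::finite) rough_path \<Rightarrow>
     real \<Rightarrow> real \<Rightarrow> real^'n \<Rightarrow> bool" where
  "has_rough_integral \<sigma> Z Z' \<Psi> X s t I \<longleftrightarrow>
     ((partition_sum (rough_germ \<sigma> Z Z' \<Psi> X)) \<longlongrightarrow> I) (mesh_filter s t)"

definition rde_solution ::
    "real \<Rightarrow> real \<Rightarrow> ((real^'n) \<times> (real^'n) \<Rightarrow> (real^'d) \<Rightarrow>\<^sub>L (real^'n)) \<Rightarrow>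
     ((real \<Rightarrow> real^'n) \<Rightarrow> (real \<Rightarrow> real^'n)) \<Rightarrow> real^'n \<Rightarrow> ('d::finite) rough_path \<Rightarrow>
     (real \<Rightarrow> real^'n) \<times> (real \<Rightarrow> (real^'d) \<Rightarrow>\<^sub>L (real^'n)) \<Rightarrow> bool" where
  "rde_solution \<beta> T \<sigma> A \<xi> X = (\<lambda>(Z, Z').
     Z \<in> holder_paths_from \<beta> T \<xi> \<and> (Z, Z') \<in> controlled_paths \<beta> T (fst X) \<and>
     (\<forall>t\<in>{0..T}. Z' t = \<sigma> (Z t, A Z t) \<and> has_rough_integral \<sigma> Z Z' (A Z) X 0 t (Z t - \<xi>)))"

text \<open>\<open>Z(h)\<close>; meaningful when the equation driven by the smooth rough path of \<open>h\<close> has exactly one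
  solution.\<close>

definition rde_path ::
    "real \<Rightarrow> real \<Rightarrow> ((real^'n) \<times> (real^'n) \<Rightarrow> (real^'d) \<Rightarrow>\<^sub>L (real^'n)) \<Rightarrow>
     ((real \<Rightarrow> real^'n) \<Rightarrow> (real \<Rightarrow> real^'n)) \<Rightarrow> real^'n \<Rightarrow> (real \<Rightarrow> real^'d) \<Rightarrow> real \<Rightarrow> real^'n" where
  "rde_path \<beta> T \<sigma> A \<xi> h = fst (THE p. rde_solution \<beta> T \<sigma> A \<xi> (smooth_rough_path T h) p)"

text \<open>An accumulation point of a sequence is one all of whose neighbourhoods contain infinitely
  many terms, counted by index; the limit of a constant sequence is thus included.\<close>

definition sol_infty ::
    "real \<Rightarrow> real \<Rightarrow> ((real^'n) \<times> (real^'n) \<Rightarrow> (real^'d) \<Rightarrow>\<^sub>L (real^'n)) \<Rightarrow>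
     ((real \<Rightarrow> real^'n) \<Rightarrow> (real \<Rightarrow> real^'n)) \<Rightarrow> real^'n \<Rightarrow> ('d::finite) rough_path \<Rightarrow>
     (real \<Rightarrow> real^'n) set" where
  "sol_infty \<beta> T \<sigma> A \<xi> X = {z \<in> holder_minus_paths \<beta> T. \<exists>h :: nat \<Rightarrow> real \<Rightarrow> real^'d.
     (\<forall>N. h N \<in> holder_paths 1 T) \<and>
     (\<lambda>N. rough_dist \<beta> T (smooth_rough_path T (h N)) X) \<longlonglongrightarrow> 0 \<and>
     (\<forall>U. openin (holder_minus_topology \<beta> T) U \<and> z \<in> U \<longrightarrow>
        (\<exists>\<^sub>F N in sequentially. rde_path \<beta> T \<sigma> A \<xi> (h N) \<in> U))}"

section \<open>Borel sets and topological support\<close>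

definition borel_of :: "'a topology \<Rightarrow> 'a measure" where
  "borel_of X = sigma (topspace X) {U. openin X U}"

definition topological_support :: "'a topology \<Rightarrow> 'a measure \<Rightarrow> 'a set" where
  "topological_support X M =
     {x \<in> topspace X. \<forall>U. openin X U \<and> x \<in> U \<longrightarrow> 0 < emeasure M U}"

section \<open>The distances above are metrics\<close>

lemma holder2_norm_le:
  "\<lbrakk>0 \<le> s; s < t; t \<le> T\<rbrakk> \<Longrightarrow> ennreal (norm (g (s, t)) / (t - s) powr \<theta>) \<le> holder2_norm \<theta> T g"
  unfolding holder2_norm_def by (rule SUP_upper2[of "(s, t)"]) auto

lemma holder2_norm_minus_commute:
  "holder2_norm \<theta> T (\<lambda>p. f p - g p) = holder2_norm \<theta> T (\<lambda>p. g p - f p)"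
  unfolding holder2_norm_def by (simp add: norm_minus_commute)

lemma holder2_norm_cong:
  "(\<And>s t. 0 \<le> s \<Longrightarrow> s < t \<Longrightarrow> t \<le> T \<Longrightarrow> f (s, t) = g (s, t)) \<Longrightarrow>
     holder2_norm \<theta> T f = holder2_norm \<theta> T g"
  unfolding holder2_norm_def by (rule SUP_cong) auto

lemma holder2_norm_uminus: "holder2_norm \<theta> T (\<lambda>p. - f p) = holder2_norm \<theta> T f"
  unfolding holder2_norm_def by simp

lemma holder2_norm_add:
  "holder2_norm \<theta> T (\<lambda>p. f p + g p) \<le> holder2_norm \<theta> T f + holder2_norm \<theta> T g"
proof -
  have "ennreal (norm (f (s, t) + g (s, t)) / (t - s) powr \<theta>) \<le> holder2_norm \<theta> T f + holder2_norm \<theta> T g"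
    if "0 \<le> s" "s < t" "t \<le> T" for s t
  proof -
    have "norm (f (s, t) + g (s, t)) / (t - s) powr \<theta>
        \<le> norm (f (s, t)) / (t - s) powr \<theta> + norm (g (s, t)) / (t - s) powr \<theta>"
      by (simp add: add_divide_distrib[symmetric] divide_right_mono norm_triangle_ineq)
    then have "ennreal (norm (f (s, t) + g (s, t)) / (t - s) powr \<theta>)
        \<le> ennreal (norm (f (s, t)) / (t - s) powr \<theta>) + ennreal (norm (g (s, t)) / (t - s) powr \<theta>)"
      by (metis ennreal_leI ennreal_plus divide_nonneg_nonneg norm_ge_zero powr_ge_zero)
    also have "\<dots> \<le> holder2_norm \<theta> T f + holder2_norm \<theta> T g"
      by (intro add_mono holder2_norm_le that)
    finally show ?thesis .
  qed
  then show ?thesis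
    unfolding holder2_norm_def[of \<theta> T "\<lambda>p. f p + g p"] by (intro SUP_least) auto
qed

lemma holder2_norm_diff_finite:
  assumes "holder2_norm \<theta> T f < \<infinity>" "holder2_norm \<theta> T g < \<infinity>"
  shows "holder2_norm \<theta> T (\<lambda>p. f p - g p) < \<infinity>"
  using holder2_norm_add[of \<theta> T f "\<lambda>p. - g p"] assms
  by (simp add: holder2_norm_uminus) (metis ennreal_add_less_top le_less_trans)

lemma holder2_norm_eq_0:
  assumes "holder2_norm \<theta> T f = 0" "0 \<le> s" "s < t" "t \<le> T"
  shows "f (s, t) = 0"
proof -
  have "ennreal (norm (f (s, t)) / (t - s) powr \<theta>) \<le> 0"
    using holder2_norm_le[of s t T f \<theta>] assms by simp
  then have "norm (f (s, t)) / (t - s) powr \<theta> \<le> 0"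
    by (simp only: le_zero_eq ennreal_eq_0_iff)
  moreover have "0 < (t - s) powr \<theta>" using assms by simp
  ultimately show ?thesis by (simp add: divide_le_0_iff)
qed

lemma holder2_norm_triangle:
  assumes "holder2_norm \<theta> T (\<lambda>p. f p - g p) < \<infinity>" "holder2_norm \<theta> T (\<lambda>p. g p - h p) < \<infinity>"
  shows "enn2real (holder2_norm \<theta> T (\<lambda>p. f p - h p))
    \<le> enn2real (holder2_norm \<theta> T (\<lambda>p. f p - g p)) + enn2real (holder2_norm \<theta> T (\<lambda>p. g p - h p))"
proof -
  have "holder2_norm \<theta> T (\<lambda>p. f p - h p)
      \<le> holder2_norm \<theta> T (\<lambda>p. f p - g p) + holder2_norm \<theta> T (\<lambda>p. g p - h p)"
    using holder2_norm_add[of \<theta> T "\<lambda>p. f p - g p" "\<lambda>p. g p - h p"] by simp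
  then show ?thesis
    using assms by (subst enn2real_plus[symmetric]) (auto intro!: enn2real_mono simp: ennreal_add_eq_top less_top)
qed

lemma holder_norm_diff:
  "holder_norm \<theta> T (\<lambda>t. x t - y t)
     = holder2_norm \<theta> T (\<lambda>p. (\<lambda>(s, t). x t - x s) p - (\<lambda>(s, t). y t - y s) p)"
  unfolding holder_norm_def by (rule holder2_norm_cong) (simp add: algebra_simps)

lemma holder_norm_diff_finite:
  "\<lbrakk>x \<in> holder_paths \<theta> T; y \<in> holder_paths \<theta> T\<rbrakk> \<Longrightarrow>
     holder2_norm \<theta> T (\<lambda>p. (\<lambda>(s, t). x t - x s) p - (\<lambda>(s, t). y t - y s) p) < \<infinity>"
  by (rule holder2_norm_diff_finite) (simp_all add: holder_paths_def holder_norm_def)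

lemma Metric_space_holder: "Metric_space (holder_paths \<theta> T) (holder_dist \<theta> T)"
proof
  fix x y z :: "real \<Rightarrow> 'a"
  show "0 \<le> holder_dist \<theta> T x y"
    by (simp add: holder_dist_def)
  show "holder_dist \<theta> T x y = holder_dist \<theta> T y x"
    unfolding holder_dist_def holder_norm_diff
    by (subst holder2_norm_minus_commute) (simp add: norm_minus_commute)
  show "holder_dist \<theta> T x y = 0 \<longleftrightarrow> x = y"
    if xy: "x \<in> holder_paths \<theta> T" "y \<in> holder_paths \<theta> T"
  proof
    assume "x = y"
    then show "holder_dist \<theta> T x y = 0"
      by (simp add: holder_dist_def holder_norm_def holder2_norm_def case_prod_beta' SUP_constant bot_ennreal)
  next
    assume 0: "holder_dist \<theta> T x y = 0"
    then have "x 0 = y 0" and "enn2real (holder_norm \<theta> T (\<lambda>t. x t - y t)) = 0"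
      by (simp_all add: holder_dist_def add_nonneg_eq_0_iff)
    moreover have "holder_norm \<theta> T (\<lambda>t. x t - y t) < \<infinity>"
      unfolding holder_norm_diff using xy by (rule holder_norm_diff_finite)
    ultimately have *: "holder2_norm \<theta> T (\<lambda>(s, t). (x t - y t) - (x s - y s)) = 0"
      by (auto simp: enn2real_eq_0_iff holder_norm_def)
    have "x t = y t" if "0 \<le> t" "t \<le> T" for t
      using holder2_norm_eq_0[OF *, of 0 t] that \<open>x 0 = y 0\<close> by (cases "t = 0") auto
    then show "x = y"
      using xy by (intro extensionalityI[of x "{0..T}" y]) (auto simp: holder_paths_def)
  qed
  show "holder_dist \<theta> T x z \<le> holder_dist \<theta> T x y + holder_dist \<theta> T y z"
    if "x \<in> holder_paths \<theta> T" "y \<in> holder_paths \<theta> T" "z \<in> holder_paths \<theta> T"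
    using holder2_norm_triangle[OF holder_norm_diff_finite[OF that(1,2)] holder_norm_diff_finite[OF that(2,3)]]
      norm_triangle_ineq[of "x 0 - y 0" "y 0 - z 0"]
    unfolding holder_dist_def holder_norm_diff by simp
qed

lemma rough_paths_diag:
  assumes "(X, XX) \<in> rough_paths \<beta> T" "0 \<le> s" "s \<le> T"
  shows "X (s, s) = 0" "XX (s, s) = 0"
proof -
  have *: "X (s, t) = X (s, u) + X (u, t) \<and>
      XX (s, t) = XX (s, u) + XX (u, t) + tensor (X (s, u)) (X (u, t))"
    if "0 \<le> s" "s \<le> u" "u \<le> t" "t \<le> T" for s u t
    using assms(1) that by (simp add: rough_paths_def)
  have "X (s, s) = X (s, s) + X (s, s)"
    and XX: "XX (s, s) = XX (s, s) + XX (s, s) + tensor (X (s, s)) (X (s, s))"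
    using *[of s s s] assms by blast+
  then show X: "X (s, s) = 0" by simp
  then have "tensor (X (s, s)) (X (s, s)) = 0"
    by (simp add: tensor_def vec_eq_iff)
  then show "XX (s, s) = 0" using XX by simp
qed

lemma Metric_space_rough:
  "Metric_space (rough_paths \<beta> T :: ('d::finite) rough_path set) (rough_dist \<beta> T)"
proof
  fix A B C :: "'d rough_path"
  obtain X XX Y YY Z ZZ where [simp]: "A = (X, XX)" "B = (Y, YY)" "C = (Z, ZZ)"
    by (cases A; cases B; cases C)
  show "0 \<le> rough_dist \<beta> T A B"
    by (simp add: rough_dist_def)
  show "rough_dist \<beta> T A B = rough_dist \<beta> T B A"
    using holder2_norm_minus_commute[of \<beta> T X Y] holder2_norm_minus_commute[of "2 * \<beta>" T XX YY]
    by (simp add: rough_dist_def)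
  have fin: "holder2_norm \<beta> T (\<lambda>p. X p - Y p) < \<infinity>" "holder2_norm (2 * \<beta>) T (\<lambda>p. XX p - YY p) < \<infinity>"
    if "(X, XX) \<in> rough_paths \<beta> T" "(Y, YY) \<in> rough_paths \<beta> T"
    for X XX and Y :: "real \<times> real \<Rightarrow> real^'d" and YY
    using that holder2_norm_diff_finite[of \<beta> T X Y] holder2_norm_diff_finite[of "2 * \<beta>" T XX YY]
    by (simp_all add: rough_paths_def)
  show "rough_dist \<beta> T A B = 0 \<longleftrightarrow> A = B" if "A \<in> rough_paths \<beta> T" "B \<in> rough_paths \<beta> T"
  proof
    assume "A = B"
    then show "rough_dist \<beta> T A B = 0"
      by (simp add: rough_dist_def holder2_norm_def case_prod_beta' SUP_constant bot_ennreal)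
  next
    note mem = that[simplified]
    assume "rough_dist \<beta> T A B = 0"
    then have "enn2real (holder2_norm \<beta> T (\<lambda>p. X p - Y p)) = 0"
      and "enn2real (holder2_norm (2 * \<beta>) T (\<lambda>p. XX p - YY p)) = 0"
      by (simp_all add: rough_dist_def add_nonneg_eq_0_iff)
    with fin[OF mem] have 1: "holder2_norm \<beta> T (\<lambda>p. X p - Y p) = 0"
      and 2: "holder2_norm (2 * \<beta>) T (\<lambda>p. XX p - YY p) = 0"
      by (auto simp: enn2real_eq_0_iff)
    have "X p = Y p \<and> XX p = YY p" if p: "p \<in> simplex2 T" for p
    proof -
      obtain s t where st: "p = (s, t)" "0 \<le> s" "s \<le> t" "t \<le> T"
        using p by (auto simp: simplex2_def)
      show ?thesis
      proof (cases "s = t")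
        case True
        then show ?thesis
          using st rough_paths_diag[OF mem(1), of s] rough_paths_diag[OF mem(2), of s] by simp
      next
        case False
        then show ?thesis
          using st holder2_norm_eq_0[OF 1, of s t] holder2_norm_eq_0[OF 2, of s t] by simp
      qed
    qed
    then have "X = Y" "XX = YY"
      using mem by (auto intro!: extensionalityI[of _ "simplex2 T"] simp: rough_paths_def)
    then show "A = B" by simp
  qed
  show "rough_dist \<beta> T A C \<le> rough_dist \<beta> T A B + rough_dist \<beta> T B C"
    if "A \<in> rough_paths \<beta> T" "B \<in> rough_paths \<beta> T" "C \<in> rough_paths \<beta> T"
  proof -
    note mem = that[simplified]
    let ?a = "enn2real (holder2_norm (2 * \<beta>) T (\<lambda>p. XX p - YY p))"
    let ?b = "enn2real (holder2_norm (2 * \<beta>) T (\<lambda>p. YY p - ZZ p))"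
    have "sqrt (enn2real (holder2_norm (2 * \<beta>) T (\<lambda>p. XX p - ZZ p))) \<le> sqrt (?a + ?b)"
      by (intro real_sqrt_le_mono holder2_norm_triangle fin[OF mem(1,2)] fin[OF mem(2,3)])
    also have "\<dots> \<le> sqrt ?a + sqrt ?b"
      by (rule sqrt_add_le_add_sqrt) simp_all
    finally show ?thesis
      using holder2_norm_triangle[OF fin(1)[OF mem(1,2)] fin(1)[OF mem(2,3)]]
      by (simp add: rough_dist_def)
  qed
qed

lemma topspace_holder_minus_topology:
  assumes "0 < \<theta>"
  shows "topspace (holder_minus_topology \<theta> T) = holder_minus_paths \<theta> T"
proof -
  have "x \<in> \<Union> {{y \<in> holder_minus_paths \<theta> T. holder_dist (\<theta> - \<epsilon>) T x y < r} | x \<epsilon> r.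
        x \<in> holder_minus_paths \<theta> T \<and> 0 < \<epsilon> \<and> \<epsilon> < \<theta> \<and> 0 < r}"
    if x: "x \<in> holder_minus_paths \<theta> T" for x :: "real \<Rightarrow> 'a"
  proof -
    have "x \<in> holder_paths (\<theta> - \<theta> / 2) T"
      using x assms unfolding holder_minus_paths_def by (elim INT_D) auto
    then have "holder_dist (\<theta> - \<theta> / 2) T x x = 0"
      using Metric_space.zero[OF Metric_space_holder] by blast
    then have "x \<in> {y \<in> holder_minus_paths \<theta> T. holder_dist (\<theta> - \<theta> / 2) T x y < 1}"
      using x by simp
    moreover have "0 < \<theta> / 2" "\<theta> / 2 < \<theta>" using assms by auto
    ultimately show ?thesis
      using x zero_less_one by blast
  qed
  then show ?thesis
    unfolding holder_minus_topology_def topology_generated_by_topspace by blast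
qed

end

theory Submission
  imports Defs "HOL-Complex_Analysis.Great_Picard"
begin

text \<open>
  Points of \<open>sol_infty X\<close> are limits of solutions \<open>Z(h)\<close>, so the support lies in the closure. For the
  converse it suffices that the set-valued map \<open>X \<mapsto> sol_infty X\<close> is continuous at smooth rough paths: a
  small ball around the rough path of \<open>h\<close> has positive mass and is then sent into a given
  neighbourhood of \<open>Z(h)\<close>. This reduces to \<open>Z(h\<^sub>k) \<rightarrow> Z(h)\<close> when Lipschitz \<open>h\<^sub>k\<close> converge to a Lipschitz \<open>h\<close> in rough
  path metric. A Davie-type a priori estimate bounds the Hoelder norm of \<open>Z(h\<^sub>k)\<close> and the local expansion
  error through the rough norms of \<open>h\<^sub>k\<close> alone. Arzela--Ascoli gives limit points in all weaker Hoelder norms,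
  the expansion passes to the limit, and uniqueness identifies the limit point with \<open>Z(h)\<close>. Since all
  integrals are against Lipschitz paths, a solution can be characterised by
  \<open>Z\<^sub>t - Z\<^sub>s - \<sigma>(Z\<^sub>s, A(Z)\<^sub>s) h\<^sub>s\<^sub>,\<^sub>t = O((t - s) powr e)\<close> with \<open>e > 1\<close>, and existence follows from Euler polygons.
\<close>

section \<open>Partitions\<close>

text \<open>The obstacle is that the Lipschitz constants of the approximating drivers may blow up.
  Two devices keep them out of the limit. The integral of \<open>A Z\<close> against
  \<open>h\<close> is bounded by the variation of \<open>A Z\<close> times the oscillation of
  \<open>h\<close>, and the bound with \<open>F\<close> makes this variation proportional to the
  oscillation of \<open>Z\<close>; so the term has order 2\<beta> without a Lipschitz constant.
  Bounds that do use such a constant serve only to start an induction over scales and as the a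
  priori constant that sewing forgets. Sewing needs \<beta>(2 + \<alpha>) > 1, where \<alpha> is a
  Hoelder exponent of the derivative of \<sigma>; this is what \<gamma> > 1/\<beta> provides. Only
  one direction of the characterisation is proved, from the Euler bound to the equation: a path with
  the Euler bound exists and the equation has at most one solution, so Z(h) is that path.
  Convergence is obtained only in norms below \<beta>, and the continuity of \<open>A\<close> at
  \<open>\<beta>\<^sub>0\<close> lets the coefficients converge along.\<close>

definition mesh_below :: "real \<Rightarrow> real list \<Rightarrow> bool" where
  "mesh_below \<delta> ts \<longleftrightarrow> (\<forall>i < length ts - 1. ts ! Suc i - ts ! i < \<delta>)"

lemma mesh_below_simps [simp]:
  "mesh_below \<delta> [x]"
  "mesh_below \<delta> (x # y # zs) \<longleftrightarrow> y - x < \<delta> \<and> mesh_below \<delta> (y # zs)"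
  unfolding mesh_below_def by (auto simp: All_less_Suc2 less_Suc_eq_0_disj nth_Cons split: nat.splits)

lemma partition_sum_simps [simp]:
  "partition_sum \<Xi> [x] = 0"
  "partition_sum \<Xi> (x # y # zs) = \<Xi> x y + partition_sum \<Xi> (y # zs)"
  unfolding partition_sum_def by (simp_all add: sum.lessThan_Suc_shift del: sum.lessThan_Suc)

lemma partitions_single [simp]: "[x] \<in> partitions a b \<longleftrightarrow> x = a \<and> a = b"
  unfolding partitions_def by auto

lemma partitions_Cons_Cons [simp]:
  "x # y # zs \<in> partitions a b \<longleftrightarrow> x = a \<and> a < y \<and> y # zs \<in> partitions y b"
  unfolding partitions_def by auto

text \<open>The right end stays fixed while the left end moves, matching the recursion of
  \<open>partition_sum\<close> and \<open>mesh_below\<close> on the list; the estimates below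
  generalise the left end accordingly.\<close>

lemma partitions_induct [consumes 1, case_names single Cons]:
  assumes "ts \<in> partitions a b"
    and "P b [b]"
    and "\<And>a y zs. \<lbrakk>a < y; y # zs \<in> partitions y b; P y (y # zs)\<rbrakk> \<Longrightarrow> P a (a # y # zs)"
  shows "P a ts"
  using assms(1)
proof (induction ts arbitrary: a rule: induct_list012)
  case 1
  then show ?case by (simp add: partitions_def)
next
  case (2 x)
  then show ?case using assms(2) by simp
next
  case (3 x y zs)
  then show ?case using assms(3) by simp
qed

lemma partitions_le: "ts \<in> partitions a b \<Longrightarrow> a \<le> b"
  by (induction rule: partitions_induct) auto

lemma partitions_same: "ts \<in> partitions a a \<Longrightarrow> ts = [a]"
  by (cases ts rule: remdups_adj.cases) (auto simp: partitions_def dest: partitions_le,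
    metis last_in_set less_irrefl)

lemma partition_join:
  assumes "ts \<in> partitions a b" "ts' \<in> partitions b c"
  shows "ts @ tl ts' \<in> partitions a c"
    and "partition_sum \<Xi> (ts @ tl ts') = partition_sum \<Xi> ts + partition_sum \<Xi> ts'"
    and "mesh_below \<delta> (ts @ tl ts') \<longleftrightarrow> mesh_below \<delta> ts \<and> mesh_below \<delta> ts'"
proof -
  have ts': "b # tl ts' = ts'"
    using assms(2) by (auto simp: partitions_def)
  have "ts @ tl ts' \<in> partitions a c
      \<and> partition_sum \<Xi> (ts @ tl ts') = partition_sum \<Xi> ts + partition_sum \<Xi> ts'
      \<and> (mesh_below \<delta> (ts @ tl ts') \<longleftrightarrow> mesh_below \<delta> ts \<and> mesh_below \<delta> ts')"
    using assms(1)
    by (induction rule: partitions_induct) (auto simp: ts' assms(2) add.assoc)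
  then show "ts @ tl ts' \<in> partitions a c"
    and "partition_sum \<Xi> (ts @ tl ts') = partition_sum \<Xi> ts + partition_sum \<Xi> ts'"
    and "mesh_below \<delta> (ts @ tl ts') \<longleftrightarrow> mesh_below \<delta> ts \<and> mesh_below \<delta> ts'"
    by auto
qed

lemma mesh_below_partition_exists:
  assumes "a \<le> b" "0 < \<delta>"
  shows "\<exists>ts\<in>partitions a b. mesh_below \<delta> ts"
proof -
  have "\<exists>ts\<in>partitions a b. mesh_below \<delta> ts" if "a \<le> b" "b - a \<le> real n * (\<delta> / 2)" for n
    using that
  proof (induction n arbitrary: a)
    case 0
    then show ?case by (intro bexI[of _ "[b]"]) auto
  next
    case (Suc n)
    show ?case
    proof (cases "b - a \<le> real n * (\<delta> / 2)")
      case True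
      with Suc show ?thesis by blast
    next
      case False
      then have "a < b" using assms(2) Suc.prems
        by (metis diff_ge_0_iff_ge diff_self less_eq_real_def half_gt_zero mult_nonneg_nonneg of_nat_0_le_iff)
      \<comment> \<open>Steps of half the size keep the mesh strictly below \<open>\<delta>\<close>;
        the minimum makes the partition end exactly at \<open>b\<close>.\<close>
      define y where "y = min b (a + \<delta> / 2)"
      have y: "a < y" "y \<le> b" "y - a < \<delta>" "b - y \<le> real n * (\<delta> / 2)"
        using \<open>a < b\<close> assms(2) Suc.prems False by (auto simp: y_def min_def algebra_simps)
      then obtain ts where ts: "ts \<in> partitions y b" "mesh_below \<delta> ts"
        using Suc.IH[of y] by blast
      then obtain zs where "ts = y # zs"
        by (auto simp: partitions_def) (metis hd_Cons_tl)
      with ts y show ?thesis by (intro bexI[of _ "a # ts"]) auto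
    qed
  qed
  moreover obtain n where "b - a \<le> real n * (\<delta> / 2)"
    using reals_Archimedean3[of "\<delta> / 2"] assms(2) by (metis half_gt_zero less_imp_le)
  ultimately show ?thesis using assms(1) by blast
qed

lemma eventually_mesh_filter:
  "eventually P (mesh_filter a b) \<longleftrightarrow> (\<exists>\<delta>>0. \<forall>ts\<in>partitions a b. mesh_below \<delta> ts \<longrightarrow> P ts)"
proof -
  have "eventually P (mesh_filter a b) \<longleftrightarrow>
      (\<exists>\<delta>\<in>{0<..}. eventually P (principal {ts \<in> partitions a b. mesh_below \<delta> ts}))"
    unfolding mesh_filter_def mesh_below_def[symmetric]
  proof (rule eventually_INF_base)
    fix \<delta> \<delta>' :: real
    assume "\<delta> \<in> {0<..}" "\<delta>' \<in> {0<..}"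
    then show "\<exists>x\<in>{0<..}. principal {ts \<in> partitions a b. mesh_below x ts}
        \<le> inf (principal {ts \<in> partitions a b. mesh_below \<delta> ts})
              (principal {ts \<in> partitions a b. mesh_below \<delta>' ts})"
      by (intro bexI[of _ "min \<delta> \<delta>'"]) (auto simp: mesh_below_def)
  qed auto
  then show ?thesis
    by (auto simp: eventually_principal)
qed

lemma mesh_filter_neq_bot: "a \<le> b \<Longrightarrow> mesh_filter a b \<noteq> bot"
  using mesh_below_partition_exists[of a b]
  by (auto simp: trivial_limit_def eventually_mesh_filter)

lemma partition_sum_cong:
  assumes "ts \<in> partitions a b"
    and "\<And>u v. \<lbrakk>a \<le> u; u < v; v \<le> b\<rbrakk> \<Longrightarrow> f u v = g u v"
  shows "partition_sum f ts = partition_sum g ts"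
proof -
  have "a \<le> a' \<Longrightarrow> partition_sum f ts = partition_sum g ts" if "ts \<in> partitions a' b" for a'
    using that
  proof (induction rule: partitions_induct)
    case (Cons a' y zs)
    then show ?case
      using assms(2)[of a' y] partitions_le[OF Cons(2)] by simp
  qed simp
  then show ?thesis using assms(1) by blast
qed

lemma norm_partition_sum_le:
  fixes f :: "real \<Rightarrow> real \<Rightarrow> 'a::real_normed_vector"
  assumes "ts \<in> partitions a b" "mesh_below \<delta> ts"
    and "\<And>u v. \<lbrakk>a \<le> u; u < v; v \<le> b; v - u < \<delta>\<rbrakk> \<Longrightarrow> norm (f u v) \<le> g u v"
  shows "norm (partition_sum f ts) \<le> partition_sum g ts"
proof -
  have "a \<le> a' \<longrightarrow> mesh_below \<delta> ts \<longrightarrow> norm (partition_sum f ts) \<le> partition_sum g ts"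
    if "ts \<in> partitions a' b" for a'
    using that
  proof (induction rule: partitions_induct)
    case (Cons a' y zs)
    then show ?case
      using assms(3)[of a' y] partitions_le[OF Cons(2)]
      by (auto intro!: order_trans[OF norm_triangle_ineq] add_mono)
  qed auto
  then show ?thesis using assms by blast
qed

text \<open>The extra 1 makes the strict bound hold even for the one-cell partition, so that
  estimates restricted to short cells specialise to all cells.\<close>

lemma mesh_below_total: "ts \<in> partitions a b \<Longrightarrow> mesh_below (b - a + 1) ts"
proof -
  have "a \<le> a' \<longrightarrow> mesh_below (b - a + 1) ts" if "ts \<in> partitions a' b" for a'
    using that
  proof (induction rule: partitions_induct)
    case (Cons a' y zs)
    then show ?case
      using partitions_le[OF Cons(2)] by simp
  qed simp
  then show "ts \<in> partitions a b \<Longrightarrow> mesh_below (b - a + 1) ts" by blast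
qed

lemma partition_sum_telescope:
  fixes f :: "real \<Rightarrow> 'a::ab_group_add"
  assumes "ts \<in> partitions a b"
  shows "partition_sum (\<lambda>u v. f v - f u) ts = f b - f a"
  using assms by (induction rule: partitions_induct) auto

lemma partition_sum_add:
  "partition_sum (\<lambda>u v. f u v + g u v) ts = partition_sum f ts + partition_sum g ts"
  by (simp add: partition_sum_def sum.distrib)

lemma partition_sum_diff:
  fixes f :: "real \<Rightarrow> real \<Rightarrow> 'a::ab_group_add"
  shows "partition_sum (\<lambda>u v. f u v - g u v) ts = partition_sum f ts - partition_sum g ts"
  by (simp add: partition_sum_def sum_subtractf)

lemma partition_sum_mult_left:
  fixes c :: real
  shows "partition_sum (\<lambda>u v. c * f u v) ts = c * partition_sum f ts"
  by (simp add: partition_sum_def sum_distrib_left)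

lemma norm_partition_sum_le_mesh:
  fixes f :: "real \<Rightarrow> real \<Rightarrow> 'a::real_normed_vector"
  assumes "ts \<in> partitions a b" "mesh_below \<delta> ts"
    and "\<And>u v. \<lbrakk>a \<le> u; u < v; v \<le> b; v - u < \<delta>\<rbrakk> \<Longrightarrow> norm (f u v) \<le> c * (v - u)"
  shows "norm (partition_sum f ts) \<le> c * (b - a)"
  using norm_partition_sum_le[of ts a b \<delta> f "\<lambda>u v. c * (v - u)"] assms
    partition_sum_telescope[OF assms(1), of "\<lambda>x. x"]
  by (simp add: partition_sum_mult_left)

lemma norm_partition_sum_le_length:
  fixes f :: "real \<Rightarrow> real \<Rightarrow> 'a::real_normed_vector"
  assumes "ts \<in> partitions a b"
    and "\<And>u v. \<lbrakk>a \<le> u; u < v; v \<le> b\<rbrakk> \<Longrightarrow> norm (f u v) \<le> c * (v - u)"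
  shows "norm (partition_sum f ts) \<le> c * (b - a)"
  using norm_partition_sum_le_mesh[OF assms(1) mesh_below_total] assms by blast

section \<open>Limits of Riemann sums\<close>

text \<open>Peeling off the first cell of the coarse partition splits the fine one at the next
  coarse point. The error per cell is at most \<open>c\<close> times the cell length, and these
  errors add up.\<close>

lemma partition_refinement:
  fixes \<Xi> :: "real \<Rightarrow> real \<Rightarrow> 'a::real_normed_vector"
  assumes "ts \<in> partitions a b" "mesh_below \<delta> ts" "ts' \<in> partitions a b" "set ts \<subseteq> set ts'"
    and "\<And>u v ss. \<lbrakk>a \<le> u; u < v; v \<le> b; v - u < \<delta>; ss \<in> partitions u v\<rbrakk>
            \<Longrightarrow> norm (partition_sum \<Xi> ss - \<Xi> u v) \<le> c * (v - u)"
  shows "norm (partition_sum \<Xi> ts' - partition_sum \<Xi> ts) \<le> c * (b - a)"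
proof -
  have "a \<le> a' \<longrightarrow> mesh_below \<delta> ts \<longrightarrow> (\<forall>ts'\<in>partitions a' b. set ts \<subseteq> set ts' \<longrightarrow>
      norm (partition_sum \<Xi> ts' - partition_sum \<Xi> ts) \<le> c * (b - a'))"
    if "ts \<in> partitions a' b" for a'
    using that
  proof (induction rule: partitions_induct)
    case single
    then show ?case by (auto dest: partitions_same)
  next
    case (Cons a' y zs)
    show ?case
    proof (intro impI ballI)
      fix ts' assume a: "a \<le> a'" "mesh_below \<delta> (a' # y # zs)" "ts' \<in> partitions a' b"
        "set (a' # y # zs) \<subseteq> set ts'"
      then obtain pre post where ts': "ts' = pre @ y # post"
        using split_list[of y ts'] by auto
      have sorted: "sorted_wrt (<) ts'" and hd: "hd ts' = a'" and last: "last ts' = b"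
        using a by (auto simp: partitions_def)
      have 1: "pre @ [y] \<in> partitions a' y" and 2: "y # post \<in> partitions y b"
        using sorted hd last Cons(1) unfolding partitions_def ts'
        by (auto simp: sorted_wrt_append hd_append split: if_splits)
      have "sorted_wrt (<) (y # zs)"
        using Cons(2) by (auto simp: partitions_def)
      then have "set (y # zs) \<subseteq> set (y # post)"
        using a(4) sorted unfolding ts' by (fastforce simp: sorted_wrt_append)
      then have IH: "norm (partition_sum \<Xi> (y # post) - partition_sum \<Xi> (y # zs)) \<le> c * (b - y)"
        using Cons(3) Cons(1) a 2 by auto
      have "norm (partition_sum \<Xi> (pre @ [y]) - \<Xi> a' y) \<le> c * (y - a')"
        using assms(5)[OF a(1) Cons(1) partitions_le[OF Cons(2)] _ 1] a(2) by simp
      moreover have "partition_sum \<Xi> ts' = partition_sum \<Xi> (pre @ [y]) + partition_sum \<Xi> (y # post)"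
        using partition_join(2)[OF 1 2, of \<Xi>] by (simp add: ts')
      ultimately have "norm (partition_sum \<Xi> ts' - partition_sum \<Xi> (a' # y # zs))
          \<le> c * (y - a') + c * (b - y)"
        using IH norm_triangle_ineq[of "partition_sum \<Xi> (pre @ [y]) - \<Xi> a' y"
            "partition_sum \<Xi> (y # post) - partition_sum \<Xi> (y # zs)"]
        by (simp add: algebra_simps)
      then show "norm (partition_sum \<Xi> ts' - partition_sum \<Xi> (a' # y # zs)) \<le> c * (b - a')"
        by (simp add: algebra_simps)
    qed
  qed
  then show ?thesis using assms by blast
qed

lemma common_refinement:
  assumes "ts \<in> partitions a b" "ts' \<in> partitions a b"
  obtains us where "us \<in> partitions a b" "set ts \<subseteq> set us" "set ts' \<subseteq> set us"
proof
  let ?us = "sorted_list_of_set (set ts \<union> set ts')"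
  have bounds: "a \<in> set ss \<and> b \<in> set ss \<and> set ss \<subseteq> {a..b}" if "ss \<in> partitions a b" for ss
    using that by (induction rule: partitions_induct) (auto dest: partitions_le)
  have set: "set ?us = set ts \<union> set ts'" by simp
  have sorted: "sorted_wrt (<) ?us" by (rule strict_sorted_list_of_set)
  have ne: "?us \<noteq> []" using bounds[OF assms(1)] set by (metis empty_iff empty_set Un_iff)
  have hd: "hd ?us = a"
  proof -
    have "a \<in> set ?us" using bounds[OF assms(1)] set by auto
    then have "hd ?us \<le> a"
      using sorted ne by (cases ?us) auto
    moreover have "hd ?us \<in> set ?us" using ne by (rule hd_in_set)
    then have "a \<le> hd ?us" unfolding set using bounds[OF assms(1)] bounds[OF assms(2)] by auto
    ultimately show ?thesis by simp
  qed
  have last: "last ?us = b"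
  proof -
    have "b \<in> set ?us" using bounds[OF assms(1)] set by auto
    then have "b \<le> last ?us"
      using sorted ne by (cases ?us rule: rev_cases) (auto simp: sorted_wrt_append)
    moreover have "last ?us \<in> set ?us" using ne by (rule last_in_set)
    then have "last ?us \<le> b" unfolding set using bounds[OF assms(1)] bounds[OF assms(2)] by auto
    ultimately show ?thesis by simp
  qed
  show "?us \<in> partitions a b"
    unfolding partitions_def using ne hd last sorted by simp
  show "set ts \<subseteq> set ?us" "set ts' \<subseteq> set ?us"
    using set by auto
qed

text \<open>Cauchy criterion for the mesh filter: two fine partitions are both compared with a
  common refinement through \<open>partition_refinement\<close>. A sequence of partitions with mesh
  below 1/(n+1) then supplies the limit.\<close>

lemma riemann_sum_convergent:
  fixes \<Xi> :: "real \<Rightarrow> real \<Rightarrow> 'a::banach"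
  assumes "a \<le> b"
    and small: "\<And>c. 0 < c \<Longrightarrow> \<exists>\<delta>>0. \<forall>u v. \<forall>ss\<in>partitions u v. a \<le> u \<longrightarrow> u < v \<longrightarrow> v \<le> b \<longrightarrow> v - u < \<delta> \<longrightarrow>
            norm (partition_sum \<Xi> ss - \<Xi> u v) \<le> c * (v - u)"
  shows "\<exists>I. (partition_sum \<Xi> \<longlongrightarrow> I) (mesh_filter a b)"
proof -
  define close where "close \<delta> e \<longleftrightarrow> (\<forall>ts\<in>partitions a b. \<forall>ts'\<in>partitions a b. mesh_below \<delta> ts \<longrightarrow> mesh_below \<delta> ts' \<longrightarrow>
    dist (partition_sum \<Xi> ts) (partition_sum \<Xi> ts') < e)" for \<delta> e
  have cauchy: "\<exists>\<delta>>0. close \<delta> e" if "0 < e" for e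
  proof -
    \<comment> \<open>The summand 1 keeps the constant positive when a = b.\<close>
    define c where "c = e / (4 * (b - a + 1))"
    have "0 < c" using assms(1) that by (simp add: c_def)
    then obtain \<delta> where "0 < \<delta>" and \<delta>: "\<And>u v ss. \<lbrakk>a \<le> u; u < v; v \<le> b; v - u < \<delta>; ss \<in> partitions u v\<rbrakk>
            \<Longrightarrow> norm (partition_sum \<Xi> ss - \<Xi> u v) \<le> c * (v - u)"
      using small by metis
    have c: "c * (b - a) \<le> e / 4"
      using assms(1) that by (simp add: c_def field_simps)
    show ?thesis
      unfolding close_def
    proof (intro exI[of _ \<delta>] conjI ballI impI \<open>0 < \<delta>\<close>)
      fix ts ts' assume ts: "ts \<in> partitions a b" "mesh_below \<delta> ts"
        and ts': "ts' \<in> partitions a b" "mesh_below \<delta> ts'"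
      obtain us where us: "us \<in> partitions a b" "set ts \<subseteq> set us" "set ts' \<subseteq> set us"
        using common_refinement[OF ts(1) ts'(1)] .
      have "dist (partition_sum \<Xi> us) (partition_sum \<Xi> ts) \<le> e / 4"
        using partition_refinement[OF ts us(1,2) \<delta>] c by (simp add: dist_norm)
      moreover have "dist (partition_sum \<Xi> us) (partition_sum \<Xi> ts') \<le> e / 4"
        using partition_refinement[OF ts' us(1,3) \<delta>] c by (simp add: dist_norm)
      ultimately show "dist (partition_sum \<Xi> ts) (partition_sum \<Xi> ts') < e"
        using dist_triangle3[of "partition_sum \<Xi> ts" "partition_sum \<Xi> ts'" "partition_sum \<Xi> us"] that
        by linarith
    qed
  qed
  obtain t where t: "\<And>n. t n \<in> partitions a b" "\<And>n. mesh_below (1 / real (Suc n)) (t n)"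
    using mesh_below_partition_exists[OF assms(1), of "1 / real (Suc _)"]
    by (metis divide_pos_pos of_nat_0_less_iff zero_less_Suc zero_less_one)
  have fine: "\<exists>N. \<forall>n\<ge>N. mesh_below \<delta> (t n)" if pos: "0 < \<delta>" for \<delta>
  proof -
    obtain N where N: "1 / real (Suc N) < \<delta>"
      using nat_approx_posE[OF pos] by metis
    have "mesh_below \<delta> (t n)" if "N \<le> n" for n
    proof -
      have "1 / real (Suc n) \<le> 1 / real (Suc N)"
        using that by (simp add: frac_le)
      then show ?thesis
        using t(2)[of n] N unfolding mesh_below_def by (meson less_le_trans less_trans)
    qed
    then show ?thesis by blast
  qed
  have "Cauchy (\<lambda>n. partition_sum \<Xi> (t n))"
    unfolding Cauchy_def
  proof (intro allI impI)
    fix e :: real assume "0 < e"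
    then obtain \<delta> where \<delta>: "\<delta> > 0" "close \<delta> e" using cauchy by blast
    then show "\<exists>M. \<forall>m\<ge>M. \<forall>n\<ge>M. dist (partition_sum \<Xi> (t m)) (partition_sum \<Xi> (t n)) < e"
      using fine[OF \<delta>(1)] t(1) unfolding close_def by meson
  qed
  then obtain I where I: "(\<lambda>n. partition_sum \<Xi> (t n)) \<longlonglongrightarrow> I"
    using Cauchy_convergent_iff convergent_def by blast
  have "(partition_sum \<Xi> \<longlongrightarrow> I) (mesh_filter a b)"
  proof (rule tendstoI)
    fix e :: real assume "0 < e"
    then obtain \<delta> where \<delta>: "\<delta> > 0" "close \<delta> (e / 2)" using cauchy[of "e / 2"] by auto
    obtain N where N: "\<forall>n\<ge>N. mesh_below \<delta> (t n)" using fine[OF \<delta>(1)] by blast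
    obtain N' where N': "\<forall>n\<ge>N'. dist (partition_sum \<Xi> (t n)) I < e / 2"
      using I \<open>0 < e\<close> unfolding lim_sequentially by (meson half_gt_zero)
    have "dist (partition_sum \<Xi> ts) I < e" if "ts \<in> partitions a b" "mesh_below \<delta> ts" for ts
    proof -
      let ?n = "max N N'"
      have "dist (partition_sum \<Xi> ts) (partition_sum \<Xi> (t ?n)) < e / 2"
        using \<delta>(2) that t(1) N unfolding close_def by (metis max.cobounded1)
      moreover have "dist (partition_sum \<Xi> (t ?n)) I < e / 2" using N' by simp
      ultimately show ?thesis
        using dist_triangle[of "partition_sum \<Xi> ts" I "partition_sum \<Xi> (t ?n)"] by linarith
    qed
    then show "\<forall>\<^sub>F ts in mesh_filter a b. dist (partition_sum \<Xi> ts) I < e"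
      unfolding eventually_mesh_filter using \<delta>(1) by blast
  qed
  then show ?thesis by blast
qed

text \<open>One fine partition of [a,b], prefixed to every fine partition of [b,c], turns
  convergence on [a,c] into convergence on [b,c].\<close>

lemma riemann_sum_tendsto_diff:
  fixes \<Xi> :: "real \<Rightarrow> real \<Rightarrow> 'a::real_normed_vector"
  assumes "a \<le> b" "(partition_sum \<Xi> \<longlongrightarrow> I) (mesh_filter a b)" "(partition_sum \<Xi> \<longlongrightarrow> J) (mesh_filter a c)"
  shows "(partition_sum \<Xi> \<longlongrightarrow> J - I) (mesh_filter b c)"
proof (rule tendstoI)
  fix e :: real assume "0 < e"
  then have "\<forall>\<^sub>F ts in mesh_filter a b. dist (partition_sum \<Xi> ts) I < e / 2"
    and "\<forall>\<^sub>F ts in mesh_filter a c. dist (partition_sum \<Xi> ts) J < e / 2"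
    using tendstoD[OF assms(2), of "e / 2"] tendstoD[OF assms(3), of "e / 2"] by auto
  then obtain \<delta> \<delta>' where \<delta>: "0 < \<delta>" "\<And>ts. ts \<in> partitions a b \<Longrightarrow> mesh_below \<delta> ts \<Longrightarrow> dist (partition_sum \<Xi> ts) I < e / 2"
    and \<delta>': "0 < \<delta>'" "\<And>ts. ts \<in> partitions a c \<Longrightarrow> mesh_below \<delta>' ts \<Longrightarrow> dist (partition_sum \<Xi> ts) J < e / 2"
    unfolding eventually_mesh_filter by blast
  obtain ts where "ts \<in> partitions a b" "mesh_below (min \<delta> \<delta>') ts"
    using mesh_below_partition_exists[OF assms(1), of "min \<delta> \<delta>'"] \<delta> \<delta>' by auto
  then have ts: "ts \<in> partitions a b" "mesh_below \<delta> ts" "mesh_below \<delta>' ts"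
    by (auto simp: mesh_below_def)
  have "dist (partition_sum \<Xi> ts') (J - I) < e" if "ts' \<in> partitions b c" "mesh_below \<delta>' ts'" for ts'
  proof -
    have "dist (partition_sum \<Xi> ts + partition_sum \<Xi> ts') J < e / 2"
      using \<delta>'(2)[of "ts @ tl ts'"] partition_join[OF ts(1) that(1)] ts that by metis
    moreover have "dist (partition_sum \<Xi> ts) I < e / 2"
      using \<delta>(2) ts by blast
    moreover have "partition_sum \<Xi> ts' - (J - I) = (partition_sum \<Xi> ts + partition_sum \<Xi> ts' - J) - (partition_sum \<Xi> ts - I)"
      by simp
    ultimately show ?thesis
      unfolding dist_norm by (metis norm_triangle_ineq4 order_le_less_trans add_strict_mono field_sum_of_halves)
  qed
  then show "\<forall>\<^sub>F ts in mesh_filter b c. dist (partition_sum \<Xi> ts) (J - I) < e"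
    unfolding eventually_mesh_filter using \<delta>'(1) by blast
qed

section \<open>Hoelder bounds\<close>

definition hoelder_on :: "real \<Rightarrow> real \<Rightarrow> real \<Rightarrow> real \<Rightarrow> (real \<Rightarrow> 'a::real_normed_vector) \<Rightarrow> bool" where
  "hoelder_on a b C e x \<longleftrightarrow> (\<forall>u v. a \<le> u \<and> u \<le> v \<and> v \<le> b \<longrightarrow> norm (x v - x u) \<le> C * (v - u) powr e)"

lemma hoelder_onD: "\<lbrakk>hoelder_on a b C e x; a \<le> u; u \<le> v; v \<le> b\<rbrakk> \<Longrightarrow> norm (x v - x u) \<le> C * (v - u) powr e"
  by (simp add: hoelder_on_def)

lemma lipschitz_onD: "\<lbrakk>hoelder_on a b C 1 x; a \<le> u; u \<le> v; v \<le> b\<rbrakk> \<Longrightarrow> norm (x v - x u) \<le> C * (v - u)"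
  using hoelder_onD[of a b C 1 x u v] by (simp add: powr_one_gt_zero_iff)

lemma hoelder_on_subset: "\<lbrakk>hoelder_on a b C e x; a \<le> a'; b' \<le> b\<rbrakk> \<Longrightarrow> hoelder_on a' b' C e x"
  by (auto simp: hoelder_on_def)

lemma holder2_norm_le_iff:
  assumes "0 \<le> C"
  shows "holder2_norm \<theta> T g \<le> ennreal C \<longleftrightarrow>
    (\<forall>s t. 0 \<le> s \<longrightarrow> s < t \<longrightarrow> t \<le> T \<longrightarrow> norm (g (s, t)) \<le> C * (t - s) powr \<theta>)"
proof -
  have "holder2_norm \<theta> T g \<le> ennreal C \<longleftrightarrow>
    (\<forall>s t. 0 \<le> s \<longrightarrow> s < t \<longrightarrow> t \<le> T \<longrightarrow> norm (g (s, t)) / (t - s) powr \<theta> \<le> C)"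
    unfolding holder2_norm_def using assms by (auto simp: SUP_le_iff ennreal_le_iff)
  also have "\<dots> \<longleftrightarrow> (\<forall>s t. 0 \<le> s \<longrightarrow> s < t \<longrightarrow> t \<le> T \<longrightarrow> norm (g (s, t)) \<le> C * (t - s) powr \<theta>)"
    by (intro all_cong1 imp_cong refl) (simp add: divide_le_eq)
  finally show ?thesis .
qed

lemma holder2_norm_finite_iff:
  "holder2_norm \<theta> T g < \<infinity> \<longleftrightarrow>
    (\<exists>C\<ge>0. \<forall>s t. 0 \<le> s \<longrightarrow> s < t \<longrightarrow> t \<le> T \<longrightarrow> norm (g (s, t)) \<le> C * (t - s) powr \<theta>)"
proof
  assume "holder2_norm \<theta> T g < \<infinity>"
  then have "holder2_norm \<theta> T g \<le> ennreal (enn2real (holder2_norm \<theta> T g))"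
    by (simp add: less_top)
  then show "\<exists>C\<ge>0. \<forall>s t. 0 \<le> s \<longrightarrow> s < t \<longrightarrow> t \<le> T \<longrightarrow> norm (g (s, t)) \<le> C * (t - s) powr \<theta>"
    by (subst (asm) holder2_norm_le_iff) (auto intro!: exI[of _ "enn2real (holder2_norm \<theta> T g)"])
next
  assume "\<exists>C\<ge>0. \<forall>s t. 0 \<le> s \<longrightarrow> s < t \<longrightarrow> t \<le> T \<longrightarrow> norm (g (s, t)) \<le> C * (t - s) powr \<theta>"
  then obtain C where "C \<ge> 0" "\<forall>s t. 0 \<le> s \<longrightarrow> s < t \<longrightarrow> t \<le> T \<longrightarrow> norm (g (s, t)) \<le> C * (t - s) powr \<theta>"
    by blast
  then have "holder2_norm \<theta> T g \<le> ennreal C"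
    by (subst holder2_norm_le_iff) auto
  then show "holder2_norm \<theta> T g < \<infinity>"
    by (metis ennreal_less_top infinity_ennreal_def le_less_trans)
qed

lemma norm_le_holder2_norm:
  assumes "holder2_norm \<theta> T g < \<infinity>" "enn2real (holder2_norm \<theta> T g) \<le> C"
    and "0 \<le> s" "s < t" "t \<le> T"
  shows "norm (g (s, t)) \<le> C * (t - s) powr \<theta>"
proof -
  have "0 \<le> C" using assms(2) enn2real_nonneg order_trans by blast
  moreover have "holder2_norm \<theta> T g \<le> ennreal C"
    using assms(1,2) by (metis ennreal_enn2real ennreal_leI infinity_ennreal_def less_top)
  ultimately show ?thesis
    using assms(3-) by (simp add: holder2_norm_le_iff)
qed

lemma holder_paths_iff:
  "x \<in> holder_paths \<theta> T \<longleftrightarrow> x \<in> extensional {0..T} \<and> (\<exists>C\<ge>0. hoelder_on 0 T C \<theta> x)"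
proof -
  have "(\<forall>s t. 0 \<le> s \<longrightarrow> s < t \<longrightarrow> t \<le> T \<longrightarrow> norm (x t - x s) \<le> C * (t - s) powr \<theta>) \<longleftrightarrow> hoelder_on 0 T C \<theta> x"
    if "0 \<le> C" for C
    unfolding hoelder_on_def
    by (smt (verit, best) that diff_self norm_zero mult_nonneg_nonneg powr_ge_zero)
  then show ?thesis
    unfolding holder_paths_def holder_norm_def holder2_norm_finite_iff by auto
qed

text \<open>Trades a larger exponent for a power of the interval length; this is how estimates on
  [0,T] are brought to a common exponent.\<close>

lemma powr_le_powr_interval:
  fixes x T :: real
  assumes "0 \<le> x" "x \<le> T" "e \<le> e'"
  shows "x powr e' \<le> T powr (e' - e) * x powr e"
proof (cases "x = 0")
  case False
  then have "x powr e' = x powr (e' - e) * x powr e"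
    by (simp add: powr_add[symmetric])
  also have "\<dots> \<le> T powr (e' - e) * x powr e"
    using assms by (intro mult_right_mono powr_mono2) auto
  finally show ?thesis .
qed simp

lemma hoelder_on_weaken:
  assumes "hoelder_on 0 T C e' x" "e \<le> e'" "0 \<le> C"
  shows "hoelder_on 0 T (C * T powr (e' - e)) e x"
  unfolding hoelder_on_def
proof (intro allI impI)
  fix u v assume uv: "0 \<le> u \<and> u \<le> v \<and> v \<le> T"
  then have "norm (x v - x u) \<le> C * (v - u) powr e'"
    using hoelder_onD[OF assms(1)] by auto
  also have "\<dots> \<le> C * (T powr (e' - e) * (v - u) powr e)"
    using uv assms by (intro mult_left_mono powr_le_powr_interval) auto
  finally show "norm (x v - x u) \<le> C * T powr (e' - e) * (v - u) powr e"
    by (simp add: mult.assoc)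
qed

lemma holder_paths_mono:
  assumes "x \<in> holder_paths e' T" "e \<le> e'"
  shows "x \<in> holder_paths e T"
  using assms hoelder_on_weaken unfolding holder_paths_iff
  by (metis mult_nonneg_nonneg powr_ge_zero)

section \<open>Tensors\<close>

lemma norm_tensor: "norm (tensor x y) = norm x * norm y"
proof -
  have "tensor x y $ i = (x $ i) *\<^sub>R y" for i
    by (simp add: tensor_def vec_eq_iff)
  then have "norm (tensor x y) = L2_set (\<lambda>i. norm (x $ i) * norm y) UNIV"
    by (simp add: norm_vec_def[of "tensor x y"])
  also have "\<dots> = L2_set (\<lambda>i. norm (x $ i)) UNIV * norm y"
    by (simp add: L2_set_left_distrib)
  finally show ?thesis
    by (simp add: norm_vec_def[of x])
qed

lemma bounded_bilinear_tensor: "bounded_bilinear tensor"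
proof
  show "\<exists>K. \<forall>a b. norm (tensor a b) \<le> norm a * norm b * K"
    by (rule exI[of _ 1]) (simp add: norm_tensor)
qed (auto simp: tensor_def vec_eq_iff algebra_simps)

interpretation tensor: bounded_bilinear tensor
  by (rule bounded_bilinear_tensor)

lemma tensor_apply_add: "tensor_apply L (M + N) = tensor_apply L M + tensor_apply L N"
  by (simp add: tensor_apply_def scaleR_add_left sum.distrib)

lemma tensor_apply_diff_left:
  "tensor_apply L M - tensor_apply L' M = tensor_apply (\<lambda>v. L v - L' v) M"
  by (simp add: tensor_apply_def minus_blinfun.rep_eq scaleR_diff_right sum_subtractf)

text \<open>\<open>tensor_apply\<close> sees only basis vectors, so linearity of \<open>L\<close> is
  what makes it act on rank-one tensors as intended. It evaluates the rank-one terms of the two Chen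
  relations in \<open>germ_defect\<close>.\<close>

lemma tensor_apply_tensor:
  assumes "linear L"
  shows "tensor_apply L (tensor x y) = blinfun_apply (L x) y"
proof -
  have x: "x = (\<Sum>i\<in>UNIV. x $ i *\<^sub>R axis i 1)" and y: "y = (\<Sum>i\<in>UNIV. y $ i *\<^sub>R axis i 1)"
    using basis_expansion[of x] basis_expansion[of y] by (simp_all add: scalar_mult_eq_scaleR)
  have "blinfun_apply (L x) y = (\<Sum>i\<in>UNIV. x $ i *\<^sub>R blinfun_apply (L (axis i 1)) y)"
    by (subst x) (simp add: linear_sum[OF assms] linear_scale[OF assms] blinfun.sum_left blinfun.scaleR_left)
  also have "\<dots> = (\<Sum>i\<in>UNIV. x $ i *\<^sub>R (\<Sum>j\<in>UNIV. y $ j *\<^sub>R blinfun_apply (L (axis i 1)) (axis j 1)))"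
    using arg_cong[OF y, of "blinfun_apply (L (axis _ 1))"]
    by (simp only: blinfun.sum_right blinfun.scaleR_right)
  finally show ?thesis
    by (simp add: tensor_apply_def tensor_def scaleR_sum_right)
qed

lemma norm_tensor_apply_le:
  fixes L :: "real^'a \<Rightarrow> (real^'d) \<Rightarrow>\<^sub>L (real^'n)"
  assumes "\<And>v. norm (L v) \<le> K * norm v"
  shows "norm (tensor_apply L M) \<le> real CARD('a) * real CARD('d) * K * norm M"
proof -
  have "norm ((M $ i $ j) *\<^sub>R blinfun_apply (L (axis i 1)) (axis j 1)) \<le> K * norm M" for i j
  proof -
    have "norm (L (axis i 1)) \<le> K"
      using assms[of "axis i 1"] by (simp add: norm_axis_1)
    then have "norm (blinfun_apply (L (axis i 1)) (axis j 1)) \<le> K"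
      using norm_blinfun[of "L (axis i 1)" "axis j 1"] by (simp add: norm_axis_1)
    moreover have "\<bar>M $ i $ j\<bar> \<le> norm M"
      using Finite_Cartesian_Product.norm_nth_le[of "M $ i" j] Finite_Cartesian_Product.norm_nth_le[of M i] by simp
    ultimately show ?thesis
      using mult_mono[of "\<bar>M $ i $ j\<bar>" "norm M" "norm (blinfun_apply (L (axis i 1)) (axis j 1))" K]
      by (simp add: mult.commute)
  qed
  then have "norm (tensor_apply L M) \<le> (\<Sum>i\<in>(UNIV::'a set). \<Sum>j\<in>(UNIV::'d set). K * norm M)"
    unfolding tensor_apply_def by (intro sum_norm_le) auto
  then show ?thesis by simp
qed

section \<open>Riemann--Stieltjes integrals against Lipschitz paths\<close>

text \<open>Young integration with one Lipschitz factor. The Lipschitz constant \<open>H\<close>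
  guarantees that the integral exists; it enters the bound \<open>norm_integral_le\<close> but not
  \<open>norm_integral_le_variation\<close>.\<close>

locale stieltjes =
  fixes s t b C H :: real and \<Psi> :: "real \<Rightarrow> real^'a" and h :: "real \<Rightarrow> real^'d"
    and X :: "real \<times> real \<Rightarrow> real^'d"
  assumes b: "0 < b" and \<Psi>: "hoelder_on s t C b \<Psi>" and h: "hoelder_on s t H 1 h"
    and C: "0 \<le> C" and H: "0 \<le> H"
    and X: "\<And>u v. \<lbrakk>s \<le> u; u \<le> v; v \<le> t\<rbrakk> \<Longrightarrow> X (u, v) = h v - h u"
begin

abbreviation riemann_sum :: "real^'a \<Rightarrow> real list \<Rightarrow> real^'d^'a" where
  "riemann_sum p \<equiv> partition_sum (\<lambda>u v. tensor (\<Psi> u - p) (X (u, v)))"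

lemma subinterval: "\<lbrakk>s \<le> s'; t' \<le> t\<rbrakk> \<Longrightarrow> stieltjes s' t' b C H \<Psi> h X"
  using b C H X \<Psi> h by unfold_locales (auto simp: hoelder_on_def)

lemma constant_sum:
  assumes "ss \<in> partitions u v" "s \<le> u" "v \<le> t"
  shows "partition_sum (\<lambda>x y. tensor p (X (x, y))) ss = tensor p (h v - h u)"
proof -
  have "partition_sum (\<lambda>x y. tensor p (X (x, y))) ss = partition_sum (\<lambda>x y. tensor p (h y) - tensor p (h x)) ss"
    using assms by (intro partition_sum_cong[of ss u v]) (auto simp: X tensor.diff_right)
  then show ?thesis
    using partition_sum_telescope[OF assms(1), of "\<lambda>x. tensor p (h x)"] by (simp add: tensor.diff_right)
qed

lemma sum_change_base:
  assumes "ss \<in> partitions u v" "s \<le> u" "v \<le> t"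
  shows "riemann_sum p ss = riemann_sum q ss + tensor (q - p) (h v - h u)"
proof -
  have "(\<lambda>x y. tensor (\<Psi> x - p) (X (x, y)))
      = (\<lambda>x y. tensor (\<Psi> x - q) (X (x, y)) + tensor (q - p) (X (x, y)))"
    by (simp add: tensor.add_left[symmetric])
  then show ?thesis
    by (simp add: partition_sum_add constant_sum[OF assms])
qed

text \<open>With base \<open>\<Psi> u\<close> the sum is exactly the deviation of a Riemann sum on
  [u,v] from its one-cell value, whatever base point that sum uses, by
  \<open>sum_change_base\<close>.\<close>

lemma sum_near_germ:
  assumes "ss \<in> partitions u v" "s \<le> u" "v \<le> t"
  shows "norm (riemann_sum (\<Psi> u) ss) \<le> C * H * (v - u) powr b * (v - u)"
proof (rule norm_partition_sum_le_length[OF assms(1)])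
  fix x y assume xy: "u \<le> x" "x < y" "y \<le> v"
  have "norm (\<Psi> x - \<Psi> u) \<le> C * (x - u) powr b"
    using hoelder_onD[OF \<Psi>] xy assms by auto
  also have "\<dots> \<le> C * (v - u) powr b"
    using xy C b by (intro mult_left_mono powr_mono2) auto
  finally have 1: "norm (\<Psi> x - \<Psi> u) \<le> C * (v - u) powr b" .
  have 2: "norm (X (x, y)) \<le> H * (y - x)"
    using lipschitz_onD[OF h] xy assms by (simp add: X)
  show "norm (tensor (\<Psi> x - \<Psi> u) (X (x, y))) \<le> C * H * (v - u) powr b * (y - x)"
    unfolding norm_tensor
    by (rule order_trans[OF mult_mono[OF 1 2]]) (use C in \<open>auto simp: mult_ac\<close>)
qed

lemma tendsto_integral:
  assumes "s \<le> t"
  shows "(riemann_sum (\<Psi> s) \<longlongrightarrow> tensor_integral \<Psi> X s t) (mesh_filter s t)"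
proof -
  let ?\<Xi> = "\<lambda>u v. tensor (\<Psi> u - \<Psi> s) (X (u, v))"
  have near: "norm (partition_sum ?\<Xi> ss - ?\<Xi> u v) \<le> C * H * (v - u) powr b * (v - u)"
    if "ss \<in> partitions u v" "s \<le> u" "u < v" "v \<le> t" for u v ss
    using sum_near_germ[OF that(1,2,4)] sum_change_base[OF that(1,2,4), of "\<Psi> s" "\<Psi> u"] that
    by (simp add: X)
  have "\<exists>\<delta>>0. \<forall>u v. \<forall>ss\<in>partitions u v. s \<le> u \<longrightarrow> u < v \<longrightarrow> v \<le> t \<longrightarrow> v - u < \<delta> \<longrightarrow>
            norm (partition_sum ?\<Xi> ss - ?\<Xi> u v) \<le> c * (v - u)" if "0 < c" for c
  proof (intro exI conjI allI ballI impI)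
    \<comment> \<open>Chosen so that C * H * (v - u)^b stays below \<open>c\<close>; the summand 1
      covers the case C * H = 0.\<close>
    let ?\<delta> = "(c / (C * H + 1)) powr (1 / b)"
    have pos: "0 < C * H + 1" using C H by (simp add: add_nonneg_pos)
    show "0 < ?\<delta>" using that pos by simp
    fix u v ss assume *: "ss \<in> partitions u v" "s \<le> u" "u < v" "v \<le> t" "v - u < ?\<delta>"
    have "(v - u) powr b \<le> ?\<delta> powr b"
      using * b by (intro powr_mono2) auto
    also have "\<dots> = c / (C * H + 1)"
      using b that pos by (simp add: powr_powr)
    finally have "C * H * (v - u) powr b \<le> C * H * (c / (C * H + 1))"
      using C H by (intro mult_left_mono) auto
    also have "\<dots> \<le> c"
      using C H that pos by (simp add: field_simps)
    finally show "norm (partition_sum ?\<Xi> ss - ?\<Xi> u v) \<le> c * (v - u)"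
      using near[OF *(1-4)] * by (meson mult_right_mono order_trans diff_ge_0_iff_ge less_imp_le)
  qed
  then obtain I where "(partition_sum ?\<Xi> \<longlongrightarrow> I) (mesh_filter s t)"
    using riemann_sum_convergent[OF assms, of ?\<Xi>] by blast
  then show ?thesis
    unfolding tensor_integral_def using tendsto_Lim[OF mesh_filter_neq_bot[OF assms]] by fastforce
qed

lemma norm_integral_le_of_sums:
  assumes "s \<le> t"
    and "\<And>ss. ss \<in> partitions s t \<Longrightarrow> norm (riemann_sum (\<Psi> s) ss) \<le> K"
  shows "norm (tensor_integral \<Psi> X s t) \<le> K"
proof (rule tendsto_upperbound[OF tendsto_norm[OF tendsto_integral[OF assms(1)]]])
  show "\<forall>\<^sub>F ss in mesh_filter s t. norm (riemann_sum (\<Psi> s) ss) \<le> K"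
    unfolding eventually_mesh_filter using assms(2) by (intro exI[of _ 1]) auto
  show "mesh_filter s t \<noteq> bot" using mesh_filter_neq_bot[OF assms(1)] .
qed

lemma norm_integral_le:
  assumes "s \<le> t"
  shows "norm (tensor_integral \<Psi> X s t) \<le> C * H * (t - s) powr (1 + b)"
proof (rule norm_integral_le_of_sums[OF assms])
  fix ss assume "ss \<in> partitions s t"
  then show "norm (riemann_sum (\<Psi> s) ss) \<le> C * H * (t - s) powr (1 + b)"
    using sum_near_germ[of ss s t] assms b by (auto simp: powr_add powr_one_gt_zero_iff mult_ac)
qed

text \<open>Summation by parts moves the increments onto \<open>\<Psi>\<close>.\<close>

lemma norm_integral_le_variation:
  assumes "s \<le> t" "0 \<le> V"
    and V: "\<And>ss. ss \<in> partitions s t \<Longrightarrow> partition_sum (\<lambda>u v. norm (\<Psi> v - \<Psi> u)) ss \<le> V"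
    and N: "\<And>u. \<lbrakk>s \<le> u; u \<le> t\<rbrakk> \<Longrightarrow> norm (h t - h u) \<le> N"
  shows "norm (tensor_integral \<Psi> X s t) \<le> V * N"
proof (rule norm_integral_le_of_sums[OF assms(1)])
  fix ss assume ss: "ss \<in> partitions s t"
  define G where "G u = tensor (\<Psi> u - \<Psi> s) (h t - h u)" for u
  have "0 \<le> N" using N[of t] assms(1) by simp
  have "riemann_sum (\<Psi> s) ss
      = partition_sum (\<lambda>u v. tensor (\<Psi> v - \<Psi> u) (h t - h v) - (G v - G u)) ss"
    by (rule partition_sum_cong[OF ss])
      (simp add: X G_def tensor.diff_left tensor.diff_right algebra_simps)
  also have "\<dots> = partition_sum (\<lambda>u v. tensor (\<Psi> v - \<Psi> u) (h t - h v)) ss - (G t - G s)"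
    by (simp add: partition_sum_diff[of _ "\<lambda>u v. G v - G u"] partition_sum_telescope[OF ss])
  also have "G t - G s = 0" by (simp add: G_def tensor.zero_left tensor.zero_right)
  also have "norm (partition_sum (\<lambda>u v. tensor (\<Psi> v - \<Psi> u) (h t - h v)) ss - 0)
      \<le> partition_sum (\<lambda>u v. N * norm (\<Psi> v - \<Psi> u)) ss"
    unfolding diff_0_right
    by (rule norm_partition_sum_le[OF ss mesh_below_total[OF ss]])
      (use N in \<open>auto simp: norm_tensor mult.commute[of N] intro!: mult_left_mono\<close>)
  also have "\<dots> \<le> N * V"
    unfolding partition_sum_mult_left using V[OF ss] \<open>0 \<le> N\<close> by (rule mult_left_mono)
  finally show "norm (riemann_sum (\<Psi> s) ss) \<le> V * N"
    by (simp add: mult.commute)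
qed

text \<open>Chen's relation for the mixed integral: moving the base point from
  \<open>\<Psi> s\<close> to \<open>\<Psi> u\<close> on the right interval costs the rank-one
  term.\<close>

lemma integral_split:
  assumes "s \<le> u" "u \<le> t"
  shows "tensor_integral \<Psi> X s t
       = tensor_integral \<Psi> X s u + tensor_integral \<Psi> X u t + tensor (\<Psi> u - \<Psi> s) (h t - h u)"
proof -
  interpret left: stieltjes s u b C H \<Psi> h X by (rule subinterval) (use assms in auto)
  interpret right: stieltjes u t b C H \<Psi> h X by (rule subinterval) (use assms in auto)
  have "(riemann_sum (\<Psi> s)
      \<longlongrightarrow> tensor_integral \<Psi> X s t - tensor_integral \<Psi> X s u) (mesh_filter u t)"
    using riemann_sum_tendsto_diff[OF assms(1) left.tendsto_integral[OF assms(1)]] tendsto_integral assms by simp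
  moreover have "((\<lambda>ss. riemann_sum (\<Psi> u) ss + tensor (\<Psi> u - \<Psi> s) (h t - h u))
      \<longlongrightarrow> tensor_integral \<Psi> X u t + tensor (\<Psi> u - \<Psi> s) (h t - h u)) (mesh_filter u t)"
    by (intro tendsto_add right.tendsto_integral assms tendsto_const)
  then have "(riemann_sum (\<Psi> s)
      \<longlongrightarrow> tensor_integral \<Psi> X u t + tensor (\<Psi> u - \<Psi> s) (h t - h u)) (mesh_filter u t)"
    by (rule Lim_transform_eventually)
      (auto simp: eventually_mesh_filter sum_change_base[OF _ assms(1) order_refl, of _ "\<Psi> s" "\<Psi> u"] intro!: exI[of _ 1])
  ultimately have "tensor_integral \<Psi> X s t - tensor_integral \<Psi> X s u
      = tensor_integral \<Psi> X u t + tensor (\<Psi> u - \<Psi> s) (h t - h u)"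
    using tendsto_unique[OF mesh_filter_neq_bot[OF assms(2)]] by blast
  then show ?thesis by (simp add: algebra_simps)
qed

end

lemma stieltjes_integral_diff:
  assumes "stieltjes s t b C H \<Psi> h X" "stieltjes s t b C H' \<Psi> h' X'" "s \<le> t"
  shows "tensor_integral \<Psi> X s t - tensor_integral \<Psi> X' s t = tensor_integral \<Psi> (\<lambda>p. X p - X' p) s t"
proof -
  interpret p: stieltjes s t b C H \<Psi> h X by fact
  interpret q: stieltjes s t b C H' \<Psi> h' X' by fact
  have "((\<lambda>ss. p.riemann_sum (\<Psi> s) ss - q.riemann_sum (\<Psi> s) ss) \<longlongrightarrow> tensor_integral \<Psi> X s t - tensor_integral \<Psi> X' s t) (mesh_filter s t)"
    by (intro tendsto_diff p.tendsto_integral q.tendsto_integral assms(3))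
  moreover have "(\<lambda>ss. p.riemann_sum (\<Psi> s) ss - q.riemann_sum (\<Psi> s) ss)
     = partition_sum (\<lambda>x y. tensor (\<Psi> x - \<Psi> s) (X (x, y) - X' (x, y)))"
    by (rule ext) (simp add: tensor.diff_right partition_sum_diff)
  ultimately have "(partition_sum (\<lambda>x y. tensor (\<Psi> x - \<Psi> s) (X (x, y) - X' (x, y)))
     \<longlongrightarrow> tensor_integral \<Psi> X s t - tensor_integral \<Psi> X' s t) (mesh_filter s t)"
    by (rule subst[rotated])
  then show ?thesis
    unfolding tensor_integral_def[of \<Psi> "\<lambda>p. X p - X' p"]
    by (rule tendsto_Lim[OF mesh_filter_neq_bot[OF assms(3)], symmetric])
qed

lemma holder_paths_1E:
  assumes "h \<in> holder_paths 1 T"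
  obtains H where "1 \<le> H" "hoelder_on 0 T H 1 h"
proof -
  obtain C where C: "hoelder_on 0 T C 1 h" using assms by (auto simp: holder_paths_iff)
  have "hoelder_on 0 T (max C 1) 1 h"
    unfolding hoelder_on_def
  proof (intro allI impI)
    fix u v assume "0 \<le> u \<and> u \<le> v \<and> v \<le> T"
    then have "norm (h v - h u) \<le> C * (v - u) powr 1" using hoelder_onD[OF C] by auto
    also have "\<dots> \<le> max C 1 * (v - u) powr 1" by (intro mult_right_mono) auto
    finally show "norm (h v - h u) \<le> max C 1 * (v - u) powr 1" .
  qed
  with that show thesis by (meson max.cobounded2)
qed

lemma stieltjes_smooth:
  assumes "hoelder_on 0 T H 1 h" "0 \<le> H" "0 \<le> s" "t \<le> T"
  shows "stieltjes s t 1 H H h h (\<lambda>(u, v). h v - h u)"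
  using assms by unfold_locales (auto simp: hoelder_on_def)

lemma smooth_rough_path_in_rough_paths:
  fixes h :: "real \<Rightarrow> real^'d"
  assumes "h \<in> holder_paths 1 T" "\<beta> \<le> 1"
  shows "smooth_rough_path T h \<in> rough_paths \<beta> T"
proof -
  obtain H where H: "1 \<le> H" "hoelder_on 0 T H 1 h" using holder_paths_1E[OF assms(1)] .
  let ?W = "tensor_integral h (\<lambda>(u, v). h v - h u)"
  have W: "norm (?W s t) \<le> H * H * T powr (2 - 2 * \<beta>) * (t - s) powr (2 * \<beta>)" if "0 \<le> s" "s < t" "t \<le> T" for s t
  proof -
    interpret stieltjes s t 1 H H h h "\<lambda>(u, v). h v - h u"
      using H that by (intro stieltjes_smooth) auto
    have "norm (?W s t) \<le> H * H * (t - s) powr 2"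
      using norm_integral_le that by simp
    also have "\<dots> \<le> H * H * (T powr (2 - 2 * \<beta>) * (t - s) powr (2 * \<beta>))"
      using that assms H by (intro mult_left_mono powr_le_powr_interval) auto
    finally show ?thesis by (simp add: mult_ac)
  qed
  have X: "norm (h t - h s) \<le> H * T powr (1 - \<beta>) * (t - s) powr \<beta>" if "0 \<le> s" "s < t" "t \<le> T" for s t
    using hoelder_onD[OF hoelder_on_weaken[OF H(2) assms(2)]] H that by auto
  have split: "?W s t = ?W s u + ?W u t + tensor (h u - h s) (h t - h u)"
    if "0 \<le> s" "s \<le> u" "u \<le> t" "t \<le> T" for s u t
  proof -
    interpret stieltjes s t 1 H H h h "\<lambda>(u, v). h v - h u"
      using H that by (intro stieltjes_smooth) auto
    show ?thesis using integral_split that by simp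
  qed
  show ?thesis
    unfolding rough_paths_def smooth_rough_path_def
  proof (clarsimp, intro conjI allI impI)
    show "holder2_norm \<beta> T (\<lambda>x\<in>simplex2 T. case x of (s, t) \<Rightarrow> h t - h s) < \<top>"
      unfolding infinity_ennreal_def[symmetric] holder2_norm_finite_iff
      using X H by (intro exI[of _ "H * T powr (1 - \<beta>)"]) (auto simp: simplex2_def)
    show "holder2_norm (2 * \<beta>) T (\<lambda>x\<in>simplex2 T. case x of (s, t) \<Rightarrow> ?W s t) < \<top>"
      unfolding infinity_ennreal_def[symmetric] holder2_norm_finite_iff
      using W H by (intro exI[of _ "H * H * T powr (2 - 2 * \<beta>)"]) (auto simp: simplex2_def)
  qed (use split in \<open>auto simp: simplex2_def\<close>)
qed

section \<open>Regularity of the coefficient\<close>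

text \<open>Since \<gamma> - 1 > 1, at least one derivative is available. If m = 1, then \<alpha> =
  \<gamma> - 2 and \<beta>(2 + \<alpha>) = \<beta>\<gamma> > 1. If m is at least 2, the first
  derivative is Lipschitz, so \<alpha> = 1 and the condition reads 3\<beta> > 1.\<close>

lemma lip_class_regularity:
  fixes f :: "'a::euclidean_space \<Rightarrow> 'b::real_normed_vector"
  assumes \<beta>: "1/3 < \<beta>" "\<beta> \<le> 1/2" and \<gamma>: "1 / \<beta> < \<gamma>" and f: "f \<in> lip_class (\<gamma> - 1)"
  obtains \<alpha> B where "0 < \<alpha>" "\<alpha> \<le> 1" "1 < \<beta> * (2 + \<alpha>)" "1 \<le> B"
    "\<And>x. norm (f x) \<le> B" "\<And>x. f differentiable (at x)"
    "\<And>x v. norm (frechet_derivative f (at x) v) \<le> B * norm v"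
    "\<And>x y v. norm (frechet_derivative f (at x) v - frechet_derivative f (at y) v)
        \<le> B * norm (x - y) powr \<alpha> * norm v"
proof -
  obtain m :: nat and \<theta> C C' where m: "\<gamma> - 1 = real m + \<theta>" "0 < \<theta>" "\<theta> \<le> 1"
    and diff: "\<And>vs x. length vs < m \<Longrightarrow> iter_deriv vs f differentiable (at x)"
    and C: "\<And>vs x. length vs \<le> m \<Longrightarrow> norm (iter_deriv vs f x) \<le> C * prod_list (map norm vs)"
    and C': "\<And>vs x y. length vs = m \<Longrightarrow>
        norm (iter_deriv vs f x - iter_deriv vs f y) \<le> C' * norm (x - y) powr \<theta> * prod_list (map norm vs)"
    using f unfolding lip_class_def continuously_differentiable_upto_def by blast
  have "2 \<le> 1 / \<beta>" using \<beta> by (simp add: field_simps)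
  then have m1: "1 \<le> m" using m \<gamma> by (cases m) auto
  define B where "B = max 1 (max C C')"
  have B: "1 \<le> B" "C \<le> B" "C' \<le> B" by (auto simp: B_def)
  have bd: "norm (f x) \<le> B" for x using C[of "[]" x] B by simp
  have df: "f differentiable (at x)" for x using diff[of "[]" x] m1 by simp
  have bd1: "norm (frechet_derivative f (at x) v) \<le> B * norm v" for x v
    using C[of "[v]" x] m1 mult_right_mono[OF B(2), of "norm v"] by simp
  show thesis
  proof (cases "m = 1")
    case True
    have "norm (frechet_derivative f (at x) v - frechet_derivative f (at y) v)
        \<le> B * norm (x - y) powr \<theta> * norm v" for x y v
    proof -
      have "norm (frechet_derivative f (at x) v - frechet_derivative f (at y) v)
        \<le> C' * norm (x - y) powr \<theta> * norm v"
        using C'[of "[v]" x y] True by simp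
      also have "\<dots> \<le> B * norm (x - y) powr \<theta> * norm v"
        by (intro mult_right_mono B) auto
      finally show ?thesis .
    qed
    moreover have "1 < \<beta> * (2 + \<theta>)"
      using m True \<gamma> \<beta> by (simp add: field_simps)
    ultimately show thesis using that[of \<theta> B] m B bd df bd1 by blast
  next
    case False
    then have m2: "2 \<le> m" using m1 by simp
    have "norm (frechet_derivative f (at x) v - frechet_derivative f (at y) v)
        \<le> B * norm (x - y) powr 1 * norm v" for x y v
    proof -
      have "norm (iter_deriv [v] f x - iter_deriv [v] f y) \<le> (B * norm v) * norm (x - y)"
      proof (rule differentiable_bound[of UNIV])
        show "(iter_deriv [v] f has_derivative frechet_derivative (iter_deriv [v] f) (at x)) (at x within UNIV)" for x
          using diff[of "[v]" x] m2 by (simp add: frechet_derivative_works[symmetric])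
        show "onorm (frechet_derivative (iter_deriv [v] f) (at x)) \<le> B * norm v" for x
        proof (rule onorm_bound)
          fix w
          have "norm (iter_deriv [w, v] f x) \<le> C * (norm w * norm v)"
            using C[of "[w, v]" x] m2 by simp
          also have "\<dots> \<le> B * (norm w * norm v)" by (intro mult_right_mono B) auto
          finally show "norm (frechet_derivative (iter_deriv [v] f) (at x) w) \<le> B * norm v * norm w"
            by (simp add: mult_ac)
        qed (use B in auto)
      qed auto
      then show ?thesis by (simp add: mult_ac)
    qed
    moreover have "1 < \<beta> * (2 + 1)" using \<beta> by simp
    ultimately show thesis using that[of 1 B] B bd df bd1 by (metis order_refl zero_less_one)
  qed
qed

section \<open>The equation\<close>

text \<open>Here \<open>A\<close> plays the part of the extension to
  \<open>\<beta>\<^sub>0\<close>-Hoelder paths. Its continuity is stated along sequences and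
  pointwise in time, the form in which it meets the limits of coefficients, and \<alpha> and
  \<open>B\<close> record the regularity of \<sigma> found in \<open>lip_class_regularity\<close>.
  Uniqueness is stated as at most one solution; existence is proved below.\<close>

locale path_dependent_rde =
  fixes T \<beta> \<beta>\<^sub>0 \<alpha> B :: real
    and \<sigma> :: "(real^'n) \<times> (real^'n) \<Rightarrow> (real^'d) \<Rightarrow>\<^sub>L (real^'n)"
    and \<xi> :: "real^'n"
    and A :: "(real \<Rightarrow> real^'n) \<Rightarrow> (real \<Rightarrow> real^'n)"
    and F :: "real \<Rightarrow> real"
  assumes T: "0 < T"
    and \<beta>: "0 < \<beta>" "\<beta> \<le> 1/2"
    and \<beta>\<^sub>0: "0 < \<beta>\<^sub>0" "\<beta>\<^sub>0 < \<beta>"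
    and \<alpha>: "0 < \<alpha>" "\<alpha> \<le> 1" "1 < \<beta> * (2 + \<alpha>)"
    and B: "1 \<le> B"
    and \<sigma>_bounded: "\<And>x. norm (\<sigma> x) \<le> B"
    and \<sigma>_differentiable: "\<And>x. \<sigma> differentiable (at x)"
    and \<sigma>_deriv_bounded: "\<And>x v. norm (frechet_derivative \<sigma> (at x) v) \<le> B * norm v"
    and \<sigma>_deriv_holder: "\<And>x y v. norm (frechet_derivative \<sigma> (at x) v - frechet_derivative \<sigma> (at y) v)
        \<le> B * norm (x - y) powr \<alpha> * norm v"
    and A_adapted: "\<And>t x y. \<lbrakk>0 \<le> t; t \<le> T; x \<in> holder_paths_from \<beta> T \<xi>; y \<in> holder_paths_from \<beta> T \<xi>;
          \<forall>s\<in>{0..t}. x s = y s\<rbrakk> \<Longrightarrow> \<forall>s\<in>{0..t}. A x s = A y s"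
    and A_continuous: "\<And>x y t. \<lbrakk>\<And>k::nat. x k \<in> holder_paths_from \<beta>\<^sub>0 T \<xi>; y \<in> holder_paths_from \<beta>\<^sub>0 T \<xi>;
          (\<lambda>k. holder_dist \<beta>\<^sub>0 T (x k) y) \<longlonglongrightarrow> 0; 0 \<le> t; t \<le> T\<rbrakk> \<Longrightarrow> (\<lambda>k. A (x k) t) \<longlonglongrightarrow> A y t"
    and F_mono: "mono_on {0..} F" and F_pos: "\<And>u. 0 \<le> u \<Longrightarrow> 0 < F u"
    and A_variation: "\<And>x s t. \<lbrakk>x \<in> holder_paths_from \<beta>\<^sub>0 T \<xi>; 0 \<le> s; s \<le> t; t \<le> T\<rbrakk> \<Longrightarrow>
          p_variation 1 (A x) s t
            \<le> ennreal (F (enn2real (p_variation (1 / \<beta>\<^sub>0) x s t))) * infty_variation x s t"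
    and unique: "\<And>h. h \<in> holder_paths 1 T \<Longrightarrow>
          \<exists>\<^sub>\<le>\<^sub>1 p. rde_solution \<beta> T \<sigma> A \<xi> (smooth_rough_path T h) p"
begin

abbreviation paths where "paths \<equiv> holder_paths_from \<beta> T \<xi>"

abbreviation D where "D x \<equiv> frechet_derivative \<sigma> (at x)"

lemma has_derivative_\<sigma>: "(\<sigma> has_derivative D x) (at x within S)"
  using \<sigma>_differentiable[of x] by (simp add: frechet_derivative_works has_derivative_at_withinI)

lemma linear_D: "linear (D x)"
  using \<sigma>_differentiable by (rule linear_frechet_derivative)

lemma \<sigma>_lipschitz: "norm (\<sigma> x - \<sigma> y) \<le> B * norm (x - y)"
  by (rule differentiable_bound[of UNIV \<sigma> D])
    (use has_derivative_\<sigma> \<sigma>_deriv_bounded B in \<open>auto intro!: onorm_bound\<close>)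

text \<open>Mean value inequality on the segment for \<sigma> minus its linear part at x, whose
  derivative there is at most B |y - x|^\<alpha>.\<close>

lemma \<sigma>_taylor: "norm (\<sigma> y - \<sigma> x - D x (y - x)) \<le> B * norm (y - x) powr (1 + \<alpha>)"
proof -
  interpret linear "D x" by (rule linear_D)
  have "norm ((\<sigma> y - D x y) - (\<sigma> x - D x x)) \<le> (B * norm (y - x) powr \<alpha>) * norm (y - x)"
  proof (rule differentiable_bound[of "closed_segment x y" "\<lambda>z. \<sigma> z - D x z" "\<lambda>z v. D z v - D x v"])
    fix z assume z: "z \<in> closed_segment x y"
    show "((\<lambda>z. \<sigma> z - D x z) has_derivative (\<lambda>v. D z v - D x v)) (at z within closed_segment x y)"
      by (intro has_derivative_diff has_derivative_\<sigma> linear_imp_has_derivative linear_D)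
    show "onorm (\<lambda>v. D z v - D x v) \<le> B * norm (y - x) powr \<alpha>"
    proof (rule onorm_bound)
      fix v
      have "norm (D z v - D x v) \<le> B * norm (z - x) powr \<alpha> * norm v"
        by (rule \<sigma>_deriv_holder)
      also have "\<dots> \<le> B * norm (y - x) powr \<alpha> * norm v"
        using segment_bound(1)[OF z] B \<alpha>
        by (intro mult_right_mono mult_left_mono powr_mono2) auto
      finally show "norm (D z v - D x v) \<le> B * norm (y - x) powr \<alpha> * norm v" .
    qed (use B in auto)
  qed auto
  also have "B * norm (y - x) powr \<alpha> * norm (y - x) = B * norm (y - x) powr (1 + \<alpha>)"
    by (cases "y = x") (auto simp: powr_add)
  finally show ?thesis by (simp add: diff algebra_simps)
qed

lemma D_partial:
  "frechet_derivative (\<lambda>z. \<sigma> (z, \<psi>)) (at z) = (\<lambda>v. D (z, \<psi>) (v, 0))"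
  "frechet_derivative (\<lambda>\<psi>. \<sigma> (z, \<psi>)) (at \<psi>) = (\<lambda>v. D (z, \<psi>) (0, v))"
proof -
  have "((\<lambda>z. \<sigma> (z, \<psi>)) has_derivative (\<lambda>v. D (z, \<psi>) (v, 0))) (at z)"
    by (rule has_derivative_compose[of "\<lambda>z. (z, \<psi>)" "\<lambda>v. (v, 0)" z UNIV \<sigma> "D (z, \<psi>)"])
      (auto intro!: derivative_eq_intros has_derivative_\<sigma>)
  then show "frechet_derivative (\<lambda>z. \<sigma> (z, \<psi>)) (at z) = (\<lambda>v. D (z, \<psi>) (v, 0))"
    by (rule frechet_derivative_at[symmetric])
  have "((\<lambda>\<psi>. \<sigma> (z, \<psi>)) has_derivative (\<lambda>v. D (z, \<psi>) (0, v))) (at \<psi>)"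
    by (rule has_derivative_compose[of "\<lambda>\<psi>. (z, \<psi>)" "\<lambda>v. (0, v)" \<psi> UNIV \<sigma> "D (z, \<psi>)"])
      (auto intro!: derivative_eq_intros has_derivative_\<sigma>)
  then show "frechet_derivative (\<lambda>\<psi>. \<sigma> (z, \<psi>)) (at \<psi>) = (\<lambda>v. D (z, \<psi>) (0, v))"
    by (rule frechet_derivative_at[symmetric])
qed

text \<open>Because \<beta> exceeds \<open>\<beta>\<^sub>0\<close>, the power
  \<beta>/\<open>\<beta>\<^sub>0\<close> of the cell length is superadditive over cells, so the sum
  is no larger than its one-cell value.\<close>

lemma p_variation_le:
  assumes "hoelder_on s t L \<beta> Z" "0 \<le> L" "s \<le> t"
  shows "p_variation (1 / \<beta>\<^sub>0) Z s t \<le> ennreal (L * (t - s) powr \<beta>)"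
  unfolding p_variation_def
proof (rule SUP_least)
  fix ts assume ts: "ts \<in> partitions s t"
  let ?p = "1 / \<beta>\<^sub>0"
  let ?K = "(L * (t - s) powr \<beta>) powr ?p"
  have p: "1 \<le> \<beta> * ?p" using \<beta>\<^sub>0 by (simp add: field_simps)
  have "partition_sum (\<lambda>u v. norm (Z v - Z u) powr ?p) ts \<le> ?K"
  proof (cases "s = t")
    case True
    then show ?thesis using ts by (auto dest: partitions_same)
  next
    case False
    define c where "c = L powr ?p * (t - s) powr (\<beta> * ?p - 1)"
    have "norm (partition_sum (\<lambda>u v. norm (Z v - Z u) powr ?p) ts) \<le> c * (t - s)"
    proof (rule norm_partition_sum_le_length[OF ts])
      fix u v assume uv: "s \<le> u" "u < v" "v \<le> t"
      have "norm (Z v - Z u) powr ?p \<le> (L * (v - u) powr \<beta>) powr ?p"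
        using hoelder_onD[OF assms(1)] uv \<beta>\<^sub>0 by (intro powr_mono2) auto
      also have "\<dots> = L powr ?p * (v - u) powr (\<beta> * ?p)"
        using assms(2) uv by (simp add: powr_mult powr_powr)
      also have "(v - u) powr (\<beta> * ?p) = (v - u) powr (\<beta> * ?p - 1) * (v - u)"
        using uv by (simp add: powr_diff)
      also have "L powr ?p * \<dots> \<le> L powr ?p * ((t - s) powr (\<beta> * ?p - 1) * (v - u))"
        using uv p by (intro mult_left_mono mult_right_mono powr_mono2) auto
      finally show "norm (norm (Z v - Z u) powr ?p) \<le> c * (v - u)"
        by (simp add: c_def mult_ac)
    qed
    also have "c * (t - s) = L powr ?p * (t - s) powr (\<beta> * ?p)"
      using False assms(3) by (simp add: c_def powr_diff)
    also have "\<dots> = ?K"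
      using assms by (simp add: powr_mult powr_powr)
    finally show ?thesis by simp
  qed
  then have "partition_sum (\<lambda>u v. norm (Z v - Z u) powr ?p) ts powr (1 / ?p) \<le> ?K powr (1 / ?p)"
    using \<beta>\<^sub>0 by (intro powr_mono2) (auto simp: partition_sum_def intro!: sum_nonneg)
  also have "\<dots> = L * (t - s) powr \<beta>"
    using assms \<beta>\<^sub>0 by (simp add: powr_powr)
  finally show "ennreal (partition_sum (\<lambda>u v. norm (Z v - Z u) powr ?p) ts powr (1 / ?p))
      \<le> ennreal (L * (t - s) powr \<beta>)"
    by (rule ennreal_leI)
qed

lemma holder_paths_from_\<beta>\<^sub>0: "Z \<in> paths \<Longrightarrow> Z \<in> holder_paths_from \<beta>\<^sub>0 T \<xi>"
  using holder_paths_mono[of Z \<beta> T \<beta>\<^sub>0] \<beta>\<^sub>0 by (auto simp: holder_paths_from_def)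

text \<open>The number \<open>N\<close> is kept apart from the Hoelder bound so that, by
  monotonicity, \<open>F\<close> is evaluated at a constant: at 1 on short intervals, and at a
  global bound on [0,T].\<close>

lemma A_variation_le:
  assumes Z: "Z \<in> paths" and st: "0 \<le> s" "s \<le> t" "t \<le> T"
    and L: "hoelder_on s t L \<beta> Z" "0 \<le> L" and N: "L * (t - s) powr \<beta> \<le> N"
    and ts: "ts \<in> partitions s t"
  shows "partition_sum (\<lambda>u v. norm (A Z v - A Z u)) ts \<le> F N * (L * (t - s) powr \<beta>)"
proof -
  let ?S = "partition_sum (\<lambda>u v. norm (A Z v - A Z u)) ts"
  have N0: "0 \<le> N" using L(2) N by (meson mult_nonneg_nonneg order_trans powr_ge_zero)
  have S0: "0 \<le> ?S" by (auto simp: partition_sum_def intro!: sum_nonneg)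
  have "ennreal ?S \<le> p_variation 1 (A Z) s t"
    unfolding p_variation_def by (rule SUP_upper2[OF ts]) (use S0 in simp)
  also have "\<dots> \<le> ennreal (F (enn2real (p_variation (1 / \<beta>\<^sub>0) Z s t))) * infty_variation Z s t"
    using A_variation holder_paths_from_\<beta>\<^sub>0[OF Z] st by blast
  also have "\<dots> \<le> ennreal (F N) * ennreal (L * (t - s) powr \<beta>)"
  proof (intro mult_mono ennreal_leI)
    have "enn2real (p_variation (1 / \<beta>\<^sub>0) Z s t) \<le> L * (t - s) powr \<beta>"
      using p_variation_le[OF L st(2)] L by (auto intro!: enn2real_leI)
    then show "F (enn2real (p_variation (1 / \<beta>\<^sub>0) Z s t)) \<le> F N"
      using N N0 by (intro mono_onD[OF F_mono]) auto
    show "infty_variation Z s t \<le> ennreal (L * (t - s) powr \<beta>)"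
      unfolding infty_variation_def
    proof (intro SUP_least, clarsimp, rule ennreal_leI)
      fix u v assume uv: "s \<le> u" "u \<le> v" "v \<le> t"
      then have "norm (Z v - Z u) \<le> L * (v - u) powr \<beta>" using hoelder_onD[OF L(1)] by auto
      also have "\<dots> \<le> L * (t - s) powr \<beta>"
        using uv L \<beta> by (intro mult_left_mono powr_mono2) auto
      finally show "norm (Z v - Z u) \<le> L * (t - s) powr \<beta>" .
    qed
  qed auto
  also have "\<dots> = ennreal (F N * (L * (t - s) powr \<beta>))"
    using F_pos[OF N0] L by (simp add: ennreal_mult)
  finally show ?thesis
    using F_pos[OF N0] L by (subst (asm) ennreal_le_iff) (auto intro!: mult_nonneg_nonneg less_imp_le)
qed

text \<open>The partition consisting of u and v alone turns the variation bound into a bound on one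
  increment.\<close>

lemma A_hoelder:
  assumes Z: "Z \<in> paths" and st: "0 \<le> s" "t \<le> T"
    and L: "hoelder_on s t L \<beta> Z" "0 \<le> L" and N: "L * (t - s) powr \<beta> \<le> N"
  shows "hoelder_on s t (F N * L) \<beta> (A Z)"
  unfolding hoelder_on_def
proof (intro allI impI)
  fix u v assume uv: "s \<le> u \<and> u \<le> v \<and> v \<le> t"
  have N': "L * (v - u) powr \<beta> \<le> N"
    by (rule order_trans[OF _ N]) (use uv L \<beta> in \<open>auto intro!: mult_left_mono powr_mono2\<close>)
  show "norm (A Z v - A Z u) \<le> F N * L * (v - u) powr \<beta>"
  proof (cases "u = v")
    case False
    then have "partition_sum (\<lambda>x y. norm (A Z y - A Z x)) [u, v] \<le> F N * (L * (v - u) powr \<beta>)"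
      using uv st by (intro A_variation_le[OF Z _ _ _ hoelder_on_subset[OF L(1)] L(2) N']) auto
    then show ?thesis by (simp add: mult_ac)
  qed simp
qed

end

section \<open>Germs close to increments, and the sewing estimate\<close>

lemma riemann_sum_tendsto_increment:
  fixes \<Xi> :: "real \<Rightarrow> real \<Rightarrow> 'a::real_normed_vector"
  assumes "1 < e" "0 \<le> K" "a \<le> b"
    and near: "\<And>u v. \<lbrakk>a \<le> u; u < v; v \<le> b\<rbrakk> \<Longrightarrow> norm (\<Xi> u v - (f v - f u)) \<le> K * (v - u) powr e"
  shows "(partition_sum \<Xi> \<longlongrightarrow> f b - f a) (mesh_filter a b)"
proof (rule tendstoI)
  fix r :: real assume "0 < r"
  \<comment> \<open>A cell contributes an error of at most K * \<delta>^(e-1) times its length,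
    hence K * \<delta>^(e-1) * (b - a) in total; the summands 1 keep this strictly below
    \<open>r\<close> and the quotient defined also when K = 0 or a = b.\<close>
  define \<delta> where "\<delta> = (r / ((K + 1) * (b - a + 1))) powr (1 / (e - 1))"
  have pos: "0 < (K + 1) * (b - a + 1)" using assms by (intro mult_pos_pos) auto
  have "0 < \<delta>" using \<open>0 < r\<close> assms by (simp add: \<delta>_def add_nonneg_eq_0_iff)
  have \<delta>: "K * \<delta> powr (e - 1) * (b - a) < r"
  proof -
    have "\<delta> powr (e - 1) = r / ((K + 1) * (b - a + 1))"
      using \<open>0 < r\<close> pos assms by (simp add: \<delta>_def powr_powr)
    then have "K * \<delta> powr (e - 1) * (b - a) = (K * (b - a)) * r / ((K + 1) * (b - a + 1))" by simp
    also have "\<dots> < r"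
    proof -
      have "K * (b - a) < (K + 1) * (b - a + 1)" using assms by (simp add: algebra_simps)
      then show ?thesis using \<open>0 < r\<close> pos by (simp add: divide_less_eq mult.commute)
    qed
    finally show ?thesis .
  qed
  have "dist (partition_sum \<Xi> ts) (f b - f a) < r" if ts: "ts \<in> partitions a b" "mesh_below \<delta> ts" for ts
  proof -
    have "norm (partition_sum (\<lambda>u v. \<Xi> u v - (f v - f u)) ts) \<le> K * \<delta> powr (e - 1) * (b - a)"
    proof (rule norm_partition_sum_le_mesh[OF ts])
      fix u v assume uv: "a \<le> u" "u < v" "v \<le> b" "v - u < \<delta>"
      have "norm (\<Xi> u v - (f v - f u)) \<le> K * (v - u) powr e" by (rule near[OF uv(1-3)])
      also have "(v - u) powr e = (v - u) powr (e - 1) * (v - u)"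
        using uv by (simp add: powr_diff)
      also have "K * \<dots> \<le> K * (\<delta> powr (e - 1) * (v - u))"
        using uv assms by (intro mult_left_mono mult_right_mono powr_mono2) auto
      finally show "norm (\<Xi> u v - (f v - f u)) \<le> K * \<delta> powr (e - 1) * (v - u)" by (simp add: mult_ac)
    qed
    then show ?thesis
      using \<delta> by (simp add: partition_sum_diff[of \<Xi>] partition_sum_telescope[OF ts(1)] dist_norm)
  qed
  then show "\<forall>\<^sub>F ts in mesh_filter a b. dist (partition_sum \<Xi> ts) (f b - f a) < r"
    unfolding eventually_mesh_filter using \<open>0 < \<delta>\<close> by blast
qed

text \<open>The restricted first level of \<open>smooth_rough_path\<close> and the plain increments
  of \<open>h\<close> agree on all cells that a partition sees; this replaces one by the
  other.\<close>

lemma tensor_integral_cong: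
  assumes "\<And>u v. \<lbrakk>s \<le> u; u < v; v \<le> t\<rbrakk> \<Longrightarrow> X (u, v) = X' (u, v)"
  shows "tensor_integral \<Psi> X s t = tensor_integral \<Psi> X' s t"
proof -
  have "(partition_sum (\<lambda>u v. tensor (\<Psi> u - \<Psi> s) (X (u, v))) \<longlongrightarrow> l) (mesh_filter s t) \<longleftrightarrow>
      (partition_sum (\<lambda>u v. tensor (\<Psi> u - \<Psi> s) (X' (u, v))) \<longlongrightarrow> l) (mesh_filter s t)" for l
    by (rule tendsto_cong) (auto simp: eventually_mesh_filter assms intro!: exI[of _ 1] partition_sum_cong)
  then show ?thesis
    unfolding tensor_integral_def Topological_Spaces.Lim_def by simp
qed

text \<open>A remainder that is \<open>o(t - s)\<close> is controlled by its defect of additivity: halving the interval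
  contracts the a priori constant \<open>C\<close> by \<open>2 powr (1 - e)\<close> and leaves \<open>G / (1 - 2 powr (1 - \<theta>))\<close> fixed.\<close>

lemma dyadic_sewing_bound:
  fixes J :: "real \<Rightarrow> real \<Rightarrow> 'a::real_normed_vector"
  assumes \<theta>: "1 < \<theta>" and e: "1 < e" and G: "0 \<le> G" and C: "0 \<le> C"
    and crude: "\<And>s t. \<lbrakk>0 \<le> s; s \<le> t; t \<le> T; t - s \<le> \<delta>\<rbrakk> \<Longrightarrow> norm (J s t) \<le> C * (t - s) powr e"
    and defect: "\<And>s u t. \<lbrakk>0 \<le> s; s \<le> u; u \<le> t; t \<le> T; t - s \<le> \<delta>\<rbrakk> \<Longrightarrow>
        norm (J s t - J s u - J u t) \<le> G * (t - s) powr \<theta>"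
    and st: "0 \<le> s" "s \<le> t" "t \<le> T" "t - s \<le> \<delta>"
  shows "norm (J s t) \<le> G / (1 - 2 powr (1 - \<theta>)) * (t - s) powr \<theta>"
proof -
  define \<kappa> where "\<kappa> = 1 / (1 - 2 powr (1 - \<theta>))"
  have q: "2 powr (1 - \<theta>) < (1::real)"
    using \<theta> powr_less_mono[of "1 - \<theta>" 0 2] by simp
  then have \<kappa>: "0 < \<kappa>" "\<kappa> * 2 powr (1 - \<theta>) + 1 = \<kappa>"
    unfolding \<kappa>_def using \<theta> by (simp_all add: divide_simps)
  have step: "norm (J s t) \<le> \<kappa> * G * (t - s) powr \<theta> + C * (2 powr (1 - e)) ^ n * (t - s) powr e"
    if "0 \<le> s" "s \<le> t" "t \<le> T" "t - s \<le> \<delta>" for n s t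
    using that
  proof (induction n arbitrary: s t)
    case 0
    have "0 \<le> \<kappa> * G * (t - s) powr \<theta>" using \<kappa> G by simp
    then show ?case using crude[OF 0] by simp
  next
    case (Suc n)
    let ?u = "(s + t) / 2" and ?Cn = "C * (2 powr (1 - e)) ^ n"
    have half: "((t - s) / 2) powr x * 2 = 2 powr (1 - x) * (t - s) powr x" for x
      using Suc.prems by (simp add: powr_divide powr_diff)
    have su: "?u - s = (t - s) / 2" and ut: "t - ?u = (t - s) / 2" by (simp_all add: field_simps)
    have "norm (J s t) \<le> norm (J s t - J s ?u - J ?u t) + norm (J s ?u) + norm (J ?u t)"
      using norm_triangle_ineq[of "J s t - J s ?u - J ?u t" "J s ?u + J ?u t"]
        norm_triangle_ineq[of "J s ?u" "J ?u t"] by simp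
    also have "\<dots> \<le> G * (t - s) powr \<theta> + (\<kappa> * G * (?u - s) powr \<theta> + ?Cn * (?u - s) powr e)
        + (\<kappa> * G * (t - ?u) powr \<theta> + ?Cn * (t - ?u) powr e)"
      using Suc.prems by (intro add_mono defect Suc.IH) (auto simp: field_simps)
    also have "\<dots> = G * (t - s) powr \<theta> + \<kappa> * G * (((t - s) / 2) powr \<theta> * 2) + ?Cn * (((t - s) / 2) powr e * 2)"
      unfolding su ut by (simp add: algebra_simps)
    also have "\<dots> = (\<kappa> * 2 powr (1 - \<theta>) + 1) * G * (t - s) powr \<theta> + ?Cn * 2 powr (1 - e) * (t - s) powr e"
      unfolding half by (simp add: algebra_simps)
    also have "\<dots> = \<kappa> * G * (t - s) powr \<theta> + C * (2 powr (1 - e)) ^ Suc n * (t - s) powr e"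
      unfolding \<kappa>(2) by (simp add: algebra_simps)
    finally show ?case .
  qed
  have "2 powr (1 - e) < (1::real)"
    using e powr_less_mono[of "1 - e" 0 2] by simp
  then have "(\<lambda>n. \<kappa> * G * (t - s) powr \<theta> + C * (2 powr (1 - e)) ^ n * (t - s) powr e)
      \<longlonglongrightarrow> \<kappa> * G * (t - s) powr \<theta> + C * 0 * (t - s) powr e"
    by (intro tendsto_intros LIMSEQ_power_zero) simp
  then have "norm (J s t) \<le> \<kappa> * G * (t - s) powr \<theta> + C * 0 * (t - s) powr e"
    by (rule LIMSEQ_le_const) (use step[OF st] in blast)
  then show ?thesis by (simp add: \<kappa>_def)
qed

section \<open>The local expansion of the equation and its defect of additivity\<close>

context path_dependent_rde
begin

definition coeff :: "(real \<Rightarrow> real^'n) \<Rightarrow> real \<Rightarrow> (real^'d) \<Rightarrow>\<^sub>L (real^'n)" where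
  "coeff Z u = \<sigma> (Z u, A Z u)"

abbreviation remainder :: "(real \<Rightarrow> real^'d) \<Rightarrow> (real \<Rightarrow> real^'n) \<Rightarrow> real \<Rightarrow> real \<Rightarrow> real^'n" where
  "remainder h Z s t \<equiv> Z t - Z s - coeff Z s (h t - h s)"

definition area :: "(real \<Rightarrow> real^'d) \<Rightarrow> real \<Rightarrow> real \<Rightarrow> real^'d^'d" where
  "area h s t = tensor_integral h (\<lambda>(u, v). h v - h u) s t"

definition cross :: "(real \<Rightarrow> real^'n) \<Rightarrow> (real \<Rightarrow> real^'d) \<Rightarrow> real \<Rightarrow> real \<Rightarrow> real^'d^'n" where
  "cross Z h s t = tensor_integral (A Z) (\<lambda>(u, v). h v - h u) s t"

text \<open>This is \<open>rough_germ\<close> for the smooth rough path of \<open>h\<close> with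
  derivative \<open>coeff Z\<close>, see \<open>rough_germ_smooth\<close>; the partial derivatives
  of \<sigma> appear as \<open>D\<close> in the directions (v, 0) and (0, v).\<close>

definition germ :: "(real \<Rightarrow> real^'d) \<Rightarrow> (real \<Rightarrow> real^'n) \<Rightarrow> real \<Rightarrow> real \<Rightarrow> real^'n" where
  "germ h Z s t = coeff Z s (h t - h s)
     + tensor_apply (\<lambda>x. D (Z s, A Z s) (coeff Z s x, 0)) (area h s t)
     + tensor_apply (\<lambda>x. D (Z s, A Z s) (0, x)) (cross Z h s t)"

text \<open>One bound for both dimension factors that \<open>norm_tensor_apply_le\<close> produces,
  in the area term and in the cross term.\<close>

definition c_tensor :: real where
  "c_tensor = real CARD('d) * real CARD('d) + real CARD('n) * real CARD('d)"

lemma c_tensor_nonneg: "0 \<le> c_tensor"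
  by (simp add: c_tensor_def)

lemma norm_tensor_apply_area_le:
  fixes L :: "real^'d \<Rightarrow> (real^'d) \<Rightarrow>\<^sub>L (real^'n)"
  assumes "\<And>v. norm (L v) \<le> K * norm v" "0 \<le> K"
  shows "norm (tensor_apply L M) \<le> c_tensor * K * norm M"
  using assms(2) norm_tensor_apply_le[of L K M, OF assms(1)] 
  by (auto simp: c_tensor_def algebra_simps intro: order_trans)

lemma norm_tensor_apply_cross_le:
  fixes L :: "real^'n \<Rightarrow> (real^'d) \<Rightarrow>\<^sub>L (real^'n)"
  assumes "\<And>v. norm (L v) \<le> K * norm v" "0 \<le> K"
  shows "norm (tensor_apply L M) \<le> c_tensor * K * norm M"
  using assms(2) norm_tensor_apply_le[of L K M, OF assms(1)] 
  by (auto simp: c_tensor_def algebra_simps intro: order_trans)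

lemma norm_coeff: "norm (coeff Z u) \<le> B"
  by (simp add: coeff_def \<sigma>_bounded)

lemma norm_coeff_apply: "norm (coeff Z u x) \<le> B * norm x"
  by (meson mult_right_mono norm_blinfun norm_coeff norm_ge_zero order_trans)

lemma norm_coeff_diff: "norm (coeff Z v - coeff Z u) \<le> B * (norm (Z v - Z u) + norm (A Z v - A Z u))"
proof -
  have "norm (coeff Z v - coeff Z u) \<le> B * norm ((Z v, A Z v) - (Z u, A Z u))"
    unfolding coeff_def by (rule \<sigma>_lipschitz)
  also have "\<dots> \<le> B * (norm (Z v - Z u) + norm (A Z v - A Z u))"
    using B norm_Pair_le[of "Z v - Z u" "A Z v - A Z u"] by (intro mult_left_mono) auto
  finally show ?thesis .
qed

lemma norm_deriv_coeff: "norm (D p (coeff Z s x, 0)) \<le> B * B * norm x"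
proof -
  have "norm (D p (coeff Z s x, 0)) \<le> B * norm (coeff Z s x)"
    using \<sigma>_deriv_bounded[of p "(coeff Z s x, 0)"] by (simp add: norm_Pair)
  also have "\<dots> \<le> B * (B * norm x)"
    using B by (intro mult_left_mono norm_coeff_apply) auto
  finally show ?thesis by (simp add: mult_ac)
qed

lemma norm_germ_diff_le:
  "norm (germ h Z s t - coeff Z s (h t - h s))
     \<le> c_tensor * (B * B) * norm (area h s t) + c_tensor * B * norm (cross Z h s t)"
proof -
  have "norm (tensor_apply (\<lambda>x. D (Z s, A Z s) (coeff Z s x, 0)) (area h s t))
      \<le> c_tensor * (B * B) * norm (area h s t)"
    by (rule norm_tensor_apply_area_le) (use norm_deriv_coeff B in auto)
  moreover have "norm (tensor_apply (\<lambda>x. D (Z s, A Z s) (0, x)) (cross Z h s t))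
      \<le> c_tensor * B * norm (cross Z h s t)"
    using \<sigma>_deriv_bounded[of _ "(0, _)"] B by (intro norm_tensor_apply_cross_le) (auto simp: norm_Pair)
  ultimately show ?thesis
    unfolding germ_def
    by (smt (verit, best) add_diff_cancel_left' add.assoc norm_triangle_ineq)
qed

lemma norm_remainder_le:
  "norm (remainder h Z s t) \<le> norm (Z t - Z s - germ h Z s t)
     + (c_tensor * (B * B) * norm (area h s t) + c_tensor * B * norm (cross Z h s t))"
  using norm_triangle_ineq[of "Z t - Z s - germ h Z s t" "germ h Z s t - coeff Z s (h t - h s)"]
    norm_germ_diff_le[of h Z s t] by (simp add: algebra_simps)

lemma rough_germ_smooth:
  assumes "0 \<le> s" "s \<le> t" "t \<le> T" "Z' s = coeff Z s"
  shows "rough_germ \<sigma> Z Z' (A Z) (smooth_rough_path T h) s t = germ h Z s t"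
proof -
  have "tensor_integral (A Z) (restrict (\<lambda>(s, t). h t - h s) (simplex2 T)) s t = cross Z h s t"
    unfolding cross_def using assms by (intro tensor_integral_cong) (auto simp: simplex2_def)
  then show ?thesis
    using assms by (simp add: rough_germ_def smooth_rough_path_def germ_def coeff_def area_def D_partial simplex2_def)
qed

text \<open>Variation of \<open>A Z\<close> times oscillation of \<open>h\<close>. The Lipschitz
  constant \<open>H\<close> makes the integral exist but is absent from the bound, which therefore
  stays uniform over drivers with bounded rough norms.\<close>

lemma norm_cross_le:
  assumes Z: "Z \<in> paths" and h: "hoelder_on 0 T H 1 h" "0 \<le> H"
    and st: "0 \<le> s" "s \<le> t" "t \<le> T"
    and L: "hoelder_on s t L \<beta> Z" "0 \<le> L" "L * (t - s) powr \<beta> \<le> N"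
    and N': "\<And>u. \<lbrakk>s \<le> u; u \<le> t\<rbrakk> \<Longrightarrow> norm (h t - h u) \<le> N'"
  shows "norm (cross Z h s t) \<le> F N * (L * (t - s) powr \<beta>) * N'"
proof -
  have N: "0 \<le> N" using L by (meson mult_nonneg_nonneg order_trans powr_ge_zero)
  interpret stieltjes s t \<beta> "F N * L" H "A Z" h "\<lambda>(u, v). h v - h u"
    by unfold_locales
      (use A_hoelder[OF Z st(1,3) L] F_pos[OF N] L h \<beta> st in \<open>auto intro: hoelder_on_subset\<close>)
  show ?thesis
    unfolding cross_def
    using L F_pos[OF N] by (intro norm_integral_le_variation st(2) A_variation_le[OF Z st L] N') auto
qed

text \<open>Chen's relations for \<open>area\<close> and \<open>cross\<close> cancel everything of
  order 2\<beta>. What remains is a Taylor error of \<sigma>, the Euler remainder on [s,u] paired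
  with an increment of \<open>h\<close>, and the change of the derivative terms from s to u.
  \<open>E\<close> is a Hoelder constant for the pair (Z, A Z).\<close>

lemma germ_defect:
  assumes Z: "Z \<in> paths" and h: "hoelder_on 0 T H 1 h" "0 \<le> H"
    and sut: "0 \<le> s" "s \<le> u" "u \<le> t" "t \<le> T" "t - s \<le> 1"
    and M: "0 \<le> M" "\<And>x y. \<lbrakk>0 \<le> x; x \<le> y; y \<le> T\<rbrakk> \<Longrightarrow> norm (h y - h x) \<le> M * (y - x) powr \<beta>"
      "\<And>x y. \<lbrakk>0 \<le> x; x \<le> y; y \<le> T\<rbrakk> \<Longrightarrow> norm (area h x y) \<le> M * (y - x) powr (2 * \<beta>)"
    and L: "hoelder_on s t L \<beta> Z" "1 \<le> L" "L * (t - s) powr \<beta> \<le> 1"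
    and r: "0 \<le> r" "norm (remainder h Z s u) \<le> r * (u - s) powr (2 * \<beta>)"
  defines "E \<equiv> L * (1 + F 1)"
  shows "norm (germ h Z s t - germ h Z s u - germ h Z u t)
    \<le> (B * M * (E * E) + B * M * r + c_tensor * (2 * B * B * E) * M + c_tensor * (B * E) * (E * M))
        * (t - s) powr (\<beta> * (2 + \<alpha>))"
proof -
  \<comment> \<open>\<open>p\<close> and \<open>q\<close> are the quantities of order \<beta> and
    \<alpha>\<beta>, and the target order \<theta> is p * p * q. Terms with a third factor p are
    weakened by \<open>pq\<close>, which holds because p is at most 1.\<close>
  define p where "p = (t - s) powr \<beta>"
  define q where "q = p powr \<alpha>"
  have p: "0 \<le> p" "p \<le> 1"
    using sut \<beta> unfolding p_def by (auto simp: powr_le_one_le intro: order_trans[OF powr_mono2[of \<beta> "t - s" 1]])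
  have q: "0 \<le> q" "q \<le> 1"
    using p \<alpha> unfolding q_def by (auto intro: order_trans[OF powr_mono2[of \<alpha> p 1]])
  have pq: "p \<le> q"
  proof (cases "p = 0")
    case False
    then show ?thesis using powr_mono'[of \<alpha> 1 p] p \<alpha> by (simp add: q_def)
  qed (use q in simp)
  have F1: "0 < F 1" by (rule F_pos) simp
  have E: "1 \<le> E" using L F1 unfolding E_def by (simp add: mult_ge1_I)
  have EL: "F 1 * L \<le> E" using L by (simp add: E_def algebra_simps)
  have cn: "0 \<le> c_tensor" by (rule c_tensor_nonneg)
  have dp: "(y - x) powr \<beta> \<le> p" if "s \<le> x" "x \<le> y" "y \<le> t" for x y
    unfolding p_def using that \<beta> by (intro powr_mono2) auto
  have dpp: "(y - x) powr (2 * \<beta>) \<le> p * p" if "s \<le> x" "x \<le> y" "y \<le> t" for x y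
  proof -
    have "(y - x) powr (2 * \<beta>) \<le> (t - s) powr (2 * \<beta>)"
      using that \<beta> by (intro powr_mono2) auto
    also have "\<dots> = p * p" unfolding p_def by (simp add: powr_add[symmetric])
    finally show ?thesis .
  qed
  have dq: "(t - s) powr (\<beta> * (2 + \<alpha>)) = p * p * q"
    unfolding p_def q_def by (simp add: powr_powr powr_add[symmetric] algebra_simps)
  have \<Psi>: "hoelder_on s t (F 1 * L) \<beta> (A Z)"
    using A_hoelder[OF Z sut(1,4) L(1) _ L(3)] L(2) by simp
  have Zsu: "norm (Z u - Z s) \<le> L * p"
    by (rule order_trans[OF hoelder_onD[OF L(1)]]) (use sut L dp in \<open>auto intro!: mult_left_mono\<close>)
  have \<Psi>su: "norm (A Z u - A Z s) \<le> F 1 * L * p"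
    by (rule order_trans[OF hoelder_onD[OF \<Psi>]]) (use sut L F1 dp in \<open>auto intro!: mult_left_mono\<close>)
  have pair: "norm ((Z u, A Z u) - (Z s, A Z s)) \<le> E * p"
    using norm_Pair_le[of "Z u - Z s" "A Z u - A Z s"] Zsu \<Psi>su by (simp add: E_def algebra_simps)
  have E\<alpha>: "E powr \<alpha> \<le> E" using powr_mono[OF \<alpha>(2) E] E by simp
  have pair_\<alpha>: "norm ((Z u, A Z u) - (Z s, A Z s)) powr \<alpha> \<le> E * q"
  proof -
    have "norm ((Z u, A Z u) - (Z s, A Z s)) powr \<alpha> \<le> (E * p) powr \<alpha>"
      using pair \<alpha> by (intro powr_mono2) auto
    also have "\<dots> = E powr \<alpha> * q" using E p by (simp add: powr_mult q_def)
    also have "\<dots> \<le> E * q" using E\<alpha> q(1) by (rule mult_right_mono)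
    finally show ?thesis .
  qed
  have Xut: "norm (h t - h u) \<le> M * p"
    by (rule order_trans[OF M(2)]) (use sut M dp in \<open>auto intro!: mult_left_mono\<close>)
  interpret \<Psi>: stieltjes s t \<beta> "F 1 * L" H "A Z" h "\<lambda>(u, v). h v - h u"
    by unfold_locales (use \<Psi> h \<beta> F1 L sut in \<open>auto intro: hoelder_on_subset\<close>)
  interpret hh: stieltjes s t 1 H H h h "\<lambda>(u, v). h v - h u"
    using h sut by (intro stieltjes_smooth)
  have Wut: "norm (cross Z h u t) \<le> E * M * (p * p)"
  proof -
    have "norm (cross Z h u t) \<le> F 1 * (L * (t - u) powr \<beta>) * (M * p)"
    proof (rule norm_cross_le[OF Z h])
      show "L * (t - u) powr \<beta> \<le> 1"
        by (rule order_trans[OF _ L(3)]) (use sut L \<beta> in \<open>auto intro!: mult_left_mono powr_mono2\<close>)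
      fix x assume "u \<le> x" "x \<le> t"
      then show "norm (h t - h x) \<le> M * p"
        by (intro order_trans[OF M(2)]) (use sut M dp in \<open>auto intro!: mult_left_mono\<close>)
    qed (use sut L in \<open>auto intro: hoelder_on_subset\<close>)
    also have "\<dots> \<le> F 1 * (L * p) * (M * p)"
      using F1 L M p sut dp by (intro mult_right_mono mult_left_mono) auto
    also have "\<dots> = (F 1 * L * p) * (M * p)" by (simp add: mult_ac)
    also have "\<dots> \<le> (E * p) * (M * p)"
      using EL M p by (intro mult_right_mono) auto
    finally show ?thesis by (simp add: mult_ac)
  qed
  let ?D = "\<lambda>x. D (Z x, A Z x)"
  let ?X = "\<lambda>x y. h y - h x"
  let ?R = "Z u - Z s - coeff Z s (?X s u)"
  interpret Ds: linear "?D s" by (rule linear_D)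
  define T1 where "T1 = blinfun_apply (coeff Z u - coeff Z s - ?D s (Z u - Z s, A Z u - A Z s)) (?X u t)"
  define T2 where "T2 = blinfun_apply (?D s (?R, 0)) (?X u t)"
  define T3 where "T3 = tensor_apply (\<lambda>x. ?D u (coeff Z u x, 0) - ?D s (coeff Z s x, 0)) (area h u t)"
  define T4 where "T4 = tensor_apply (\<lambda>x. ?D u (0, x) - ?D s (0, x)) (cross Z h u t)"
  have area_split: "area h s t = area h s u + area h u t + tensor (?X s u) (?X u t)"
    unfolding area_def using hh.integral_split sut by simp
  have cross_split: "cross Z h s t = cross Z h s u + cross Z h u t + tensor (A Z u - A Z s) (?X u t)"
    unfolding cross_def using \<Psi>.integral_split sut by simp
  have lin1: "linear (\<lambda>x. ?D s (coeff Z s x, 0))"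
  proof -
    have "linear (\<lambda>x. (coeff Z s x, 0::real^'n))"
      by (rule linearI) (auto simp: blinfun.add_right blinfun.scaleR_right)
    from linear_compose[OF this linear_D] show ?thesis by (simp add: o_def)
  qed
  have lin2: "linear (\<lambda>x. ?D s (0, x))"
  proof -
    have "linear (\<lambda>x::real^'n. (0::real^'n, x))" by (rule linearI) auto
    from linear_compose[OF this linear_D] show ?thesis by (simp add: o_def)
  qed
  \<comment> \<open>The increment of (Z, A Z) splits into the Euler remainder, the first-order part
    and the increment of \<open>A Z\<close>. The last two are exactly the rank-one terms from
    \<open>area_split\<close> and \<open>cross_split\<close>, so they cancel against the
    linearisation of \<open>coeff\<close> subtracted in \<open>T1\<close>.\<close>
  have "?D s (Z u - Z s, A Z u - A Z s)
      = ?D s (?R, 0) + ?D s (coeff Z s (?X s u), 0) + ?D s (0, A Z u - A Z s)"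
    by (simp add: Ds.add[symmetric])
  then have "germ h Z s t - germ h Z s u - germ h Z u t = - T1 - T2 - T3 - T4"
    unfolding germ_def T1_def T2_def T3_def T4_def area_split cross_split tensor_apply_add
      tensor_apply_tensor[OF lin1] tensor_apply_tensor[OF lin2] tensor_apply_diff_left[symmetric]
    by (simp add: blinfun.diff_left blinfun.add_left blinfun.diff_right algebra_simps)
  then have "norm (germ h Z s t - germ h Z s u - germ h Z u t) \<le> norm T1 + norm T2 + norm T3 + norm T4"
    by (smt (verit, best) norm_minus_cancel norm_triangle_ineq4)
  moreover have "norm T1 \<le> B * M * (E * E) * (p * p * q)"
  proof -
    have "norm (coeff Z u - coeff Z s - ?D s (Z u - Z s, A Z u - A Z s))
        \<le> B * norm ((Z u, A Z u) - (Z s, A Z s)) powr (1 + \<alpha>)"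
      using \<sigma>_taylor[of "(Z u, A Z u)" "(Z s, A Z s)"] by (simp add: coeff_def)
    also have "norm ((Z u, A Z u) - (Z s, A Z s)) powr (1 + \<alpha>)
        = norm ((Z u, A Z u) - (Z s, A Z s)) * norm ((Z u, A Z u) - (Z s, A Z s)) powr \<alpha>"
      by (cases "norm ((Z u, A Z u) - (Z s, A Z s)) = 0") (auto simp: powr_add)
    also have "B * \<dots> \<le> B * ((E * p) * (E * q))"
      using B pair pair_\<alpha> E p by (intro mult_left_mono mult_mono) auto
    finally have "norm T1 \<le> (B * ((E * p) * (E * q))) * (M * p)"
      unfolding T1_def using Xut B E p q
      by (intro order_trans[OF norm_blinfun] mult_mono) auto
    then show ?thesis by (simp add: mult_ac)
  qed
  moreover have "norm T2 \<le> B * M * r * (p * p * q)"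
  proof -
    have "norm (?D s (?R, 0)) \<le> B * norm ?R"
      using \<sigma>_deriv_bounded[of "(Z s, A Z s)" "(?R, 0)"] by (simp add: norm_Pair)
    also have "\<dots> \<le> B * (r * (p * p))"
      using B r dpp[of s u] sut by (intro mult_left_mono order_trans[OF r(2)]) auto
    finally have "norm T2 \<le> (B * (r * (p * p))) * (M * p)"
      unfolding T2_def using Xut B r p
      by (intro order_trans[OF norm_blinfun] mult_mono) auto
    also have "\<dots> \<le> (B * (r * (p * p))) * (M * q)"
      using pq B r p M by (intro mult_left_mono) auto
    finally show ?thesis by (simp add: mult_ac)
  qed
  moreover have "norm T3 \<le> c_tensor * (2 * B * B * E) * M * (p * p * q)"
  proof -
    have "norm T3 \<le> c_tensor * (2 * B * B * E * q) * norm (area h u t)"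
      unfolding T3_def
    proof (rule norm_tensor_apply_area_le)
      fix x
      \<comment> \<open>The linear map changes through the point of differentiation
        (\<open>?a\<close>) and through \<open>coeff\<close> (\<open>?b\<close>). The first change
        has order q; the second has order p and is weakened to q.\<close>
      let ?a = "?D u (coeff Z u x, 0) - ?D s (coeff Z u x, 0)"
      let ?b = "?D s ((coeff Z u - coeff Z s) x, 0)"
      have "norm ?a \<le> B * norm ((Z u, A Z u) - (Z s, A Z s)) powr \<alpha> * norm (coeff Z u x)"
        using \<sigma>_deriv_holder[of "(Z u, A Z u)" "(coeff Z u x, 0)" "(Z s, A Z s)"]
        by (simp add: norm_Pair)
      also have "\<dots> \<le> B * (E * q) * (B * norm x)"
        using B pair_\<alpha> E q by (intro mult_mono norm_coeff_apply) auto
      finally have a: "norm ?a \<le> B * B * E * q * norm x" by (simp add: mult_ac)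
      have "norm ?b \<le> B * norm ((coeff Z u - coeff Z s) x)"
        using \<sigma>_deriv_bounded[of "(Z s, A Z s)" "((coeff Z u - coeff Z s) x, 0)"] by (simp add: norm_Pair)
      also have "\<dots> \<le> B * (norm (coeff Z u - coeff Z s) * norm x)"
        using B by (intro mult_left_mono norm_blinfun) auto
      also have "\<dots> \<le> B * ((B * (E * q)) * norm x)"
      proof -
        have "norm (coeff Z u - coeff Z s) \<le> B * norm ((Z u, A Z u) - (Z s, A Z s))"
          unfolding coeff_def by (rule \<sigma>_lipschitz)
        also have "\<dots> \<le> B * (E * p)"
          using B pair by (intro mult_left_mono) auto
        also have "\<dots> \<le> B * (E * q)" using B pq E by (intro mult_left_mono) auto
        finally show ?thesis using B by (intro mult_left_mono mult_right_mono) auto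
      qed
      finally have b: "norm ?b \<le> B * B * E * q * norm x" by (simp add: mult_ac)
      have "?D u (coeff Z u x, 0) - ?D s (coeff Z s x, 0) = ?a + ?b"
        by (simp add: Ds.add[symmetric] blinfun.diff_left algebra_simps)
      then show "norm (?D u (coeff Z u x, 0) - ?D s (coeff Z s x, 0))
          \<le> 2 * B * B * E * q * norm x"
        using norm_triangle_ineq[of ?a ?b] a b by (simp only:)
    qed (use B E q in auto)
    also have "\<dots> \<le> c_tensor * (2 * B * B * E * q) * (M * (p * p))"
      using cn B E q M sut dpp[of u t]
      by (intro mult_left_mono order_trans[OF M(3)]) auto
    finally show ?thesis by (simp add: mult_ac)
  qed
  moreover have "norm T4 \<le> c_tensor * (B * E) * (E * M) * (p * p * q)"
  proof -
    have "norm T4 \<le> c_tensor * (B * (E * q)) * norm (cross Z h u t)"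
      unfolding T4_def
    proof (rule norm_tensor_apply_cross_le)
      fix x
      have "norm (?D u (0, x) - ?D s (0, x)) \<le> B * norm ((Z u, A Z u) - (Z s, A Z s)) powr \<alpha> * norm x"
        using \<sigma>_deriv_holder[of "(Z u, A Z u)" "(0, x)" "(Z s, A Z s)"] by (simp add: norm_Pair)
      also have "\<dots> \<le> B * (E * q) * norm x"
        using B pair_\<alpha> by (intro mult_right_mono mult_left_mono) auto
      finally show "norm (?D u (0, x) - ?D s (0, x)) \<le> B * (E * q) * norm x" .
    qed (use B E q in auto)
    also have "\<dots> \<le> c_tensor * (B * (E * q)) * (E * M * (p * p))"
      using cn B E q Wut by (intro mult_left_mono) auto
    finally show ?thesis by (simp add: mult_ac)
  qed
  ultimately show ?thesis
    unfolding dq by (simp only: distrib_right)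
qed

end

lemma small_powr:
  fixes K e c :: real
  assumes "0 < e" "0 \<le> K" "0 < c"
  obtains \<delta> where "0 < \<delta>" "\<delta> \<le> 1" "\<And>x. \<lbrakk>0 \<le> x; x \<le> \<delta>\<rbrakk> \<Longrightarrow> K * x powr e \<le> c"
proof -
  define \<delta> where "\<delta> = min 1 ((c / (K + 1)) powr (1 / e))"
  have "0 < \<delta>" using assms by (auto simp: \<delta>_def)
  moreover have "K * x powr e \<le> c" if "0 \<le> x" "x \<le> \<delta>" for x
  proof -
    have "x powr e \<le> ((c / (K + 1)) powr (1 / e)) powr e"
      using that assms by (intro powr_mono2) (auto simp: \<delta>_def)
    also have "\<dots> = c / (K + 1)" using assms by (simp add: powr_powr)
    finally have "K * x powr e \<le> K * (c / (K + 1))" using assms by (intro mult_left_mono) auto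
    also have "\<dots> \<le> c" using assms by (simp add: field_simps)
    finally show ?thesis .
  qed
  ultimately show thesis using that[of \<delta>] by (auto simp: \<delta>_def)
qed

text \<open>Halving n times brings every interval down to length \<delta>, and each halving costs a
  factor 2.\<close>

lemma hoelder_on_local_to_global:
  fixes x :: "real \<Rightarrow> 'a::real_normed_vector"
  assumes local: "\<And>s t. \<lbrakk>0 \<le> s; s \<le> t; t \<le> T; t - s \<le> \<delta>\<rbrakk> \<Longrightarrow> norm (x t - x s) \<le> C * (t - s) powr e"
    and e: "0 \<le> e" and C: "0 \<le> C" and n: "T \<le> \<delta> * 2 ^ n"
  shows "hoelder_on 0 T (2 ^ n * C) e x"
proof -
  have "norm (x t - x s) \<le> 2 ^ m * C * (t - s) powr e"
    if "0 \<le> s" "s \<le> t" "t \<le> T" "t - s \<le> \<delta> * 2 ^ m" for m s t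
    using that
  proof (induction m arbitrary: s t)
    case 0
    then show ?case using local by simp
  next
    case (Suc m)
    let ?u = "(s + t) / 2"
    have "norm (x t - x s) \<le> norm (x ?u - x s) + norm (x t - x ?u)"
      using norm_triangle_ineq[of "x ?u - x s" "x t - x ?u"] by simp
    also have "\<dots> \<le> 2 ^ m * C * (?u - s) powr e + 2 ^ m * C * (t - ?u) powr e"
      using Suc.prems by (intro add_mono Suc.IH) (auto simp: field_simps)
    also have "\<dots> \<le> 2 ^ m * C * (t - s) powr e + 2 ^ m * C * (t - s) powr e"
      using Suc.prems e C by (intro add_mono mult_left_mono powr_mono2) (auto simp: field_simps)
    finally show ?case by (simp add: mult_ac)
  qed
  then show ?thesis
    unfolding hoelder_on_def using n by (smt (verit, best))
qed

section \<open>Euler bounds as a criterion for solutions with a Lipschitz driver\<close>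

context path_dependent_rde
begin

definition euler_bound :: "(real \<Rightarrow> real^'d) \<Rightarrow> (real \<Rightarrow> real^'n) \<Rightarrow> real \<Rightarrow> real \<Rightarrow> bool" where
  "euler_bound h Z C e \<longleftrightarrow> (\<forall>s t. 0 \<le> s \<and> s \<le> t \<and> t \<le> T \<longrightarrow>
     norm (remainder h Z s t) \<le> C * (t - s) powr e)"

text \<open>The exponent 1 + \<beta> is what Euler polygons give for a Lipschitz driver. Limits of
  solutions only inherit the exponent \<theta>, so the identification of solutions below accepts any
  exponent above 1.\<close>

definition euler_solution :: "(real \<Rightarrow> real^'d) \<Rightarrow> (real \<Rightarrow> real^'n) \<Rightarrow> bool" where
  "euler_solution h Z \<longleftrightarrow> h \<in> holder_paths 1 T \<and> Z \<in> paths \<and> (\<exists>C\<ge>0. euler_bound h Z C (1 + \<beta>))"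

lemma euler_boundD:
  "\<lbrakk>euler_bound h Z C e; 0 \<le> s; s \<le> t; t \<le> T\<rbrakk> \<Longrightarrow>
     norm (remainder h Z s t) \<le> C * (t - s) powr e"
  by (simp add: euler_bound_def)

lemma coeff_hoelder:
  assumes Z: "Z \<in> paths" and L: "0 \<le> L" "hoelder_on 0 T L \<beta> Z"
    and st: "0 \<le> s" "s \<le> t" "t \<le> T"
  shows "norm (coeff Z t - coeff Z s) \<le> B * (L + F (L * T powr \<beta>) * L) * (t - s) powr \<beta>"
proof -
  have "hoelder_on 0 T (F (L * T powr \<beta>) * L) \<beta> (A Z)"
    by (rule A_hoelder[OF Z]) (use L in auto)
  then have "norm (coeff Z t - coeff Z s) \<le> B * (L * (t - s) powr \<beta> + F (L * T powr \<beta>) * L * (t - s) powr \<beta>)"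
    using B hoelder_onD[OF L(2) st] hoelder_onD[OF _ st]
    by (intro order_trans[OF norm_coeff_diff] mult_left_mono add_mono) auto
  then show ?thesis by (simp add: algebra_simps)
qed

text \<open>For a Lipschitz driver the area term has order 2 and the cross term order 1 + \<beta>,
  so neither affects the limit of the sums and the germ may be replaced by its first-order part.
  \<open>K\<close> depends on the Lipschitz constant \<open>H\<close> and is used only
  qualitatively.\<close>

lemma smooth_driver_bounds:
  assumes Z: "Z \<in> paths" and h: "hoelder_on 0 T H 1 h" "0 \<le> H"
  obtains K where "0 \<le> K"
    "\<And>s t. \<lbrakk>0 \<le> s; s \<le> t; t \<le> T\<rbrakk> \<Longrightarrow>
        norm (germ h Z s t - coeff Z s (h t - h s)) \<le> K * (t - s) powr (1 + \<beta>)"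
    "\<And>s t. \<lbrakk>0 \<le> s; s \<le> t; t \<le> T\<rbrakk> \<Longrightarrow> norm (coeff Z t - coeff Z s) \<le> K * (t - s) powr \<beta>"
proof -
  obtain L where L: "0 \<le> L" "hoelder_on 0 T L \<beta> Z"
    using Z by (auto simp: holder_paths_from_def holder_paths_iff)
  let ?N = "L * T powr \<beta>"
  define C where "C = F ?N * L"
  have C: "0 \<le> C" using F_pos[of ?N] L by (simp add: C_def)
  have \<Psi>: "hoelder_on 0 T C \<beta> (A Z)"
    unfolding C_def by (rule A_hoelder[OF Z]) (use L in auto)
  define K1 where "K1 = c_tensor * (B * B) * (H * H * T powr (1 - \<beta>)) + c_tensor * B * (C * H)"
  define K where "K = K1 + B * (L + C)"
  have K1: "0 \<le> K1" and K: "0 \<le> K"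
    using c_tensor_nonneg B C L h(2) by (auto simp: K1_def K_def)
  have 1: "norm (germ h Z s t - coeff Z s (h t - h s)) \<le> K * (t - s) powr (1 + \<beta>)"
    if st: "0 \<le> s" "s \<le> t" "t \<le> T" for s t
  proof -
    interpret \<Psi>: stieltjes s t \<beta> C H "A Z" h "\<lambda>(u, v). h v - h u"
      by unfold_locales (use \<Psi> h \<beta> C st in \<open>auto intro: hoelder_on_subset\<close>)
    interpret hh: stieltjes s t 1 H H h h "\<lambda>(u, v). h v - h u"
      using h st by (intro stieltjes_smooth)
    have "norm (area h s t) \<le> H * H * (t - s) powr 2"
      using hh.norm_integral_le st by (simp add: area_def)
    also have "\<dots> \<le> H * H * (T powr (2 - (1 + \<beta>)) * (t - s) powr (1 + \<beta>))"
      using st \<beta> h by (intro mult_left_mono powr_le_powr_interval) auto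
    finally have a: "norm (area h s t) \<le> H * H * T powr (1 - \<beta>) * (t - s) powr (1 + \<beta>)"
      by (simp add: mult_ac)
    have b: "norm (cross Z h s t) \<le> C * H * (t - s) powr (1 + \<beta>)"
      using \<Psi>.norm_integral_le st by (simp add: cross_def)
    have "norm (germ h Z s t - coeff Z s (h t - h s))
        \<le> c_tensor * (B * B) * (H * H * T powr (1 - \<beta>) * (t - s) powr (1 + \<beta>))
          + c_tensor * B * (C * H * (t - s) powr (1 + \<beta>))"
      using a b B c_tensor_nonneg by (intro order_trans[OF norm_germ_diff_le] add_mono mult_left_mono) auto
    also have "\<dots> = K1 * (t - s) powr (1 + \<beta>)" by (simp add: K1_def algebra_simps)
    also have "\<dots> \<le> K * (t - s) powr (1 + \<beta>)"
      using B L C by (intro mult_right_mono) (auto simp: K_def)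
    finally show ?thesis .
  qed
  have 2: "norm (coeff Z t - coeff Z s) \<le> K * (t - s) powr \<beta>" if st: "0 \<le> s" "s \<le> t" "t \<le> T" for s t
  proof -
    have "norm (coeff Z t - coeff Z s) \<le> B * (L + C) * (t - s) powr \<beta>"
      using coeff_hoelder[OF Z L st] by (simp add: C_def)
    also have "\<dots> \<le> K * (t - s) powr \<beta>"
      using K1 by (intro mult_right_mono) (auto simp: K_def)
    finally show ?thesis .
  qed
  show thesis by (rule that[OF K 1 2])
qed

text \<open>The germ and the increment of \<open>Z\<close> both differ from the first-order term by
  an error of order above 1, so the germ sums converge to the increment. The remainder in the
  controlled path condition is fine because e > 1 and 2\<beta> is at most 1.\<close>

lemma rde_solution_if_euler_bound:
  assumes Z: "Z \<in> paths" and h: "h \<in> holder_paths 1 T"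
    and e: "1 < e" and C: "0 \<le> C" and euler: "euler_bound h Z C e"
  shows "rde_solution \<beta> T \<sigma> A \<xi> (smooth_rough_path T h) (Z, restrict (coeff Z) {0..T})"
proof -
  obtain H where H: "1 \<le> H" "hoelder_on 0 T H 1 h" using holder_paths_1E[OF h] .
  then have "0 \<le> H" by simp
  obtain K where K: "0 \<le> K"
    "\<And>s t. \<lbrakk>0 \<le> s; s \<le> t; t \<le> T\<rbrakk> \<Longrightarrow>
        norm (germ h Z s t - coeff Z s (h t - h s)) \<le> K * (t - s) powr (1 + \<beta>)"
    "\<And>s t. \<lbrakk>0 \<le> s; s \<le> t; t \<le> T\<rbrakk> \<Longrightarrow> norm (coeff Z t - coeff Z s) \<le> K * (t - s) powr \<beta>"
    using smooth_driver_bounds[OF Z H(2) \<open>0 \<le> H\<close>] by blast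
  let ?Z' = "restrict (coeff Z) {0..T}"
  have "hoelder_on 0 T K \<beta> ?Z'"
    unfolding hoelder_on_def using K(3) by auto
  then have Z': "?Z' \<in> holder_paths \<beta> T"
    unfolding holder_paths_iff using K(1) by auto
  have R: "norm (Z t - Z s - blinfun_apply (?Z' s) (fst (smooth_rough_path T h) (s, t)))
      \<le> C * T powr (e - 2 * \<beta>) * (t - s) powr (2 * \<beta>)" if st: "0 \<le> s" "s < t" "t \<le> T" for s t
  proof -
    have "norm (remainder h Z s t) \<le> C * (t - s) powr e"
      using euler st by (auto simp: euler_bound_def)
    also have "\<dots> \<le> C * (T powr (e - 2 * \<beta>) * (t - s) powr (2 * \<beta>))"
      using st e \<beta> C by (intro mult_left_mono powr_le_powr_interval) auto
    finally show ?thesis using st by (simp add: smooth_rough_path_def simplex2_def mult_ac)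
  qed
  have controlled: "(Z, ?Z') \<in> controlled_paths \<beta> T (fst (smooth_rough_path T h))"
    unfolding controlled_paths_def
    using Z Z' R C by (auto simp: holder_paths_from_def infinity_ennreal_def[symmetric] holder2_norm_finite_iff
        simp del: infinity_ennreal_def intro!: exI[of _ "C * T powr (e - 2 * \<beta>)"])
  have integral: "has_rough_integral \<sigma> Z ?Z' (A Z) (smooth_rough_path T h) 0 t (Z t - \<xi>)"
    if t: "0 \<le> t" "t \<le> T" for t
  proof -
    \<comment> \<open>The two errors have orders \<open>e\<close> and 1 + \<beta>; the smaller
      exponent, still above 1, serves for both.\<close>
    define e' where "e' = min e (1 + \<beta>)"
    define K' where "K' = C * T powr (e - e') + K * T powr (1 + \<beta> - e')"
    have "(partition_sum (rough_germ \<sigma> Z ?Z' (A Z) (smooth_rough_path T h)) \<longlongrightarrow> Z t - Z 0) (mesh_filter 0 t)"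
    proof (rule riemann_sum_tendsto_increment[of e' K'])
      show "1 < e'" "0 \<le> K'" using e \<beta> C K by (auto simp: e'_def K'_def)
      fix u v assume uv: "0 \<le> u" "u < v" "v \<le> t"
      have germ: "rough_germ \<sigma> Z ?Z' (A Z) (smooth_rough_path T h) u v = germ h Z u v"
        using uv t by (intro rough_germ_smooth) auto
      have "norm (germ h Z u v - (Z v - Z u))
          \<le> norm (germ h Z u v - coeff Z u (h v - h u))
            + norm (remainder h Z u v)"
        using norm_triangle_ineq4[of "germ h Z u v - coeff Z u (h v - h u)"
            "remainder h Z u v"] by (simp add: algebra_simps)
      also have "\<dots> \<le> K * (v - u) powr (1 + \<beta>) + C * (v - u) powr e"
        using uv t by (intro add_mono K(2) euler_boundD[OF euler]) auto
      also have "\<dots> \<le> K * (T powr (1 + \<beta> - e') * (v - u) powr e') + C * (T powr (e - e') * (v - u) powr e')"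
        using uv t K C by (intro add_mono mult_left_mono powr_le_powr_interval) (auto simp: e'_def)
      also have "\<dots> = K' * (v - u) powr e'" by (simp add: K'_def algebra_simps)
      finally show "norm (rough_germ \<sigma> Z ?Z' (A Z) (smooth_rough_path T h) u v - (Z v - Z u)) \<le> K' * (v - u) powr e'"
        unfolding germ .
    qed (use t in auto)
    then show ?thesis
      using Z by (simp add: has_rough_integral_def holder_paths_from_def)
  qed
  show ?thesis
    unfolding rde_solution_def using Z controlled integral by (auto simp: coeff_def)
qed

section \<open>The a priori bound by induction over scales\<close>

definition rough_bound :: "(real \<Rightarrow> real^'d) \<Rightarrow> real \<Rightarrow> bool" where
  "rough_bound h M \<longleftrightarrow> 0 \<le> M \<and> (\<forall>x y. 0 \<le> x \<longrightarrow> x \<le> y \<longrightarrow> y \<le> T \<longrightarrow>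
     norm (h y - h x) \<le> M * (y - x) powr \<beta> \<and> norm (area h x y) \<le> M * (y - x) powr (2 * \<beta>))"

abbreviation \<theta> where "\<theta> \<equiv> \<beta> * (2 + \<alpha>)"

text \<open>The constants from here to \<open>sewing_const\<close> close the induction over scales.
  In \<open>path_const\<close>, B * M is the first-order term and 1 pays for the Euler remainder. In
  \<open>remainder_const\<close>, 1 pays for the sewing error and the other summands for the area
  and cross terms. On intervals of twice the length, 2 * \<open>path_const\<close> bounds the
  increments of Z, \<open>pair_const\<close> those of (Z, A Z), and \<open>doubled_const\<close> the
  remainder: two halves plus a change of coefficient. \<open>defect_const\<close> is the constant of
  \<open>germ_defect\<close> for these values.\<close>

definition path_const :: "real \<Rightarrow> real" where
  "path_const M = B * M + 1"

definition pair_const :: "real \<Rightarrow> real" where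
  "pair_const M = 2 * path_const M * (1 + F 1)"

definition remainder_const :: "real \<Rightarrow> real" where
  "remainder_const M = 1 + c_tensor * (B * B) * M + c_tensor * B * (pair_const M * M)"

definition doubled_const :: "real \<Rightarrow> real" where
  "doubled_const M = 2 * remainder_const M + B * pair_const M * M"

definition defect_const :: "real \<Rightarrow> real" where
  "defect_const M = B * M * (pair_const M * pair_const M) + B * M * doubled_const M
     + c_tensor * (2 * B * B * pair_const M) * M + c_tensor * (B * pair_const M) * (pair_const M * M)"

definition sewing_const :: "real \<Rightarrow> real" where
  "sewing_const M = defect_const M / (1 - 2 powr (1 - \<theta>))"

text \<open>The three smallness conditions say, in order: \<open>F\<close> may be evaluated at 1;
  the sewing error is at most (t - s)^(2\<beta>); the Euler remainder is at most (t - s)^\<beta>.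
  The driver enters through \<open>M\<close> alone.\<close>

definition admissible :: "real \<Rightarrow> real \<Rightarrow> bool" where
  "admissible M \<delta> \<longleftrightarrow> 0 < \<delta> \<and> \<delta> \<le> 1 \<and> (\<forall>x. 0 \<le> x \<longrightarrow> x \<le> \<delta> \<longrightarrow>
     2 * path_const M * x powr \<beta> \<le> 1 \<and> sewing_const M * x powr (\<alpha> * \<beta>) \<le> 1 \<and> remainder_const M * x powr \<beta> \<le> 1)"

definition controlled_upto :: "real \<Rightarrow> real \<Rightarrow> (real \<Rightarrow> real^'d) \<Rightarrow> (real \<Rightarrow> real^'n) \<Rightarrow> bool" where
  "controlled_upto M \<delta> h Z \<longleftrightarrow> (\<forall>s t. 0 \<le> s \<longrightarrow> s \<le> t \<longrightarrow> t \<le> T \<longrightarrow> t - s \<le> \<delta> \<longrightarrow>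
     norm (Z t - Z s) \<le> path_const M * (t - s) powr \<beta> \<and>
     norm (remainder h Z s t) \<le> remainder_const M * (t - s) powr (2 * \<beta>))"

lemma controlled_uptoD:
  assumes "controlled_upto M \<delta> h Z" "0 \<le> s" "s \<le> t" "t \<le> T" "t - s \<le> \<delta>"
  shows "norm (Z t - Z s) \<le> path_const M * (t - s) powr \<beta>"
    and "norm (remainder h Z s t) \<le> remainder_const M * (t - s) powr (2 * \<beta>)"
  using assms by (auto simp: controlled_upto_def)

lemma consts_ge:
  assumes "0 \<le> M"
  shows "1 \<le> path_const M" "1 \<le> pair_const M" "1 \<le> remainder_const M" "0 \<le> doubled_const M"
    "0 \<le> defect_const M" "0 \<le> sewing_const M"
proof -
  have F1: "0 < F 1" by (rule F_pos) simp
  show 1: "1 \<le> path_const M" using B assms by (simp add: path_const_def)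
  have "1 * 1 \<le> (2 * path_const M) * (1 + F 1)"
    using 1 F1 by (intro mult_mono) auto
  then show 2: "1 \<le> pair_const M" by (simp add: pair_const_def)
  show 3: "1 \<le> remainder_const M"
    using 2 B assms c_tensor_nonneg by (simp add: remainder_const_def)
  show 4: "0 \<le> doubled_const M" using 2 3 B assms by (simp add: doubled_const_def)
  show 5: "0 \<le> defect_const M"
    unfolding defect_const_def using 2 4 B assms c_tensor_nonneg by (intro add_nonneg_nonneg) auto
  have "2 powr (1 - \<theta>) < (1::real)"
    using \<alpha>(3) powr_less_mono[of "1 - \<theta>" 0 2] by simp
  then show "0 \<le> sewing_const M"
    unfolding sewing_const_def using 5 by (intro divide_nonneg_nonneg) auto
qed

lemma admissible_exists:
  assumes "0 \<le> M"
  shows "\<exists>\<delta>. admissible M \<delta>"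
proof -
  note c = consts_ge[OF assms]
  obtain \<delta>1 where 1: "0 < \<delta>1" "\<delta>1 \<le> 1" "\<And>x. \<lbrakk>0 \<le> x; x \<le> \<delta>1\<rbrakk> \<Longrightarrow> 2 * path_const M * x powr \<beta> \<le> 1"
    by (rule small_powr[of \<beta> "2 * path_const M" 1]) (use c \<beta> in auto)
  obtain \<delta>2 where 2: "0 < \<delta>2" "\<delta>2 \<le> 1" "\<And>x. \<lbrakk>0 \<le> x; x \<le> \<delta>2\<rbrakk> \<Longrightarrow> sewing_const M * x powr (\<alpha> * \<beta>) \<le> 1"
    by (rule small_powr[of "\<alpha> * \<beta>" "sewing_const M" 1]) (use c \<alpha> \<beta> in auto)
  obtain \<delta>3 where 3: "0 < \<delta>3" "\<delta>3 \<le> 1" "\<And>x. \<lbrakk>0 \<le> x; x \<le> \<delta>3\<rbrakk> \<Longrightarrow> remainder_const M * x powr \<beta> \<le> 1"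
    by (rule small_powr[of \<beta> "remainder_const M" 1]) (use c \<beta> in auto)
  have "admissible M (min \<delta>1 (min \<delta>2 \<delta>3))"
    unfolding admissible_def using 1 2 3 by auto
  then show ?thesis by blast
qed

text \<open>Doubling the scale at most doubles the bound on the increments. The sewing bound with these worse
  constants then recovers the original ones, because admissibility makes its contribution small.\<close>

lemma controlled_upto_double:
  assumes Z: "Z \<in> paths" and h: "hoelder_on 0 T H 1 h" "0 \<le> H"
    and euler: "euler_bound h Z C (1 + \<beta>)" "0 \<le> C"
    and M: "rough_bound h M" and \<delta>\<^sub>0: "admissible M \<delta>\<^sub>0" "2 * \<delta> \<le> \<delta>\<^sub>0"
    and good: "controlled_upto M \<delta> h Z"
  shows "controlled_upto M (2 * \<delta>) h Z"
    and "\<And>s t. \<lbrakk>0 \<le> s; s \<le> t; t \<le> T; t - s \<le> 2 * \<delta>\<rbrakk> \<Longrightarrow>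
        norm (Z t - Z s - germ h Z s t) \<le> sewing_const M * (t - s) powr \<theta>"
proof -
  have M0: "0 \<le> M" using M by (simp add: rough_bound_def)
  note c = consts_ge[OF M0]
  define L where "L = 2 * path_const M"
  have L: "1 \<le> L" using c by (simp add: L_def)
  have F1: "0 < F 1" by (rule F_pos) simp
  have Mh: "norm (h y - h x) \<le> M * (y - x) powr \<beta>" "norm (area h x y) \<le> M * (y - x) powr (2 * \<beta>)"
    if "0 \<le> x" "x \<le> y" "y \<le> T" for x y using M that by (auto simp: rough_bound_def)
  have small: "L * x powr \<beta> \<le> 1" "sewing_const M * x powr (\<alpha> * \<beta>) \<le> 1" "remainder_const M * x powr \<beta> \<le> 1" "x \<le> 1"
    if "0 \<le> x" "x \<le> 2 * \<delta>" for x
    using \<delta>\<^sub>0 that by (auto simp: admissible_def L_def)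
  have mid: "norm (Z t - Z s) \<le> L * (t - s) powr \<beta>"
    if st: "0 \<le> s" "s \<le> t" "t \<le> T" "t - s \<le> 2 * \<delta>" for s t
  proof -
    let ?u = "(s + t) / 2"
    have "norm (Z t - Z s) \<le> norm (Z ?u - Z s) + norm (Z t - Z ?u)"
      using norm_triangle_ineq[of "Z ?u - Z s" "Z t - Z ?u"] by simp
    also have "\<dots> \<le> path_const M * (?u - s) powr \<beta> + path_const M * (t - ?u) powr \<beta>"
      using st by (intro add_mono controlled_uptoD(1)[OF good]) (auto simp: field_simps)
    also have "\<dots> \<le> path_const M * (t - s) powr \<beta> + path_const M * (t - s) powr \<beta>"
      using st c \<beta> by (intro add_mono mult_left_mono powr_mono2) (auto simp: field_simps)
    finally show ?thesis by (simp add: L_def)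
  qed
  have Lst: "hoelder_on s t L \<beta> Z" if st: "0 \<le> s" "s \<le> t" "t \<le> T" "t - s \<le> 2 * \<delta>" for s t
    unfolding hoelder_on_def using mid st by auto
  have coeff: "norm (coeff Z t - coeff Z s) \<le> B * pair_const M * (t - s) powr \<beta>"
    if st: "0 \<le> s" "s \<le> t" "t \<le> T" "t - s \<le> 2 * \<delta>" for s t
  proof -
    have "norm (A Z t - A Z s) \<le> F 1 * L * (t - s) powr \<beta>"
      by (rule hoelder_onD[OF A_hoelder[OF Z st(1,3) Lst[OF st] _ small(1)[of "t - s"]]])
        (use L st in auto)
    then have "norm (coeff Z t - coeff Z s) \<le> B * (L * (t - s) powr \<beta> + F 1 * L * (t - s) powr \<beta>)"
      using B mid[OF st] by (intro order_trans[OF norm_coeff_diff] mult_left_mono add_mono) auto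
    then show ?thesis by (simp add: pair_const_def L_def algebra_simps)
  qed
  have rem: "norm (remainder h Z s t) \<le> doubled_const M * (t - s) powr (2 * \<beta>)"
    if st: "0 \<le> s" "s \<le> t" "t \<le> T" "t - s \<le> 2 * \<delta>" for s t
  proof -
    let ?u = "(s + t) / 2"
    let ?R = "\<lambda>s t. remainder h Z s t"
    have u: "s \<le> ?u" "?u \<le> t" "?u - s \<le> \<delta>" "t - ?u \<le> \<delta>" using st by (auto simp: field_simps)
    have "norm ((coeff Z ?u - coeff Z s) (h t - h ?u))
        \<le> (B * pair_const M * (?u - s) powr \<beta>) * (M * (t - ?u) powr \<beta>)"
      using coeff[of s ?u] Mh(1)[of ?u t] st u B c
      by (intro order_trans[OF norm_blinfun] mult_mono) auto
    also have "\<dots> \<le> (B * pair_const M * (t - s) powr \<beta>) * (M * (t - s) powr \<beta>)"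
      using st u B c M0 \<beta> by (intro mult_mono mult_left_mono powr_mono2) auto
    also have "\<dots> = B * pair_const M * M * (t - s) powr (2 * \<beta>)"
      by (simp add: powr_add[symmetric] mult_ac)
    finally have 1: "norm ((coeff Z ?u - coeff Z s) (h t - h ?u)) \<le> B * pair_const M * M * (t - s) powr (2 * \<beta>)" .
    have half: "norm (?R x y) \<le> remainder_const M * (t - s) powr (2 * \<beta>)" if "s \<le> x" "x \<le> y" "y \<le> t" "y - x \<le> \<delta>" for x y
    proof -
      have "norm (?R x y) \<le> remainder_const M * (y - x) powr (2 * \<beta>)"
        using good that st by (auto simp: controlled_upto_def)
      also have "\<dots> \<le> remainder_const M * (t - s) powr (2 * \<beta>)"
        using that c \<beta> by (intro mult_left_mono powr_mono2) auto
      finally show ?thesis .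
    qed
    have split: "?R s t = ?R s ?u + ?R ?u t + (coeff Z ?u - coeff Z s) (h t - h ?u)"
      by (simp add: blinfun.diff_left blinfun.diff_right)
    have "norm (?R s t) \<le> norm (?R s ?u) + norm (?R ?u t) + norm ((coeff Z ?u - coeff Z s) (h t - h ?u))"
      unfolding split by (intro order_trans[OF norm_triangle_ineq] add_right_mono norm_triangle_ineq)
    also have "\<dots> \<le> remainder_const M * (t - s) powr (2 * \<beta>) + remainder_const M * (t - s) powr (2 * \<beta>)
        + B * pair_const M * M * (t - s) powr (2 * \<beta>)"
      using u by (intro add_mono half 1) auto
    also have "\<dots> = doubled_const M * (t - s) powr (2 * \<beta>)"
      by (simp add: doubled_const_def algebra_simps)
    finally show ?thesis .
  qed
  \<comment> \<open>\<open>K\<close> involves the Lipschitz constant of \<open>h\<close>. It only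
    supplies the crude bound that sewing requires and does not occur in the sewing
    conclusion.\<close>
  obtain K where K: "0 \<le> K"
    "\<And>s t. \<lbrakk>0 \<le> s; s \<le> t; t \<le> T\<rbrakk> \<Longrightarrow>
        norm (germ h Z s t - coeff Z s (h t - h s)) \<le> K * (t - s) powr (1 + \<beta>)"
    by (rule smooth_driver_bounds[OF Z h]) (rule that)
  have sew: "norm (Z t - Z s - germ h Z s t) \<le> sewing_const M * (t - s) powr \<theta>"
    if st: "0 \<le> s" "s \<le> t" "t \<le> T" "t - s \<le> 2 * \<delta>" for s t
    unfolding sewing_const_def
  proof (rule dyadic_sewing_bound[where J = "\<lambda>s t. Z t - Z s - germ h Z s t" and e = "1 + \<beta>" and C = "C + K"])
    show "1 < \<theta>" "1 < 1 + \<beta>" using \<alpha> \<beta> by auto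
    show "0 \<le> defect_const M" "0 \<le> C + K" using B M0 c c_tensor_nonneg euler K by auto
    fix s t assume st: "0 \<le> s" "s \<le> t" "t \<le> T" "t - s \<le> 2 * \<delta>"
    have "norm (Z t - Z s - germ h Z s t) \<le> norm (remainder h Z s t)
        + norm (germ h Z s t - coeff Z s (h t - h s))"
      using norm_triangle_ineq4[of "remainder h Z s t"
          "germ h Z s t - coeff Z s (h t - h s)"] by (simp add: algebra_simps)
    also have "\<dots> \<le> C * (t - s) powr (1 + \<beta>) + K * (t - s) powr (1 + \<beta>)"
      using st by (intro add_mono K(2) euler_boundD[OF euler(1)]) auto
    finally show "norm (Z t - Z s - germ h Z s t) \<le> (C + K) * (t - s) powr (1 + \<beta>)"
      by (simp add: algebra_simps)
  next
    fix s u t assume sut: "0 \<le> s" "s \<le> u" "u \<le> t" "t \<le> T" "t - s \<le> 2 * \<delta>"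
    have EL: "L * (1 + F 1) = pair_const M" by (simp add: L_def pair_const_def)
    have "norm (germ h Z s t - germ h Z s u - germ h Z u t) \<le> defect_const M * (t - s) powr \<theta>"
      unfolding defect_const_def
    proof (rule germ_defect[OF Z h sut(1-4), where L = L, unfolded EL])
      show "t - s \<le> 1" "L * (t - s) powr \<beta> \<le> 1" using small[of "t - s"] sut by auto
      show "hoelder_on s t L \<beta> Z" using sut by (intro Lst) auto
      show "norm (remainder h Z s u) \<le> doubled_const M * (u - s) powr (2 * \<beta>)"
        using sut by (intro rem) auto
    qed (fact M0 Mh L c(4))+
    moreover have "norm (Z t - Z s - germ h Z s t - (Z u - Z s - germ h Z s u) - (Z t - Z u - germ h Z u t))
        = norm (germ h Z s t - germ h Z s u - germ h Z u t)"
      by (subst norm_minus_cancel[symmetric]) (simp add: algebra_simps)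
    ultimately show "norm (Z t - Z s - germ h Z s t - (Z u - Z s - germ h Z s u) - (Z t - Z u - germ h Z u t)) \<le> defect_const M * (t - s) powr \<theta>"
      by simp
  qed (use st in auto)
  then show "\<And>s t. \<lbrakk>0 \<le> s; s \<le> t; t \<le> T; t - s \<le> 2 * \<delta>\<rbrakk> \<Longrightarrow>
        norm (Z t - Z s - germ h Z s t) \<le> sewing_const M * (t - s) powr \<theta>" .
  have rem': "norm (remainder h Z s t) \<le> remainder_const M * (t - s) powr (2 * \<beta>)"
    if st: "0 \<le> s" "s \<le> t" "t \<le> T" "t - s \<le> 2 * \<delta>" for s t
  proof -
    have 1: "norm (Z t - Z s - germ h Z s t) \<le> (t - s) powr (2 * \<beta>)"
    proof -
      have "sewing_const M * (t - s) powr \<theta> = (sewing_const M * (t - s) powr (\<alpha> * \<beta>)) * (t - s) powr (2 * \<beta>)"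
        by (simp add: powr_add[symmetric] algebra_simps)
      also have "\<dots> \<le> 1 * (t - s) powr (2 * \<beta>)"
        using st small by (intro mult_right_mono) auto
      finally show ?thesis using sew[OF st] by simp
    qed
    have "norm (cross Z h s t) \<le> F 1 * (L * (t - s) powr \<beta>) * (M * (t - s) powr \<beta>)"
    proof (rule norm_cross_le[OF Z h st(1-3) Lst[OF st]])
      fix u assume "s \<le> u" "u \<le> t"
      then have "norm (h t - h u) \<le> M * (t - u) powr \<beta>" using st by (intro Mh) auto
      also have "\<dots> \<le> M * (t - s) powr \<beta>"
        using \<open>s \<le> u\<close> \<open>u \<le> t\<close> M0 \<beta> by (intro mult_left_mono powr_mono2) auto
      finally show "norm (h t - h u) \<le> M * (t - s) powr \<beta>" .
    qed (use L st small in auto)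
    also have "\<dots> = F 1 * L * M * (t - s) powr (2 * \<beta>)"
      by (simp add: powr_add[symmetric] mult_ac)
    also have "\<dots> \<le> pair_const M * M * (t - s) powr (2 * \<beta>)"
      using L M0 by (intro mult_right_mono) (auto simp: pair_const_def L_def)
    finally have 2: "norm (cross Z h s t) \<le> pair_const M * M * (t - s) powr (2 * \<beta>)" .
    have "norm (remainder h Z s t) \<le> (t - s) powr (2 * \<beta>) + (c_tensor * (B * B) * (M * (t - s) powr (2 * \<beta>))
        + c_tensor * B * (pair_const M * M * (t - s) powr (2 * \<beta>)))"
      using st B c_tensor_nonneg
      by (intro order_trans[OF norm_remainder_le] add_mono 1 mult_left_mono Mh 2) auto
    also have "\<dots> = remainder_const M * (t - s) powr (2 * \<beta>)"
      by (simp add: remainder_const_def algebra_simps)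
    finally show ?thesis .
  qed
  have "norm (Z t - Z s) \<le> path_const M * (t - s) powr \<beta>"
    if st: "0 \<le> s" "s \<le> t" "t \<le> T" "t - s \<le> 2 * \<delta>" for s t
  proof -
    have "norm (Z t - Z s) \<le> norm (remainder h Z s t) + norm (coeff Z s (h t - h s))"
      using norm_triangle_ineq[of "remainder h Z s t" "coeff Z s (h t - h s)"] by simp
    also have "\<dots> \<le> remainder_const M * (t - s) powr (2 * \<beta>) + B * (M * (t - s) powr \<beta>)"
      using st B by (intro add_mono rem' order_trans[OF norm_coeff_apply] mult_left_mono Mh) auto
    also have "remainder_const M * (t - s) powr (2 * \<beta>) = (remainder_const M * (t - s) powr \<beta>) * (t - s) powr \<beta>"
      by (simp add: powr_add[symmetric])
    also have "\<dots> \<le> 1 * (t - s) powr \<beta>"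
      using st small by (intro mult_right_mono) auto
    finally show ?thesis by (simp add: path_const_def algebra_simps)
  qed
  then show "controlled_upto M (2 * \<delta>) h Z"
    unfolding controlled_upto_def using rem' by blast
qed

text \<open>Start of the induction over scales: 1 + \<beta> exceeds 2\<beta>, so on short intervals
  the constant \<open>C\<close> is absorbed. The scale depends on the individual solution, which is
  harmless since only its positivity is used.\<close>

lemma controlled_upto_small:
  assumes euler: "euler_bound h Z C (1 + \<beta>)" "0 \<le> C" and M: "rough_bound h M"
  shows "\<exists>\<delta>>0. \<forall>\<delta>'\<le>\<delta>. controlled_upto M \<delta>' h Z"
proof -
  have M0: "0 \<le> M" using M by (simp add: rough_bound_def)
  note c = consts_ge[OF M0]
  obtain \<delta> where \<delta>: "0 < \<delta>" "\<delta> \<le> 1" "\<And>x. \<lbrakk>0 \<le> x; x \<le> \<delta>\<rbrakk> \<Longrightarrow> C * x powr (1 - \<beta>) \<le> 1"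
    by (rule small_powr[of "1 - \<beta>" C 1]) (use euler \<beta> in auto)
  have "controlled_upto M \<delta>' h Z" if "\<delta>' \<le> \<delta>" for \<delta>'
    unfolding controlled_upto_def
  proof (intro allI impI)
    fix s t assume st: "0 \<le> s" "s \<le> t" "t \<le> T" "t - s \<le> \<delta>'"
    have "norm (remainder h Z s t) \<le> C * (t - s) powr (1 + \<beta>)"
      using st by (intro euler_boundD[OF euler(1)])
    also have "\<dots> = (C * (t - s) powr (1 - \<beta>)) * (t - s) powr (2 * \<beta>)"
      by (simp add: powr_add[symmetric] algebra_simps)
    also have "\<dots> \<le> 1 * (t - s) powr (2 * \<beta>)"
      using st \<open>\<delta>' \<le> \<delta>\<close> by (intro mult_right_mono \<delta>) auto
    finally have R: "norm (remainder h Z s t) \<le> (t - s) powr (2 * \<beta>)" by simp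
    have le: "(t - s) powr (2 * \<beta>) \<le> (t - s) powr \<beta>"
    proof (cases "t = s")
      case False
      then show ?thesis using st \<open>\<delta>' \<le> \<delta>\<close> \<delta> \<beta> by (intro powr_mono') auto
    qed simp
    have "norm (Z t - Z s) \<le> norm (remainder h Z s t) + norm (coeff Z s (h t - h s))"
      using norm_triangle_ineq[of "remainder h Z s t" "coeff Z s (h t - h s)"] by simp
    also have "\<dots> \<le> (t - s) powr \<beta> + B * (M * (t - s) powr \<beta>)"
      using st B M by (intro add_mono order_trans[OF R le] order_trans[OF norm_coeff_apply] mult_left_mono)
        (auto simp: rough_bound_def)
    also have "\<dots> = path_const M * (t - s) powr \<beta>" by (simp add: path_const_def algebra_simps)
    finally show "norm (Z t - Z s) \<le> path_const M * (t - s) powr \<beta> \<and>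
        norm (remainder h Z s t) \<le> remainder_const M * (t - s) powr (2 * \<beta>)"
      using R c(3) mult_right_mono[OF c(3), of "(t - s) powr (2 * \<beta>)"] by simp
  qed
  then show ?thesis using \<delta>(1) by blast
qed

text \<open>Each solution satisfies the bounds at some scale of its own, and finitely many doublings
  carry them up to an admissible scale determined by \<open>M\<close>. The number of doublings
  depends on the solution, but the constants do not deteriorate along them.\<close>

theorem a_priori_bound:
  assumes "0 \<le> M"
  obtains \<delta> K G where "0 < \<delta>" "0 \<le> K" "0 \<le> G"
    "\<And>h Z. \<lbrakk>euler_solution h Z; rough_bound h M\<rbrakk> \<Longrightarrow> hoelder_on 0 T K \<beta> Z"
    "\<And>h Z s t. \<lbrakk>euler_solution h Z; rough_bound h M; 0 \<le> s; s \<le> t; t \<le> T; t - s \<le> \<delta>\<rbrakk> \<Longrightarrow>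
        norm (Z t - Z s - germ h Z s t) \<le> G * (t - s) powr \<theta>"
proof -
  note c = consts_ge[OF assms]
  obtain \<delta> where \<delta>: "admissible M \<delta>" using admissible_exists[OF assms] ..
  then have "0 < \<delta>" by (simp add: admissible_def)
  have pow: "\<exists>n. x \<le> y * 2 ^ n" if "0 < y" for x y :: real
    using real_arch_pow[of 2 "x / y"] that by (auto simp: divide_less_eq mult.commute intro: less_imp_le)
  obtain n where n: "T \<le> \<delta> * 2 ^ n" using pow[OF \<open>0 < \<delta>\<close>] ..
  have 1: "hoelder_on 0 T (2 ^ n * path_const M) \<beta> Z"
    and 2: "\<And>s t. \<lbrakk>0 \<le> s; s \<le> t; t \<le> T; t - s \<le> \<delta>\<rbrakk> \<Longrightarrow> norm (Z t - Z s - germ h Z s t) \<le> sewing_const M * (t - s) powr \<theta>"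
    if sol: "euler_solution h Z" and M: "rough_bound h M" for h Z
  proof -
    obtain C where Z: "Z \<in> paths" and euler: "euler_bound h Z C (1 + \<beta>)" "0 \<le> C"
      using sol by (auto simp: euler_solution_def)
    obtain H where "1 \<le> H" "hoelder_on 0 T H 1 h"
      using sol by (auto simp: euler_solution_def elim: holder_paths_1E)
    then have h: "hoelder_on 0 T H 1 h" "0 \<le> H" by auto
    obtain \<epsilon> where \<epsilon>: "0 < \<epsilon>" "\<And>\<delta>'. \<delta>' \<le> \<epsilon> \<Longrightarrow> controlled_upto M \<delta>' h Z"
      using controlled_upto_small[OF euler M] by blast
    \<comment> \<open>The doublings start at \<delta>/2 divided by 2^m and stop at \<delta>/2. The
      last one, from \<delta>/2 to \<delta>, is applied separately because it also yields the sewing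
      bound at scale \<delta>.\<close>
    obtain m where "\<delta> / 2 \<le> \<epsilon> * 2 ^ m" using pow[OF \<epsilon>(1)] ..
    then have m: "\<delta> / 2 / 2 ^ m \<le> \<epsilon>" by (simp add: field_simps)
    have "controlled_upto M (\<delta> / 2 / 2 ^ m * 2 ^ k) h Z" if "k \<le> m" for k
      using that
    proof (induction k)
      case 0
      then show ?case using \<epsilon>(2) m by simp
    next
      case (Suc k)
      have "2 * (\<delta> / 2 / 2 ^ m * 2 ^ k) \<le> \<delta>"
        using power_increasing[of k m "2 :: real"] \<open>0 < \<delta>\<close> Suc.prems by (simp add: pos_divide_le_eq)
      then have "controlled_upto M (2 * (\<delta> / 2 / 2 ^ m * 2 ^ k)) h Z"
        using Suc by (intro controlled_upto_double(1)[OF Z h euler M \<delta>]) auto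
      then show ?case by (simp add: mult_ac)
    qed
    from this[of m] have half: "controlled_upto M (\<delta> / 2) h Z" by simp
    note double = controlled_upto_double[OF Z h euler M \<delta> _ half]
    have "controlled_upto M \<delta> h Z" using double(1) by simp
    then show "hoelder_on 0 T (2 ^ n * path_const M) \<beta> Z"
      using n \<beta> c by (intro hoelder_on_local_to_global[of T \<delta>]) (auto simp: controlled_upto_def)
    show "norm (Z t - Z s - germ h Z s t) \<le> sewing_const M * (t - s) powr \<theta>"
      if "0 \<le> s" "s \<le> t" "t \<le> T" "t - s \<le> \<delta>" for s t
      using double(2)[of s t] that by simp
  qed
  show thesis
    by (rule that[OF \<open>0 < \<delta>\<close> _ c(6) 1 2]) (use c(1) in auto)
qed

end

section \<open>Compactness in weaker Hoelder norms\<close>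

lemma holder_dist_le:
  assumes "norm (x 0 - y 0) \<le> a" "0 \<le> b"
    and "\<And>s t. \<lbrakk>0 \<le> s; s < t; t \<le> T\<rbrakk> \<Longrightarrow> norm ((x t - y t) - (x s - y s)) \<le> b * (t - s) powr e"
  shows "holder_dist e T x y \<le> a + b"
proof -
  have "holder_norm e T (\<lambda>t. x t - y t) \<le> ennreal b"
    unfolding holder_norm_def using assms by (subst holder2_norm_le_iff) auto
  then have "enn2real (holder_norm e T (\<lambda>t. x t - y t)) \<le> b"
    using assms(2) by (simp add: enn2real_leI)
  then show ?thesis using assms(1) by (simp add: holder_dist_def)
qed

lemma holder_dist_nonneg: "0 \<le> holder_dist e T x y"
  by (simp add: holder_dist_def)

text \<open>Interpolation: a uniform Hoelder bound handles short increments, uniform convergence the long ones.\<close>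

lemma holder_dist_tendsto_zero:
  fixes z :: "nat \<Rightarrow> real \<Rightarrow> 'a::real_normed_vector"
  assumes T: "0 \<le> T" and e: "0 < e'" "e' < e" and K: "0 \<le> K" "\<And>k. hoelder_on 0 T K e (z k)" "hoelder_on 0 T K e Z"
    and unif: "\<And>r. 0 < r \<Longrightarrow> \<exists>N. \<forall>k\<ge>N. \<forall>t\<in>{0..T}. norm (z k t - Z t) < r"
  shows "(\<lambda>k. holder_dist e' T (z k) Z) \<longlonglongrightarrow> 0"
proof (rule LIMSEQ_I)
  fix r :: real assume "0 < r"
  obtain \<tau> where \<tau>: "0 < \<tau>" "\<And>x. \<lbrakk>0 \<le> x; x \<le> \<tau>\<rbrakk> \<Longrightarrow> (2 * K) * x powr (e - e') \<le> r / 4"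
    by (rule small_powr[of "e - e'" "2 * K" "r / 4"]) (use e K \<open>0 < r\<close> in auto)
  \<comment> \<open>The first entry settles the starting point; the second makes 2 * q at most r/4
    times \<tau>^e', which settles increments longer than \<open>\<tau>\<close>.\<close>
  define q where "q = min (r / 4) (r / 8 * \<tau> powr e')"
  have "0 < q" using \<open>0 < r\<close> \<tau> by (simp add: q_def)
  then obtain N where N: "\<And>k t. \<lbrakk>N \<le> k; 0 \<le> t; t \<le> T\<rbrakk> \<Longrightarrow> norm (z k t - Z t) < q"
    using unif by (meson atLeastAtMost_iff)
  have "holder_dist e' T (z k) Z < r" if k: "N \<le> k" for k
  proof -
    have "holder_dist e' T (z k) Z \<le> r / 4 + r / 4"
    proof (rule holder_dist_le)
      show "norm (z k 0 - Z 0) \<le> r / 4" using N[OF k, of 0] T by (simp add: q_def)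
      fix s t assume st: "0 \<le> s" "s < t" "t \<le> T"
      show "norm ((z k t - Z t) - (z k s - Z s)) \<le> r / 4 * (t - s) powr e'"
      proof (cases "t - s \<le> \<tau>")
        case True
        have "norm ((z k t - Z t) - (z k s - Z s)) \<le> norm (z k t - z k s) + norm (Z t - Z s)"
          using norm_triangle_ineq4[of "z k t - z k s" "Z t - Z s"] by (simp add: algebra_simps)
        also have "\<dots> \<le> K * (t - s) powr e + K * (t - s) powr e"
          using st by (intro add_mono hoelder_onD[OF K(2)] hoelder_onD[OF K(3)]) auto
        also have "\<dots> = ((2 * K) * (t - s) powr (e - e')) * (t - s) powr e'"
          by (simp add: powr_add[symmetric])
        also have "\<dots> \<le> r / 4 * (t - s) powr e'"
          using True st by (intro mult_right_mono \<tau>) auto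
        finally show ?thesis .
      next
        case False
        have "norm ((z k t - Z t) - (z k s - Z s)) \<le> norm (z k t - Z t) + norm (z k s - Z s)"
          by (rule norm_triangle_ineq4)
        also have "\<dots> \<le> q + q"
          using N[OF k] st by (intro add_mono less_imp_le) auto
        also have "\<dots> \<le> r / 4 * \<tau> powr e'" by (simp add: q_def)
        also have "\<dots> \<le> r / 4 * (t - s) powr e'"
          using False \<tau> e \<open>0 < r\<close> by (intro mult_left_mono powr_mono2) auto
        finally show ?thesis .
      qed
    qed (use \<open>0 < r\<close> in auto)
    then show ?thesis using \<open>0 < r\<close> by simp
  qed
  then show "\<exists>N. \<forall>k\<ge>N. norm (holder_dist e' T (z k) Z - 0) < r"
    by (intro exI[of _ N]) (auto simp: holder_dist_nonneg)
qed

context path_dependent_rde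
begin

text \<open>Serves both Euler polygons and solutions along converging drivers. The \<beta>-Hoelder
  bound passes to the limit although convergence holds only below \<beta>; convergence at
  \<open>\<beta>\<^sub>0\<close> is what moves \<open>A\<close> to the limit.\<close>

lemma compactness:
  assumes z: "\<And>k. z k \<in> paths" and K: "0 \<le> K" "\<And>k. hoelder_on 0 T K \<beta> (z k)"
  obtains r Z where "strict_mono (r :: nat \<Rightarrow> nat)" "Z \<in> paths" "hoelder_on 0 T K \<beta> Z"
    "\<And>t. \<lbrakk>0 \<le> t; t \<le> T\<rbrakk> \<Longrightarrow> (\<lambda>k. z (r k) t) \<longlonglongrightarrow> Z t"
    "\<And>t. \<lbrakk>0 \<le> t; t \<le> T\<rbrakk> \<Longrightarrow> (\<lambda>k. A (z (r k)) t) \<longlonglongrightarrow> A Z t"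
    "\<And>e. \<lbrakk>0 < e; e < \<beta>\<rbrakk> \<Longrightarrow> (\<lambda>k. holder_dist e T (z (r k)) Z) \<longlonglongrightarrow> 0"
proof -
  have z0: "z k 0 = \<xi>" for k using z by (simp add: holder_paths_from_def)
  have bounded: "norm (z k t) \<le> norm \<xi> + K * T powr \<beta>" if t: "t \<in> {0..T}" for k t
  proof -
    have "norm (z k t - z k 0) \<le> K * (t - 0) powr \<beta>"
      using t by (intro hoelder_onD[OF K(2)]) auto
    also have "\<dots> \<le> K * T powr \<beta>" using t K \<beta> by (intro mult_left_mono powr_mono2) auto
    finally show ?thesis using norm_triangle_ineq2[of "z k t" \<xi>] by (simp add: z0)
  qed
  have equicontinuous: "\<exists>d>0. \<forall>k y. y \<in> {0..T} \<and> norm (x - y) < d \<longrightarrow> norm (z k x - z k y) < e"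
    if x: "x \<in> {0..T}" and "0 < e" for x e
  proof -
    obtain d where d: "0 < d" "\<And>x. \<lbrakk>0 \<le> x; x \<le> d\<rbrakk> \<Longrightarrow> K * x powr \<beta> \<le> e / 2"
      by (rule small_powr[of \<beta> K "e / 2"]) (use \<beta> K \<open>0 < e\<close> in auto)
    have "norm (z k x - z k y) < e" if y: "y \<in> {0..T}" "norm (x - y) < d" for k y
    proof -
      have "norm (z k x - z k y) \<le> K * \<bar>x - y\<bar> powr \<beta>"
      proof (cases "y \<le> x")
        case True
        then show ?thesis using hoelder_onD[OF K(2), of y x k] x y by simp
      next
        case False
        then show ?thesis using hoelder_onD[OF K(2), of x y k] x y by (simp add: norm_minus_commute)
      qed
      also have "\<dots> \<le> e / 2" using y by (intro d) auto
      finally show ?thesis using \<open>0 < e\<close> by simp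
    qed
    with d show ?thesis by blast
  qed
  obtain g r where r: "strict_mono (r :: nat \<Rightarrow> nat)"
    and unif: "\<And>e. 0 < e \<Longrightarrow> \<exists>N. \<forall>n x. n \<ge> N \<and> x \<in> {0..T} \<longrightarrow> norm (z (r n) x - g x) < e"
    using Arzela_Ascoli[of "{0..T}" z, OF compact_Icc bounded equicontinuous] by metis
  define Z where "Z = restrict g {0..T}"
  have unif': "\<exists>N. \<forall>n\<ge>N. \<forall>t\<in>{0..T}. norm (z (r n) t - Z t) < e" if e: "0 < e" for e
  proof -
    obtain N where "\<forall>n x. n \<ge> N \<and> x \<in> {0..T} \<longrightarrow> norm (z (r n) x - g x) < e"
      using unif[OF e] ..
    then show ?thesis by (intro exI[of _ N]) (auto simp: Z_def)
  qed
  have lim: "(\<lambda>k. z (r k) t) \<longlonglongrightarrow> Z t" if "0 \<le> t" "t \<le> T" for t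
    using unif' that by (intro LIMSEQ_I) (meson atLeastAtMost_iff)
  have Z: "hoelder_on 0 T K \<beta> Z"
    unfolding hoelder_on_def
  proof (intro allI impI)
    fix u v assume uv: "0 \<le> u \<and> u \<le> v \<and> v \<le> T"
    have "(\<lambda>k. norm (z (r k) v - z (r k) u)) \<longlonglongrightarrow> norm (Z v - Z u)"
      using uv by (intro tendsto_intros lim) auto
    then show "norm (Z v - Z u) \<le> K * (v - u) powr \<beta>"
      by (rule LIMSEQ_le_const2) (use uv hoelder_onD[OF K(2)] in auto)
  qed
  have "Z 0 = \<xi>" using lim[of 0] T by (simp add: z0 LIMSEQ_const_iff)
  with Z K have Z': "Z \<in> paths"
    by (auto simp: holder_paths_from_def holder_paths_iff Z_def)
  have dist: "(\<lambda>k. holder_dist e T (z (r k)) Z) \<longlonglongrightarrow> 0" if "0 < e" "e < \<beta>" for e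
    using T that K Z unif' by (intro holder_dist_tendsto_zero[of T e \<beta> K]) auto
  have "(\<lambda>k. A (z (r k)) t) \<longlonglongrightarrow> A Z t" if "0 \<le> t" "t \<le> T" for t
    using dist[OF \<beta>\<^sub>0] that z Z' by (intro A_continuous holder_paths_from_\<beta>\<^sub>0)
  with r Z' Z lim dist show thesis by (intro that)
qed

lemma coeff_tendsto:
  assumes "(\<lambda>k. z k t) \<longlonglongrightarrow> Z t" "(\<lambda>k. A (z k) t) \<longlonglongrightarrow> A Z t"
  shows "(\<lambda>k. coeff (z k) t) \<longlonglongrightarrow> coeff Z t"
  unfolding coeff_def
  by (rule isCont_tendsto_compose[OF has_derivative_continuous[OF has_derivative_\<sigma>] tendsto_Pair[OF assms]])

section \<open>Existence by Euler polygons\<close>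

definition grid :: "nat \<Rightarrow> nat \<Rightarrow> real" where
  "grid N i = real i * T / real N"

text \<open>\<open>A\<close> needs a whole path as argument, so every stage is defined on all of
  [0,T]: beyond \<open>grid N i\<close> the stage \<open>Suc i\<close> keeps the coefficient frozen
  there, and later stages overwrite it. Only the stage \<open>N\<close> is used in the end.\<close>

primrec polygon :: "(real \<Rightarrow> real^'d) \<Rightarrow> nat \<Rightarrow> nat \<Rightarrow> real \<Rightarrow> real^'n" where
  "polygon h N 0 = restrict (\<lambda>_. \<xi>) {0..T}"
| "polygon h N (Suc i) = restrict (\<lambda>t. if t \<le> grid N i then polygon h N i t
     else polygon h N i (grid N i) + blinfun_apply (coeff (polygon h N i) (grid N i)) (h t - h (grid N i))) {0..T}"

context
  fixes h :: "real \<Rightarrow> real^'d" and H :: real and N :: nat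
  assumes h: "hoelder_on 0 T H 1 h" and H: "0 \<le> H" and N: "0 < N"
begin

lemma grid_bounds: "0 \<le> grid N i" "i \<le> N \<Longrightarrow> grid N i \<le> T" "grid N i \<le> grid N (Suc i)"
  "grid N (Suc i) = grid N i + T / real N" "grid N 0 = 0" "grid N N = T"
  using T N by (auto simp: grid_def field_simps)

text \<open>The coefficients are bounded by \<open>B\<close> whatever the past of the path, so the
  constant depends neither on \<open>N\<close> nor on \<open>i\<close>; this uniformity feeds
  \<open>compactness\<close>.\<close>

lemma polygon_lipschitz: "i \<le> N \<Longrightarrow> hoelder_on 0 T (B * H) 1 (polygon h N i)"
proof (induction i)
  case 0
  show ?case using B H by (auto simp: hoelder_on_def)
next
  case (Suc i)
  let ?z = "polygon h N i" and ?g = "grid N i"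
  have g: "0 \<le> ?g" "?g \<le> T" using grid_bounds Suc.prems by auto
  have IH: "norm (?z v - ?z u) \<le> B * H * (v - u)" if "0 \<le> u" "u \<le> v" "v \<le> T" for u v
    using Suc that by (intro lipschitz_onD) auto
  have step: "norm (coeff ?z ?g (h v - h u)) \<le> B * H * (v - u)" if "0 \<le> u" "u \<le> v" "v \<le> T" for u v
    unfolding mult.assoc using that B lipschitz_onD[OF h that]
    by (intro order_trans[OF norm_coeff_apply] mult_left_mono) auto
  show ?case
    unfolding hoelder_on_def
  proof (intro allI impI)
    fix u v assume uv: "0 \<le> u \<and> u \<le> v \<and> v \<le> T"
    consider "v \<le> ?g" | "u \<le> ?g" "?g < v" | "?g < u" using uv by linarith
    then have "norm (polygon h N (Suc i) v - polygon h N (Suc i) u) \<le> B * H * (v - u)"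
    proof cases
      case 1
      then show ?thesis using IH uv by simp
    next
      case 2
      have "norm (?z ?g + coeff ?z ?g (h v - h ?g) - ?z u)
          \<le> norm (?z ?g - ?z u) + norm (coeff ?z ?g (h v - h ?g))"
        using norm_triangle_ineq[of "?z ?g - ?z u" "coeff ?z ?g (h v - h ?g)"]
        by (simp add: algebra_simps)
      also have "\<dots> \<le> B * H * (?g - u) + B * H * (v - ?g)"
        using 2 uv g by (intro add_mono IH step) auto
      finally show ?thesis using 2 uv by (simp add: algebra_simps)
    next
      case 3
      then have "polygon h N (Suc i) v - polygon h N (Suc i) u = coeff ?z ?g (h v - h u)"
        using uv by (simp add: blinfun.diff_right)
      then show ?thesis using step[of u v] uv by simp
    qed
    then show "norm (polygon h N (Suc i) v - polygon h N (Suc i) u) \<le> B * H * (v - u) powr 1"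
      using uv by (simp add: powr_one_gt_zero_iff)
  qed
qed

lemma polygon_path:
  assumes "i \<le> N"
  shows "hoelder_on 0 T (B * H * T powr (1 - \<beta>)) \<beta> (polygon h N i)"
    and "polygon h N i \<in> paths"
proof -
  show 1: "hoelder_on 0 T (B * H * T powr (1 - \<beta>)) \<beta> (polygon h N i)"
    using hoelder_on_weaken[OF polygon_lipschitz[OF assms], of \<beta>] \<beta> B H by auto
  have "polygon h N j 0 = \<xi>" for j
    using T grid_bounds(1) by (induction j) auto
  moreover have "polygon h N i \<in> extensional {0..T}" by (cases i) auto
  ultimately show "polygon h N i \<in> paths"
    using 1 B H unfolding holder_paths_from_def holder_paths_iff
    by (auto intro!: exI[of _ "B * H * T powr (1 - \<beta>)"])
qed

lemma polygon_stable: "\<lbrakk>i \<le> j; 0 \<le> t; t \<le> grid N i; t \<le> T\<rbrakk> \<Longrightarrow> polygon h N j t = polygon h N i t"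
proof (induction j rule: dec_induct)
  case (step j)
  have "grid N i \<le> grid N j" using step T N by (simp add: grid_def divide_right_mono mult_right_mono)
  then show ?case using step by simp
qed simp

text \<open>The coefficient was computed from stage \<open>i\<close>. Later stages agree with it up
  to \<open>grid N i\<close>, so adaptedness of \<open>A\<close> turns it into the coefficient of
  the final polygon.\<close>

lemma polygon_step:
  assumes i: "i < N" and t: "grid N i \<le> t" "t \<le> grid N (Suc i)"
  shows "polygon h N N t = polygon h N N (grid N i)
    + blinfun_apply (coeff (polygon h N N) (grid N i)) (h t - h (grid N i))"
proof -
  let ?g = "grid N i"
  have g: "0 \<le> ?g" "?g \<le> T" "t \<le> T" "0 \<le> t"
    using grid_bounds(1)[of i] grid_bounds(2)[of i] grid_bounds(2)[of "Suc i"] i t by linarith+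
  have eq: "polygon h N N u = polygon h N i u" if "u \<in> {0..?g}" for u
    using that g i by (intro polygon_stable) auto
  then have "A (polygon h N N) ?g = A (polygon h N i) ?g"
    using A_adapted[OF g(1,2), of "polygon h N N" "polygon h N i"] polygon_path(2) i g by auto
  then have c: "coeff (polygon h N N) ?g = coeff (polygon h N i) ?g"
    using eq g by (simp add: coeff_def)
  have "polygon h N N t = polygon h N (Suc i) t"
    using g i t by (intro polygon_stable) auto
  then show ?thesis
    using eq[of ?g] g t by (auto simp: c)
qed

text \<open>In the application \<open>v\<close> is the coefficient at s. Cells are added one at a
  time; closeness to \<open>v\<close> is asked of every cell meeting [s,t], including one whose left
  end precedes s.\<close>

lemma polygon_frozen_coefficient:
  assumes st: "0 \<le> s" "s \<le> t" "t \<le> T" and \<epsilon>: "0 \<le> \<epsilon>"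
    and near: "\<And>i. \<lbrakk>i < N; grid N i \<le> t; s \<le> grid N (Suc i)\<rbrakk> \<Longrightarrow> norm (coeff (polygon h N N) (grid N i) - v) \<le> \<epsilon>"
  shows "norm (polygon h N N t - polygon h N N s - blinfun_apply v (h t - h s)) \<le> \<epsilon> * H * (t - s)"
proof -
  let ?z = "polygon h N N"
  have cell: "norm (?z y - ?z x - blinfun_apply v (h y - h x)) \<le> \<epsilon> * H * (y - x)"
    if i: "i < N" and xy: "grid N i \<le> x" "x \<le> y" "y \<le> grid N (Suc i)" and "s \<le> x" "y \<le> t" for i x y
  proof -
    have "?z y - ?z x = coeff ?z (grid N i) (h y - h x)"
      using polygon_step[OF i, of x] polygon_step[OF i, of y] xy by (simp add: blinfun.diff_right)
    then have "?z y - ?z x - blinfun_apply v (h y - h x) = blinfun_apply (coeff ?z (grid N i) - v) (h y - h x)"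
      by (simp add: blinfun.diff_left)
    also have "norm \<dots> \<le> \<epsilon> * (H * (y - x))"
      using near[OF i] that st \<epsilon> lipschitz_onD[OF h, of x y]
      by (intro order_trans[OF norm_blinfun] mult_mono) auto
    finally show ?thesis by simp
  qed
  have "norm (?z y - ?z s - blinfun_apply v (h y - h s)) \<le> \<epsilon> * H * (y - s)"
    if "m \<le> N" "s \<le> y" "y \<le> t" "y \<le> grid N m" for m y
    using that
  proof (induction m arbitrary: y)
    case 0
    then have "y = s" using st grid_bounds(5) by linarith
    then show ?case by simp
  next
    case (Suc m)
    let ?g = "grid N m"
    consider "y \<le> ?g" | "?g \<le> s" | "s \<le> ?g" "?g \<le> y" by linarith
    then show ?case
    proof cases
      case 1
      then show ?thesis using Suc by simp
    next
      case 2
      then show ?thesis using Suc.prems by (intro cell[of m]) auto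
    next
      case 3
      have "norm (?z y - ?z s - blinfun_apply v (h y - h s)) \<le>
          norm (?z y - ?z ?g - blinfun_apply v (h y - h ?g)) + norm (?z ?g - ?z s - blinfun_apply v (h ?g - h s))"
        using norm_triangle_ineq[of "?z y - ?z ?g - blinfun_apply v (h y - h ?g)" "?z ?g - ?z s - blinfun_apply v (h ?g - h s)"]
        by (simp add: blinfun.diff_right algebra_simps)
      also have "\<dots> \<le> \<epsilon> * H * (y - ?g) + \<epsilon> * H * (?g - s)"
        using 3 Suc.prems by (intro add_mono cell[of m] Suc.IH) auto
      finally show ?thesis by (simp add: algebra_simps)
    qed
  qed
  from this[of N t] show ?thesis using st grid_bounds(6) by simp
qed

end

text \<open>On the cells meeting [s,t] the coefficient differs from that at s by at most
  \<open>K\<close> times the \<beta>-power of t - s plus one mesh width. As the mesh vanishes along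
  a convergent subsequence, the factor (t - s)^\<beta> remains and, with the Lipschitz driver, gives
  the exponent 1 + \<beta>.\<close>

theorem euler_solution_exists:
  assumes "h \<in> holder_paths 1 T"
  shows "\<exists>Z. euler_solution h Z"
proof -
  obtain H where "1 \<le> H" and h: "hoelder_on 0 T H 1 h" using holder_paths_1E[OF assms] .
  then have H: "0 \<le> H" by simp
  define L where "L = B * H * T powr (1 - \<beta>)"
  define K where "K = B * (L + F (L * T powr \<beta>) * L)"
  have L: "0 \<le> L" using B H by (simp add: L_def)
  have K: "0 \<le> K" using B L F_pos[of "L * T powr \<beta>"] by (simp add: K_def)
  define z where "z k = polygon h (Suc k) (Suc k)" for k
  have z: "z k \<in> paths" "hoelder_on 0 T L \<beta> (z k)" for k
    using polygon_path[OF h H, of "Suc k" "Suc k"] by (auto simp: z_def L_def)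
  obtain r Z where r: "strict_mono (r :: nat \<Rightarrow> nat)" and Z: "Z \<in> paths"
    and lim: "\<And>t. \<lbrakk>0 \<le> t; t \<le> T\<rbrakk> \<Longrightarrow> (\<lambda>k. z (r k) t) \<longlonglongrightarrow> Z t"
      "\<And>t. \<lbrakk>0 \<le> t; t \<le> T\<rbrakk> \<Longrightarrow> (\<lambda>k. A (z (r k)) t) \<longlonglongrightarrow> A Z t"
    by (rule compactness[of z L, OF z(1) L z(2)]) (rule that)
  have "norm (remainder h Z s t) \<le> K * H * (t - s) powr (1 + \<beta>)"
    if st: "0 \<le> s" "s \<le> t" "t \<le> T" for s t
  proof -
    have approx: "norm (z k t - z k s - coeff (z k) s (h t - h s))
        \<le> K * (t - s + T / real (Suc k)) powr \<beta> * H * (t - s)" for k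
      unfolding z_def
    proof (rule polygon_frozen_coefficient[OF h H _ st])
      fix i assume i: "i < Suc k" "grid (Suc k) i \<le> t" "s \<le> grid (Suc k) (Suc i)"
      let ?g = "grid (Suc k) i"
      have w: "0 \<le> T / real (Suc k)" using T by (intro divide_nonneg_nonneg) auto
      have g: "0 \<le> ?g" "?g \<le> T" using grid_bounds(1)[OF h H zero_less_Suc, of k i] i st by auto
      \<comment> \<open>The left end of the first cell may lie before s, but by no more than one
        mesh width.\<close>
      have g': "\<bar>?g - s\<bar> \<le> t - s + T / real (Suc k)"
        using grid_bounds(4)[OF h H zero_less_Suc, of k i] w i st by linarith
      have "norm (coeff (z k) ?g - coeff (z k) s) \<le> K * \<bar>?g - s\<bar> powr \<beta>"
      proof (cases "s \<le> ?g")
        case True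
        then show ?thesis using coeff_hoelder[OF z(1) L z(2), of s ?g] g st by (simp add: K_def)
      next
        case False
        then show ?thesis using coeff_hoelder[OF z(1) L z(2), of ?g s] g st
          by (simp add: K_def norm_minus_commute)
      qed
      also have "\<dots> \<le> K * (t - s + T / real (Suc k)) powr \<beta>"
        using g' K \<beta> by (intro mult_left_mono powr_mono2) auto
      finally show "norm (coeff (polygon h (Suc k) (Suc k)) ?g - coeff (polygon h (Suc k) (Suc k)) s)
          \<le> K * (t - s + T / real (Suc k)) powr \<beta>"
        by (simp add: z_def)
    qed (use K in auto)
    have "(\<lambda>k. norm (z (r k) t - z (r k) s - coeff (z (r k)) s (h t - h s)))
        \<longlonglongrightarrow> norm (remainder h Z s t)"
      using st by (intro tendsto_intros lim blinfun.tendsto coeff_tendsto) auto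
    moreover have "(\<lambda>k. T / real (Suc k)) \<longlonglongrightarrow> 0"
      using tendsto_mult_right_zero[OF LIMSEQ_inverse_real_of_nat, of T] by (simp add: divide_inverse)
    then have "(\<lambda>k. T / real (Suc (r k))) \<longlonglongrightarrow> 0"
      using LIMSEQ_subseq_LIMSEQ[OF _ r] by (fastforce simp: o_def)
    then have "(\<lambda>k. K * (t - s + T / real (Suc (r k))) powr \<beta> * H * (t - s)) \<longlonglongrightarrow> K * (t - s + 0) powr \<beta> * H * (t - s)"
      using \<beta> T st by (intro tendsto_intros tendsto_powr') (auto intro!: always_eventually)
    ultimately have "norm (remainder h Z s t) \<le> K * (t - s + 0) powr \<beta> * H * (t - s)"
      by (rule LIMSEQ_le) (use approx in auto)
    also have "\<dots> = K * H * (t - s) powr (1 + \<beta>)"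
      using st by (simp add: powr_add powr_one_gt_zero_iff mult_ac)
    finally show ?thesis .
  qed
  then have "euler_bound h Z (K * H) (1 + \<beta>)" by (simp add: euler_bound_def)
  then show ?thesis
    using assms Z K H unfolding euler_solution_def by (metis mult_nonneg_nonneg)
qed

end

section \<open>Limits of solutions along converging drivers\<close>

lemma hoelder_on_diff:
  assumes "hoelder_on a b C e x" "hoelder_on a b C' e y"
  shows "hoelder_on a b (C + C') e (\<lambda>t. x t - y t)"
  unfolding hoelder_on_def
proof (intro allI impI)
  fix u v assume "a \<le> u \<and> u \<le> v \<and> v \<le> b"
  then have "norm (x v - x u) \<le> C * (v - u) powr e" "norm (y v - y u) \<le> C' * (v - u) powr e"
    using assms by (auto dest: hoelder_onD)
  then show "norm (x v - y v - (x u - y u)) \<le> (C + C') * (v - u) powr e"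
    using norm_triangle_ineq4[of "x v - x u" "y v - y u"] by (simp add: algebra_simps)
qed

text \<open>The square root in \<open>rough_dist\<close> is the reason why a distance \<eta>
  controls the second level by the square of \<eta>.\<close>

lemma rough_dist_bounds:
  assumes X: "(X, XX) \<in> rough_paths \<beta> T" and Y: "(Y, YY) \<in> rough_paths \<beta> T"
    and d: "rough_dist \<beta> T (X, XX) (Y, YY) \<le> \<eta>" and st: "0 \<le> s" "s < t" "t \<le> T"
  shows "norm (X (s, t) - Y (s, t)) \<le> \<eta> * (t - s) powr \<beta>"
    and "norm (XX (s, t) - YY (s, t)) \<le> \<eta>\<^sup>2 * (t - s) powr (2 * \<beta>)"
proof -
  let ?a = "enn2real (holder2_norm \<beta> T (\<lambda>p. X p - Y p))"
  let ?b = "enn2real (holder2_norm (2 * \<beta>) T (\<lambda>p. XX p - YY p))"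
  have fin: "holder2_norm \<beta> T (\<lambda>p. X p - Y p) < \<infinity>" "holder2_norm (2 * \<beta>) T (\<lambda>p. XX p - YY p) < \<infinity>"
    using X Y holder2_norm_diff_finite[of \<beta> T X Y] holder2_norm_diff_finite[of "2 * \<beta>" T XX YY]
    by (simp_all add: rough_paths_def)
  have sum: "?a + sqrt ?b \<le> \<eta>" using d by (simp add: rough_dist_def)
  then have a: "?a \<le> \<eta>" by (smt (verit) enn2real_nonneg real_sqrt_ge_zero)
  have "sqrt ?b \<le> \<eta>" using sum by (smt (verit) enn2real_nonneg)
  then have b: "?b \<le> \<eta>\<^sup>2"
    by (metis enn2real_nonneg real_sqrt_ge_zero real_sqrt_pow2 power_mono)
  show "norm (X (s, t) - Y (s, t)) \<le> \<eta> * (t - s) powr \<beta>"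
    using norm_le_holder2_norm[OF fin(1) a st] .
  show "norm (XX (s, t) - YY (s, t)) \<le> \<eta>\<^sup>2 * (t - s) powr (2 * \<beta>)"
    using norm_le_holder2_norm[OF fin(2) b st] .
qed

context path_dependent_rde
begin

lemma smooth_rough_path_\<beta>: "h \<in> holder_paths 1 T \<Longrightarrow> smooth_rough_path T h \<in> rough_paths \<beta> T"
  using smooth_rough_path_in_rough_paths[of h T \<beta>] \<beta> by auto

lemma smooth_rough_path_apply:
  assumes "0 \<le> s" "s \<le> t" "t \<le> T"
  shows "fst (smooth_rough_path T h) (s, t) = h t - h s" "snd (smooth_rough_path T h) (s, t) = area h s t"
  using assms by (simp_all add: smooth_rough_path_def area_def simplex2_def)

abbreviation driver_dist :: "(real \<Rightarrow> real^'d) \<Rightarrow> (real \<Rightarrow> real^'d) \<Rightarrow> real" where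
  "driver_dist g h \<equiv> rough_dist \<beta> T (smooth_rough_path T g) (smooth_rough_path T h)"

lemma area_diag:
  assumes "h \<in> holder_paths 1 T" "0 \<le> s" "s \<le> T"
  shows "area h s s = 0"
  using rough_paths_diag(2)[of "fst (smooth_rough_path T h)" "snd (smooth_rough_path T h)" \<beta> T s]
    smooth_rough_path_\<beta>[OF assms(1)] assms by (simp add: smooth_rough_path_apply)

lemma smooth_rough_dist_bounds:
  assumes h: "h \<in> holder_paths 1 T" "h' \<in> holder_paths 1 T"
    and d: "driver_dist h' h \<le> \<eta>"
    and st: "0 \<le> s" "s \<le> t" "t \<le> T"
  shows "norm ((h' t - h' s) - (h t - h s)) \<le> \<eta> * (t - s) powr \<beta>"
    and "norm (area h' s t - area h s t) \<le> \<eta>\<^sup>2 * (t - s) powr (2 * \<beta>)"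
proof -
  have "norm ((h' t - h' s) - (h t - h s)) \<le> \<eta> * (t - s) powr \<beta>
      \<and> norm (area h' s t - area h s t) \<le> \<eta>\<^sup>2 * (t - s) powr (2 * \<beta>)"
  proof (cases "s = t")
    case True
    then show ?thesis using area_diag h st by simp
  next
    case False
    then show ?thesis
      using rough_dist_bounds[of "fst (smooth_rough_path T h')" "snd (smooth_rough_path T h')" \<beta> T
          "fst (smooth_rough_path T h)" "snd (smooth_rough_path T h)" \<eta> s t]
        smooth_rough_path_\<beta>[OF h(1)] smooth_rough_path_\<beta>[OF h(2)] d st
      by (simp add: smooth_rough_path_apply)
  qed
  then show "norm ((h' t - h' s) - (h t - h s)) \<le> \<eta> * (t - s) powr \<beta>"
    and "norm (area h' s t - area h s t) \<le> \<eta>\<^sup>2 * (t - s) powr (2 * \<beta>)" by auto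
qed

lemma rough_bound_exists:
  assumes h: "h \<in> holder_paths 1 T"
  shows "\<exists>M. rough_bound h M"
proof -
  have "holder2_norm \<beta> T (fst (smooth_rough_path T h)) < \<infinity>" "holder2_norm (2 * \<beta>) T (snd (smooth_rough_path T h)) < \<infinity>"
    using smooth_rough_path_\<beta>[OF h] by (auto simp: rough_paths_def case_prod_beta)
  then obtain C C' where C: "0 \<le> C" "\<And>s t. \<lbrakk>0 \<le> s; s < t; t \<le> T\<rbrakk> \<Longrightarrow> norm (h t - h s) \<le> C * (t - s) powr \<beta>"
    and C': "0 \<le> C'" "\<And>s t. \<lbrakk>0 \<le> s; s < t; t \<le> T\<rbrakk> \<Longrightarrow> norm (area h s t) \<le> C' * (t - s) powr (2 * \<beta>)"
    unfolding holder2_norm_finite_iff by (auto simp: smooth_rough_path_apply)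
  have "norm (h t - h s) \<le> (C + C') * (t - s) powr \<beta> \<and> norm (area h s t) \<le> (C + C') * (t - s) powr (2 * \<beta>)"
    if st: "0 \<le> s" "s \<le> t" "t \<le> T" for s t
  proof (cases "s = t")
    case True
    then show ?thesis using area_diag[OF h] st by simp
  next
    case False
    then have "norm (h t - h s) \<le> C * (t - s) powr \<beta>" "norm (area h s t) \<le> C' * (t - s) powr (2 * \<beta>)"
      using C C' st by auto
    then show ?thesis
      using C(1) C'(1) by (auto simp: distrib_right intro: add_increasing add_increasing2)
  qed
  then have "rough_bound h (C + C')" unfolding rough_bound_def using C C' by auto
  then show ?thesis ..
qed

lemma rough_bound_near:
  assumes h: "h \<in> holder_paths 1 T" "h' \<in> holder_paths 1 T" and M: "rough_bound h M"
    and d: "driver_dist h' h \<le> 1"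
  shows "rough_bound h' (M + 1)"
proof -
  have "norm (h' t - h' s) \<le> (M + 1) * (t - s) powr \<beta> \<and> norm (area h' s t) \<le> (M + 1) * (t - s) powr (2 * \<beta>)"
    if st: "0 \<le> s" "s \<le> t" "t \<le> T" for s t
  proof -
    have "norm (h t - h s) \<le> M * (t - s) powr \<beta>" "norm (area h s t) \<le> M * (t - s) powr (2 * \<beta>)"
      using M st by (auto simp: rough_bound_def)
    then show ?thesis
      using smooth_rough_dist_bounds[OF h d st] norm_triangle_ineq2[of "h' t - h' s" "h t - h s"]
        norm_triangle_ineq2[of "area h' s t" "area h s t"] by (simp add: distrib_right)
  qed
  then show ?thesis using M by (auto simp: rough_bound_def)
qed

text \<open>The constants in the a priori bound depend on the driver only through its rough norms, whereas
  the estimate \<open>cross Z h s t = O((t - s) powr (1 + \<beta>))\<close> uses that the limiting driver \<open>h\<close> is Lipschitz.\<close>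

theorem solution_limit:
  assumes h: "h \<in> holder_paths 1 T"
    and d: "(\<lambda>k. driver_dist (g k) h) \<longlonglongrightarrow> 0"
      "\<And>k. driver_dist (g k) h \<le> 1"
    and sol: "\<And>k. euler_solution (g k) (z k)"
  obtains r Z C where "strict_mono (r :: nat \<Rightarrow> nat)" "Z \<in> paths" "0 \<le> C"
    "euler_bound h Z C \<theta>"
    "\<And>e. \<lbrakk>0 < e; e < \<beta>\<rbrakk> \<Longrightarrow> (\<lambda>k. holder_dist e T (z (r k)) Z) \<longlonglongrightarrow> 0"
proof -
  have g: "g k \<in> holder_paths 1 T" and z: "z k \<in> paths" for k
    using sol[of k] by (auto simp: euler_solution_def)
  obtain M where M: "rough_bound h M" using rough_bound_exists[OF h] ..
  then have M0: "0 \<le> M + 1" by (simp add: rough_bound_def)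
  have gM: "rough_bound (g k) (M + 1)" for k by (rule rough_bound_near[OF h g M d(2)])
  obtain H where H: "1 \<le> H" "hoelder_on 0 T H 1 h" using holder_paths_1E[OF h] .
  then have H0: "0 \<le> H" by simp
  obtain \<delta> K G where c: "0 < \<delta>" "0 \<le> K" "0 \<le> G"
    and hoelder: "\<And>h Z. \<lbrakk>euler_solution h Z; rough_bound h (M + 1)\<rbrakk> \<Longrightarrow> hoelder_on 0 T K \<beta> Z"
    and sewing: "\<And>h Z s t. \<lbrakk>euler_solution h Z; rough_bound h (M + 1); 0 \<le> s; s \<le> t; t \<le> T; t - s \<le> \<delta>\<rbrakk> \<Longrightarrow>
        norm (Z t - Z s - germ h Z s t) \<le> G * (t - s) powr \<theta>"
    by (rule a_priori_bound[OF M0]) (rule that)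
  note zK = hoelder[OF sol gM] and zG = sewing[OF sol gM]
  obtain r Z where r: "strict_mono (r :: nat \<Rightarrow> nat)" and Z: "Z \<in> paths" "hoelder_on 0 T K \<beta> Z"
    and lim: "\<And>t. \<lbrakk>0 \<le> t; t \<le> T\<rbrakk> \<Longrightarrow> (\<lambda>k. z (r k) t) \<longlonglongrightarrow> Z t"
      "\<And>t. \<lbrakk>0 \<le> t; t \<le> T\<rbrakk> \<Longrightarrow> (\<lambda>k. A (z (r k)) t) \<longlonglongrightarrow> A Z t"
    and dist: "\<And>e. \<lbrakk>0 < e; e < \<beta>\<rbrakk> \<Longrightarrow> (\<lambda>k. holder_dist e T (z (r k)) Z) \<longlonglongrightarrow> 0"
    by (rule compactness[of z K, OF z c(2) zK]) (rule that)
  define \<eta> where "\<eta> k = driver_dist (g k) h" for k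
  have \<eta>0: "(\<lambda>k. \<eta> (r k)) \<longlonglongrightarrow> 0"
    using LIMSEQ_subseq_LIMSEQ[OF d(1) r] by (simp add: \<eta>_def o_def)
  have near: "norm ((g k t - g k s) - (h t - h s)) \<le> \<eta> k * (t - s) powr \<beta>"
    "norm (area (g k) s t - area h s t) \<le> (\<eta> k)\<^sup>2 * (t - s) powr (2 * \<beta>)"
    if "0 \<le> s" "s \<le> t" "t \<le> T" for k s t
    using smooth_rough_dist_bounds[OF h g order_refl that, of k] by (auto simp: \<eta>_def)
  define N where "N = K * T powr \<beta>"
  define C1 where "C1 = F N * K"
  have C1: "0 \<le> C1" using F_pos[of N] c by (simp add: C1_def N_def)
  define Q where "Q = G + c_tensor * (B * B) * (H * H * T powr (2 - \<theta>)) + c_tensor * B * (C1 * H * T powr (1 + \<beta> - \<theta>))"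
  have Q: "0 \<le> Q" using c B C1 H0 c_tensor_nonneg by (simp add: Q_def)
  \<comment> \<open>Both bounds rest on \<beta>(1 + \<alpha>) being at most 1; they allow the orders
    1 + \<beta> and 2 to be weakened to \<theta>.\<close>
  have \<theta>_le: "\<theta> \<le> 1 + \<beta>" "\<theta> \<le> 2"
  proof -
    have "\<beta> * (1 + \<alpha>) \<le> 1/2 * 2" using \<alpha> \<beta> by (intro mult_mono) auto
    then show "\<theta> \<le> 1 + \<beta>" "\<theta> \<le> 2" using \<beta> by (auto simp: algebra_simps)
  qed
  have local: "norm (remainder h Z s t) \<le> Q * (t - s) powr \<theta>"
    if st: "0 \<le> s" "s \<le> t" "t \<le> T" "t - s \<le> \<delta>" for s t
  proof -
    have glim: "(\<lambda>k. g (r k) t - g (r k) s) \<longlonglongrightarrow> h t - h s"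
    proof (rule Lim_transform2[OF tendsto_const Lim_null_comparison])
      show "\<forall>\<^sub>F k in sequentially. norm (h t - h s - (g (r k) t - g (r k) s)) \<le> \<eta> (r k) * (t - s) powr \<beta>"
        using near(1)[OF st(1-3)] by (simp add: norm_minus_commute)
      show "(\<lambda>k. \<eta> (r k) * (t - s) powr \<beta>) \<longlonglongrightarrow> 0"
        using tendsto_mult_left_zero[OF \<eta>0] .
    qed
    \<comment> \<open>The right-hand side as a function of the driver distance, so that the limit is
      simply its value at 0.\<close>
    define bd where "bd x = G * (t - s) powr \<theta>
          + (c_tensor * (B * B) * (norm (area h s t) + x\<^sup>2 * (t - s) powr (2 * \<beta>))
          + c_tensor * B * (C1 * H * (t - s) powr (1 + \<beta>) + F N * (K * (t - s) powr \<beta>) * (x * T powr \<beta>)))" for x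
    have bound: "norm (remainder (g k) (z k) s t) \<le> bd (\<eta> k)" for k
    proof -
      obtain H' where H': "1 \<le> H'" "hoelder_on 0 T H' 1 (g k)" using holder_paths_1E[OF g] .
      have KN: "K * (t - s) powr \<beta> \<le> N"
        unfolding N_def using st c \<beta> by (intro mult_left_mono powr_mono2) auto
      have KNT: "K * (T - 0) powr \<beta> \<le> N" by (simp add: N_def)
      have \<Psi>: "hoelder_on 0 T C1 \<beta> (A (z k))"
        unfolding C1_def by (rule A_hoelder[OF z _ _ zK c(2) KNT]) auto
      interpret p: stieltjes s t \<beta> C1 H' "A (z k)" "g k" "\<lambda>(u, v). g k v - g k u"
        by unfold_locales (use \<Psi> H' \<beta> C1 st in \<open>auto intro: hoelder_on_subset\<close>)
      interpret q: stieltjes s t \<beta> C1 H "A (z k)" h "\<lambda>(u, v). h v - h u"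
        by unfold_locales (use \<Psi> H \<beta> C1 st in \<open>auto intro: hoelder_on_subset\<close>)
      \<comment> \<open>The driver is split into \<open>h\<close> and the difference. Against
        \<open>h\<close> its Lipschitz constant gives order 1 + \<beta>; against the difference only
        the oscillation enters, which tends to 0 with \<open>\<eta> k\<close>. The Lipschitz
        constant \<open>H'\<close> of \<open>g k\<close> drops out.\<close>
      have "cross (z k) (g k) s t - cross (z k) h s t = cross (z k) (\<lambda>u. g k u - h u) s t"
        unfolding cross_def stieltjes_integral_diff[OF p.stieltjes_axioms q.stieltjes_axioms st(2)]
        by (rule tensor_integral_cong) simp
      moreover have "norm (cross (z k) h s t) \<le> C1 * H * (t - s) powr (1 + \<beta>)"
        using q.norm_integral_le[OF st(2)] by (simp add: cross_def)
      moreover have "norm (cross (z k) (\<lambda>u. g k u - h u) s t) \<le> F N * (K * (t - s) powr \<beta>) * (\<eta> k * T powr \<beta>)"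
      proof (rule norm_cross_le[OF z hoelder_on_diff[OF H'(2) H(2)] _ st(1-3) _ c(2) KN])
        show "hoelder_on s t K \<beta> (z k)" using zK st by (auto intro: hoelder_on_subset)
        fix u assume u: "s \<le> u" "u \<le> t"
        have "norm (g k t - h t - (g k u - h u)) \<le> \<eta> k * (t - u) powr \<beta>"
          using near(1)[of u t k] u st by (simp add: algebra_simps)
        also have "\<dots> \<le> \<eta> k * T powr \<beta>"
          using u st \<beta> Metric_space.nonneg[OF Metric_space_rough, of \<beta> T "smooth_rough_path T (g k)" "smooth_rough_path T h"]
          by (intro mult_left_mono powr_mono2) (auto simp: \<eta>_def)
        finally show "norm (g k t - h t - (g k u - h u)) \<le> \<eta> k * T powr \<beta>" .
      qed (use H H' in auto)
      ultimately have cross: "norm (cross (z k) (g k) s t)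
          \<le> C1 * H * (t - s) powr (1 + \<beta>) + F N * (K * (t - s) powr \<beta>) * (\<eta> k * T powr \<beta>)"
        using norm_triangle_sub[of "cross (z k) (g k) s t" "cross (z k) h s t"] by simp
      have area: "norm (area (g k) s t) \<le> norm (area h s t) + (\<eta> k)\<^sup>2 * (t - s) powr (2 * \<beta>)"
        using near(2)[OF st(1-3), of k] norm_triangle_ineq2[of "area (g k) s t" "area h s t"] by simp
      have "norm (remainder (g k) (z k) s t)
          \<le> G * (t - s) powr \<theta> + (c_tensor * (B * B) * norm (area (g k) s t) + c_tensor * B * norm (cross (z k) (g k) s t))"
        by (intro order_trans[OF norm_remainder_le] add_right_mono zG st)
      also have "\<dots> \<le> bd (\<eta> k)"
        using B c_tensor_nonneg unfolding bd_def by (intro add_mono mult_left_mono area cross order_refl) auto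
      finally show ?thesis .
    qed
    have "(\<lambda>k. norm (remainder (g (r k)) (z (r k)) s t)) \<longlonglongrightarrow> norm (remainder h Z s t)"
      using st by (intro tendsto_norm tendsto_diff[OF tendsto_diff] lim blinfun.tendsto coeff_tendsto glim) auto
    moreover have "(\<lambda>k. bd (\<eta> (r k))) \<longlonglongrightarrow> bd 0"
      unfolding bd_def by (intro tendsto_add tendsto_mult tendsto_const tendsto_power \<eta>0)
    ultimately have "norm (remainder h Z s t) \<le> bd 0"
      by (rule LIMSEQ_le) (use bound in auto)
    also have "\<dots> = G * (t - s) powr \<theta> + (c_tensor * (B * B) * norm (area h s t) + c_tensor * B * (C1 * H * (t - s) powr (1 + \<beta>)))"
      by (simp add: bd_def)
    also have "\<dots> \<le> G * (t - s) powr \<theta> + (c_tensor * (B * B) * (H * H * (T powr (2 - \<theta>) * (t - s) powr \<theta>))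
        + c_tensor * B * (C1 * H * (T powr (1 + \<beta> - \<theta>) * (t - s) powr \<theta>)))"
    proof (intro add_mono mult_left_mono order_refl)
      interpret hh: stieltjes s t 1 H H h h "\<lambda>(u, v). h v - h u"
        using H H0 st by (intro stieltjes_smooth)
      have "norm (area h s t) \<le> H * H * (t - s) powr 2"
        using hh.norm_integral_le st by (simp add: area_def)
      also have "\<dots> \<le> H * H * (T powr (2 - \<theta>) * (t - s) powr \<theta>)"
        using st H0 \<theta>_le by (intro mult_left_mono powr_le_powr_interval) auto
      finally show "norm (area h s t) \<le> H * H * (T powr (2 - \<theta>) * (t - s) powr \<theta>)" .
      show "(t - s) powr (1 + \<beta>) \<le> T powr (1 + \<beta> - \<theta>) * (t - s) powr \<theta>"
        using st \<theta>_le by (intro powr_le_powr_interval) auto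
    qed (use B c c_tensor_nonneg C1 H0 in auto)
    also have "\<dots> = Q * (t - s) powr \<theta>" by (simp add: Q_def algebra_simps)
    finally show ?thesis .
  qed
  \<comment> \<open>A crude bound for the remainder on any interval; for t - s above \<delta>,
    division by \<delta>^\<theta> gives it the required form.\<close>
  define P where "P = K * T powr \<beta> + B * (H * T)"
  have P: "0 \<le> P" using c B H0 T by (simp add: P_def)
  have "norm (remainder h Z s t) \<le> (Q + P / \<delta> powr \<theta>) * (t - s) powr \<theta>"
    if st: "0 \<le> s" "s \<le> t" "t \<le> T" for s t
  proof (cases "t - s \<le> \<delta>")
    case True
    have "Q * (t - s) powr \<theta> \<le> (Q + P / \<delta> powr \<theta>) * (t - s) powr \<theta>"
      using P by (intro mult_right_mono) auto
    then show ?thesis using local[OF st True] by simp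
  next
    case False
    have "norm (Z t - Z s) \<le> K * (t - s) powr \<beta>" by (rule hoelder_onD[OF Z(2) st])
    also have "\<dots> \<le> K * T powr \<beta>" using st c \<beta> by (intro mult_left_mono powr_mono2) auto
    finally have "norm (Z t - Z s) \<le> K * T powr \<beta>" .
    moreover have "norm (coeff Z s (h t - h s)) \<le> B * (H * T)"
    proof -
      have "norm (h t - h s) \<le> H * (t - s)" by (rule lipschitz_onD[OF H(2) st])
      also have "\<dots> \<le> H * T" using st H0 by (intro mult_left_mono) auto
      finally show ?thesis
        using B by (intro order_trans[OF norm_coeff_apply] mult_left_mono) auto
    qed
    ultimately have "norm (remainder h Z s t) \<le> P"
      using norm_triangle_ineq4[of "Z t - Z s" "coeff Z s (h t - h s)"] by (simp add: P_def)
    also have "\<dots> = P / \<delta> powr \<theta> * \<delta> powr \<theta>" using c by simp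
    also have "\<dots> \<le> P / \<delta> powr \<theta> * (t - s) powr \<theta>"
      using False c P \<alpha>(3) by (intro mult_left_mono powr_mono2) auto
    also have "\<dots> \<le> (Q + P / \<delta> powr \<theta>) * (t - s) powr \<theta>"
      using Q by (intro mult_right_mono) auto
    finally show ?thesis .
  qed
  then have "euler_bound h Z (Q + P / \<delta> powr \<theta>) \<theta>" by (simp add: euler_bound_def)
  moreover have "0 \<le> Q + P / \<delta> powr \<theta>" using Q P by simp
  ultimately show thesis using r Z dist by (intro that)
qed

end

section \<open>Stability of the solution map at smooth drivers\<close>

context path_dependent_rde
begin

abbreviation Z where "Z \<equiv> rde_path \<beta> T \<sigma> A \<xi>"

lemma rde_path_eq:
  assumes "h \<in> holder_paths 1 T" "rde_solution \<beta> T \<sigma> A \<xi> (smooth_rough_path T h) p"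
  shows "Z h = fst p"
  unfolding rde_path_def using the1_equality'[OF unique[OF assms(1)] assms(2)] by simp

lemma rde_path_eq_euler:
  assumes "h \<in> holder_paths 1 T" "z \<in> paths" "1 < e" "0 \<le> C" "euler_bound h z C e"
  shows "Z h = z"
  using rde_path_eq[OF assms(1) rde_solution_if_euler_bound[OF assms(2,1,3-)]] by simp

text \<open>The existing Euler solution solves the equation, so by uniqueness it is the path that
  \<open>rde_path\<close> selects. In this way the selected solution gets the Euler bound without an
  analysis of arbitrary solutions.\<close>

lemma euler_solution_rde_path: "h \<in> holder_paths 1 T \<Longrightarrow> euler_solution h (Z h)"
  using euler_solution_exists[of h] rde_path_eq_euler \<beta>(1) unfolding euler_solution_def by force

lemma rde_path_holder: "\<lbrakk>h \<in> holder_paths 1 T; e \<le> \<beta>\<rbrakk> \<Longrightarrow> Z h \<in> holder_paths e T"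
  using euler_solution_rde_path[of h] holder_paths_mono[of "Z h" \<beta> T e]
  by (auto simp: euler_solution_def holder_paths_from_def)

text \<open>Drivers tending to \<open>h\<close> whose solutions stay at distance at least
  \<open>r\<close> would have a subsequence of solutions converging to a path with an Euler bound
  for \<open>h\<close>. Uniqueness makes that path \<open>Z h\<close>, a contradiction; one
  subsequence is therefore enough.\<close>

lemma rde_path_stable:
  assumes h: "h \<in> holder_paths 1 T" and e: "0 < e" "e < \<beta>" and "0 < r"
  shows "\<exists>\<eta>>0. \<forall>h'\<in>holder_paths 1 T. driver_dist h' h < \<eta> \<longrightarrow>
    holder_dist e T (Z h') (Z h) < r"
proof (rule ccontr)
  assume "\<not> ?thesis"
  then have "\<exists>h'\<in>holder_paths 1 T. driver_dist h' h < inverse (real (Suc k))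
      \<and> r \<le> holder_dist e T (Z h') (Z h)" for k
    by (metis inverse_positive_iff_positive linorder_not_less of_nat_0_less_iff zero_less_Suc)
  then obtain g where g: "\<And>k. g k \<in> holder_paths 1 T"
      "\<And>k. driver_dist (g k) h < inverse (real (Suc k))"
      "\<And>k. r \<le> holder_dist e T (Z (g k)) (Z h)"
    by metis
  have d: "(\<lambda>k. driver_dist (g k) h) \<longlonglongrightarrow> 0"
    by (rule Lim_null_comparison[OF _ LIMSEQ_inverse_real_of_nat])
      (use g(2) in \<open>auto simp: abs_of_nonneg Metric_space.nonneg[OF Metric_space_rough] intro!: always_eventually less_imp_le\<close>)
  have le1: "driver_dist (g k) h \<le> 1" for k
  proof -
    have "inverse (real (Suc k)) \<le> 1" by (simp add: inverse_le_1_iff)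
    then show ?thesis using g(2)[of k] by linarith
  qed
  obtain q z C where "strict_mono (q :: nat \<Rightarrow> nat)" and z: "z \<in> paths" "0 \<le> C" "euler_bound h z C \<theta>"
    and lim: "\<And>e. \<lbrakk>0 < e; e < \<beta>\<rbrakk> \<Longrightarrow> (\<lambda>k. holder_dist e T (Z (g (q k))) z) \<longlonglongrightarrow> 0"
    by (rule solution_limit[of h g "\<lambda>k. Z (g k)", OF h d le1 euler_solution_rde_path[OF g(1)]]) (rule that)
  have "r \<le> 0"
    using LIMSEQ_le_const[OF lim[OF e]] g(3) rde_path_eq_euler[OF h z(1) \<alpha>(3) z(2,3)] by blast
  then show False using \<open>0 < r\<close> by simp
qed

end

section \<open>The Frechet topology\<close>

lemma holder_dist_mono:
  assumes "x \<in> holder_paths e' T" "y \<in> holder_paths e' T" "e \<le> e'"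
  shows "holder_dist e T x y \<le> max 1 (T powr (e' - e)) * holder_dist e' T x y"
proof -
  let ?m = "max 1 (T powr (e' - e))" and ?N = "enn2real (holder_norm e' T (\<lambda>t. x t - y t))"
  have fin: "holder_norm e' T (\<lambda>t. x t - y t) < \<infinity>"
    unfolding holder_norm_diff using assms by (intro holder_norm_diff_finite)
  have "holder_dist e T x y \<le> ?m * norm (x 0 - y 0) + ?m * ?N"
  proof (rule holder_dist_le)
    show "norm (x 0 - y 0) \<le> ?m * norm (x 0 - y 0)"
      using mult_right_mono[of 1 ?m "norm (x 0 - y 0)"] by simp
    fix s t assume st: "0 \<le> s" "s < t" "t \<le> T"
    have "norm ((x t - y t) - (x s - y s)) \<le> ?N * (t - s) powr e'"
      using norm_le_holder2_norm[OF fin[unfolded holder_norm_def] order_refl st]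
      by (simp add: holder_norm_def)
    also have "\<dots> \<le> ?N * (T powr (e' - e) * (t - s) powr e)"
      using st assms by (intro mult_left_mono powr_le_powr_interval) auto
    also have "\<dots> \<le> ?N * (?m * (t - s) powr e)"
      by (intro mult_left_mono mult_right_mono) auto
    finally show "norm ((x t - y t) - (x s - y s)) \<le> ?m * ?N * (t - s) powr e" by (simp add: mult_ac)
  qed auto
  then show ?thesis by (simp add: holder_dist_def distrib_left)
qed

lemma holder_minus_paths_D: "\<lbrakk>x \<in> holder_minus_paths \<theta> T; 0 < \<epsilon>; \<epsilon> < \<theta>\<rbrakk> \<Longrightarrow> x \<in> holder_paths (\<theta> - \<epsilon>) T"
  by (auto simp: holder_minus_paths_def)

abbreviation fball :: "real \<Rightarrow> real \<Rightarrow> real \<Rightarrow> (real \<Rightarrow> 'a::real_normed_vector) \<Rightarrow> real \<Rightarrow> (real \<Rightarrow> 'a) set" where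
  "fball \<theta> T \<epsilon> x r \<equiv> {y \<in> holder_minus_paths \<theta> T. holder_dist (\<theta> - \<epsilon>) T x y < r}"

lemma openin_holder_minus_ball:
  assumes "x \<in> holder_minus_paths \<theta> T" "0 < \<epsilon>" "\<epsilon> < \<theta>" "0 < r"
  shows "openin (holder_minus_topology \<theta> T) (fball \<theta> T \<epsilon> x r)"
  unfolding holder_minus_topology_def
  by (rule topology_generated_by_Basis) (use assms in blast)

text \<open>On [0,T] a Hoelder distance dominates those of smaller exponent up to a factor, so a
  finite intersection of balls around x contains a single ball for the largest exponent involved.
  Balls with another centre are handled by the triangle inequality.\<close>

lemma openin_holder_minus_contains_ball:
  fixes U :: "(real \<Rightarrow> 'a::real_normed_vector) set"
  assumes "openin (holder_minus_topology \<theta> T) U" "x \<in> U" "x \<in> holder_minus_paths \<theta> T" "0 < \<theta>"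
  shows "\<exists>\<epsilon> r. 0 < \<epsilon> \<and> \<epsilon> < \<theta> \<and> 0 < r \<and>
    fball \<theta> T \<epsilon> x r \<subseteq> U"
proof -
  let ?P = "\<lambda>U. \<exists>\<epsilon> r. 0 < \<epsilon> \<and> \<epsilon> < \<theta> \<and> 0 < r \<and>
    fball \<theta> T \<epsilon> x r \<subseteq> U"
  have "x \<in> U \<longrightarrow> ?P U"
    using assms(1)[unfolded holder_minus_topology_def openin_topology_generated_by_iff]
  proof (induction rule: generate_topology_on.induct)
    case Empty
    then show ?case by simp
  next
    case (Int a b)
    show ?case
    proof
      assume "x \<in> a \<inter> b"
      with Int obtain \<epsilon>1 r1 \<epsilon>2 r2 where 1: "0 < \<epsilon>1" "\<epsilon>1 < \<theta>" "0 < r1" "fball \<theta> T \<epsilon>1 x r1 \<subseteq> a"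
        and 2: "0 < \<epsilon>2" "\<epsilon>2 < \<theta>" "0 < r2" "fball \<theta> T \<epsilon>2 x r2 \<subseteq> b"
        by blast
      define \<epsilon> where "\<epsilon> = min \<epsilon>1 \<epsilon>2"
      define m where "m = max (max 1 (T powr (\<epsilon>1 - \<epsilon>))) (max 1 (T powr (\<epsilon>2 - \<epsilon>)))"
      define r where "r = min r1 r2 / m"
      have m: "1 \<le> m" by (simp add: m_def)
      have r: "0 < r" "m * r \<le> r1" "m * r \<le> r2" using 1 2 m by (auto simp: r_def)
      have "y \<in> a \<inter> b" if y: "y \<in> holder_minus_paths \<theta> T" "holder_dist (\<theta> - \<epsilon>) T x y < r" for y
      proof -
        have mem: "x \<in> holder_paths (\<theta> - \<epsilon>) T" "y \<in> holder_paths (\<theta> - \<epsilon>) T"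
          using assms(3) y 1 2 by (auto intro!: holder_minus_paths_D simp: \<epsilon>_def)
        have *: "m * holder_dist (\<theta> - \<epsilon>) T x y < m * r" using y m by simp
        have "holder_dist (\<theta> - \<epsilon>1) T x y \<le> m * holder_dist (\<theta> - \<epsilon>) T x y"
          by (rule order_trans[OF holder_dist_mono[OF mem]])
            (auto simp: \<epsilon>_def m_def holder_dist_nonneg intro!: mult_right_mono)
        moreover have "holder_dist (\<theta> - \<epsilon>2) T x y \<le> m * holder_dist (\<theta> - \<epsilon>) T x y"
          by (rule order_trans[OF holder_dist_mono[OF mem]])
            (auto simp: \<epsilon>_def m_def holder_dist_nonneg intro!: mult_right_mono)
        ultimately show ?thesis using * r 1(4) 2(4) y by (auto simp: subset_iff)
      qed
      then show "?P (a \<inter> b)"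
        using 1 2 r by (intro exI[of _ \<epsilon>] exI[of _ r]) (auto simp: \<epsilon>_def)
    qed
  next
    case (UN K)
    then show ?case by (meson Union_iff Union_upper subset_trans)
  next
    case (Basis s)
    then obtain x0 \<epsilon> r where s: "s = fball \<theta> T \<epsilon> x0 r"
      and *: "x0 \<in> holder_minus_paths \<theta> T" "0 < \<epsilon>" "\<epsilon> < \<theta>" "0 < r" by blast
    show ?case
    proof
      assume "x \<in> s"
      have "y \<in> s" if y: "y \<in> holder_minus_paths \<theta> T" "holder_dist (\<theta> - \<epsilon>) T x y < r - holder_dist (\<theta> - \<epsilon>) T x0 x" for y
      proof -
        have "holder_dist (\<theta> - \<epsilon>) T x0 y \<le> holder_dist (\<theta> - \<epsilon>) T x0 x + holder_dist (\<theta> - \<epsilon>) T x y"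
          using * y assms(3) by (intro Metric_space.triangle[OF Metric_space_holder] holder_minus_paths_D)
        then show ?thesis using y s by simp
      qed
      then show "?P s"
        using * \<open>x \<in> s\<close> s by (intro exI[of _ \<epsilon>] exI[of _ "r - holder_dist (\<theta> - \<epsilon>) T x0 x"]) auto
    qed
  qed
  then show ?thesis using assms(2) by blast
qed

section \<open>The support\<close>

context path_dependent_rde
begin

lemma rde_path_holder_minus: "h \<in> holder_paths 1 T \<Longrightarrow> Z h \<in> holder_minus_paths \<beta> T"
  unfolding holder_minus_paths_def by (auto intro: rde_path_holder)

text \<open>Infinitely many of the solutions Z(g N) are near z, while the drivers g N are eventually
  near X and hence near \<open>h\<close>; some N does both, and \<open>rde_path_stable\<close>
  applies to it. The radius is uniform over X and over all points of \<open>sol_infty\<close>, so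
  the choice made by a selection does not matter.\<close>

lemma sol_infty_near_smooth:
  assumes h: "h \<in> holder_paths 1 T" and \<epsilon>: "0 < \<epsilon>" "\<epsilon> < \<beta>" and "0 < r"
  shows "\<exists>\<eta>>0. \<forall>X\<in>rough_paths \<beta> T. rough_dist \<beta> T (smooth_rough_path T h) X < \<eta> \<longrightarrow>
    (\<forall>z\<in>sol_infty \<beta> T \<sigma> A \<xi> X. holder_dist (\<beta> - \<epsilon>) T (Z h) z < r)"
proof -
  obtain \<eta> where \<eta>: "0 < \<eta>" "\<And>h'. \<lbrakk>h' \<in> holder_paths 1 T; driver_dist h' h < \<eta>\<rbrakk> \<Longrightarrow>
      holder_dist (\<beta> - \<epsilon>) T (Z h') (Z h) < r / 2"
    using rde_path_stable[OF h, of "\<beta> - \<epsilon>" "r / 2"] \<epsilon> \<open>0 < r\<close> by auto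
  have "holder_dist (\<beta> - \<epsilon>) T (Z h) z < r"
    if X: "X \<in> rough_paths \<beta> T" "rough_dist \<beta> T (smooth_rough_path T h) X < \<eta> / 2" and z: "z \<in> sol_infty \<beta> T \<sigma> A \<xi> X" for X z
  proof -
    interpret R: Metric_space "rough_paths \<beta> T" "rough_dist \<beta> T" by (rule Metric_space_rough)
    interpret P: Metric_space "holder_paths (\<beta> - \<epsilon>) T" "holder_dist (\<beta> - \<epsilon>) T" by (rule Metric_space_holder)
    obtain g where zmem: "z \<in> holder_minus_paths \<beta> T" and g: "\<And>N. g N \<in> holder_paths 1 T"
      "(\<lambda>N. rough_dist \<beta> T (smooth_rough_path T (g N)) X) \<longlonglongrightarrow> 0"
      "\<And>U. \<lbrakk>openin (holder_minus_topology \<beta> T) U; z \<in> U\<rbrakk> \<Longrightarrow> \<exists>\<^sub>F N in sequentially. Z (g N) \<in> U"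
      using z unfolding sol_infty_def by blast
    have zp: "z \<in> holder_paths (\<beta> - \<epsilon>) T" by (rule holder_minus_paths_D[OF zmem \<epsilon>])
    let ?U = "fball \<beta> T \<epsilon> z (r / 2)"
    have "\<exists>\<^sub>F N in sequentially. Z (g N) \<in> ?U"
      by (rule g(3)[OF openin_holder_minus_ball[OF zmem \<epsilon>]]) (use zmem zp \<open>0 < r\<close> in auto)
    moreover have "\<forall>\<^sub>F N in sequentially. rough_dist \<beta> T (smooth_rough_path T (g N)) X < \<eta> / 2"
      by (rule order_tendstoD(2)[OF g(2)]) (use \<eta>(1) in simp)
    ultimately obtain N where N: "Z (g N) \<in> ?U" "rough_dist \<beta> T (smooth_rough_path T (g N)) X < \<eta> / 2"
      using frequently_eventually_conj[THEN frequently_ex] by blast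
    have "driver_dist (g N) h
        \<le> rough_dist \<beta> T (smooth_rough_path T (g N)) X + rough_dist \<beta> T X (smooth_rough_path T h)"
      by (intro R.triangle smooth_rough_path_\<beta> g h X)
    then have "holder_dist (\<beta> - \<epsilon>) T (Z (g N)) (Z h) < r / 2"
      using N X R.commute[of X "smooth_rough_path T h"] by (intro \<eta>(2) g) auto
    moreover have "holder_dist (\<beta> - \<epsilon>) T z (Z h) \<le> holder_dist (\<beta> - \<epsilon>) T z (Z (g N)) + holder_dist (\<beta> - \<epsilon>) T (Z (g N)) (Z h)"
      using \<epsilon> by (intro P.triangle zp rde_path_holder g h) auto
    ultimately show ?thesis using N P.commute[of z "Z h"] by auto
  qed
  then show ?thesis using \<eta>(1) by (intro exI[of _ "\<eta> / 2"]) auto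
qed

theorem support_of_solutions:
  fixes \<nu> :: "('d::finite) rough_path measure" and S :: "('d::finite) rough_path set" and \<I> :: "('d::finite) rough_path \<Rightarrow> real \<Rightarrow> real^'n"
  assumes \<nu>: "prob_space \<nu>" "sets \<nu> = sets (borel_of (geometric_topology \<beta> T))"
    and supp_\<nu>: "topological_support (geometric_topology \<beta> T) \<nu> = geometric_rough_paths \<beta> T"
    and S: "S \<subseteq> geometric_rough_paths \<beta> T" "emeasure (completion \<nu>) S = 1"
    and \<I>_measurable: "\<I> \<in> restrict_space (completion \<nu>) S \<rightarrow>\<^sub>M borel_of (holder_minus_topology \<beta> T)"
    and \<I>_sol: "\<And>X. X \<in> S \<Longrightarrow> \<I> X \<in> sol_infty \<beta> T \<sigma> A \<xi> X"
  shows "topological_support (holder_minus_topology \<beta> T)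
           (distr (restrict_space (completion \<nu>) S) (borel_of (holder_minus_topology \<beta> T)) \<I>)
       = holder_minus_topology \<beta> T closure_of {Z h | h. h \<in> holder_paths 1 T}" (is "?supp = ?closure")
proof -
  interpret \<nu>: prob_space \<nu> by fact
  interpret R: Metric_space "rough_paths \<beta> T :: ('d::finite) rough_path set" "rough_dist \<beta> T" by (rule Metric_space_rough)
  let ?HM = "holder_minus_topology \<beta> T :: (real \<Rightarrow> real^'n) topology"
  let ?G = "geometric_topology \<beta> T :: ('d::finite) rough_path topology"
  let ?M = "restrict_space (completion \<nu>) S"
  have sets_borel_of: "U \<in> sets (borel_of X)" if "openin X U" for X :: "'x topology" and U
    unfolding borel_of_def using that by (auto simp: sets_measure_of dest: openin_subset)
  have topspace: "topspace ?HM = holder_minus_paths \<beta> T"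
    using \<beta> by (intro topspace_holder_minus_topology)
  have geom: "geometric_rough_paths \<beta> T \<subseteq> (rough_paths \<beta> T :: ('d::finite) rough_path set)"
    unfolding geometric_rough_paths_def rough_topology_def using closure_of_subset_topspace by fastforce
  \<comment> \<open>\<open>emeasure\<close> is 0 on sets that are not measurable, so the value 1
    forces \<open>S\<close> to be measurable for the completion.\<close>
  have S_sets: "S \<in> sets (completion \<nu>)"
    using S(2) emeasure_notin_sets by fastforce
  have space_M: "space ?M = S"
    using sets.sets_into_space[OF S_sets] by (auto simp: space_restrict_space)
  have S_null: "emeasure (completion \<nu>) (space \<nu> - S) = 0"
    using emeasure_compl[OF S_sets] S(2) \<nu>.emeasure_space_1 by (simp add: space_completion)
  have measure_distr: "emeasure (distr ?M (borel_of ?HM) \<I>) U = emeasure (completion \<nu>) (\<I> -` U \<inter> S)"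
    if U: "openin ?HM U" for U
  proof -
    have "emeasure (distr ?M (borel_of ?HM) \<I>) U = emeasure ?M (\<I> -` U \<inter> S)"
      using emeasure_distr[OF \<I>_measurable sets_borel_of[OF U]] by (simp add: space_M)
    also have "\<dots> = emeasure (completion \<nu>) (\<I> -` U \<inter> S)"
      using S_sets by (intro emeasure_restrict_space) auto
    finally show ?thesis .
  qed
  have "?supp \<subseteq> ?closure"
  proof (rule subsetI, rule ccontr)
    fix z assume z: "z \<in> ?supp" "z \<notin> ?closure"
    let ?U = "topspace ?HM - ?closure"
    have U: "openin ?HM ?U" by (intro openin_diff openin_topspace closedin_closure_of)
    have "\<I> X \<in> ?closure" if "X \<in> S" for X
    proof -
      have sol: "\<I> X \<in> sol_infty \<beta> T \<sigma> A \<xi> X" using \<I>_sol that .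
      show ?thesis
        unfolding in_closure_of topspace
      proof (intro conjI allI impI)
        show "\<I> X \<in> holder_minus_paths \<beta> T" using sol by (simp add: sol_infty_def)
        fix V assume "\<I> X \<in> V \<and> openin ?HM V"
        then obtain g :: "nat \<Rightarrow> real \<Rightarrow> real^'d" where "\<And>N. g N \<in> holder_paths 1 T" "\<exists>\<^sub>F N in sequentially. Z (g N) \<in> V"
          using sol unfolding sol_infty_def by blast
        then show "\<exists>y. y \<in> {Z h |h. h \<in> holder_paths 1 T} \<and> y \<in> V"
          using frequently_ex by fast
      qed
    qed
    then have "\<I> -` ?U \<inter> S = {}" by auto
    then have "emeasure (distr ?M (borel_of ?HM) \<I>) ?U = 0" using measure_distr[OF U] by simp
    moreover have "z \<in> ?U" "0 < emeasure (distr ?M (borel_of ?HM) \<I>) ?U"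
      using z U by (auto simp: topological_support_def)
    ultimately show False by simp
  qed
  moreover have "?closure \<subseteq> ?supp"
  proof
    fix z assume z: "z \<in> ?closure"
    have "0 < emeasure (distr ?M (borel_of ?HM) \<I>) U" if U: "openin ?HM U" "z \<in> U" for U
    proof -
      obtain h where h: "h \<in> holder_paths 1 T" "Z h \<in> U"
        using z U unfolding in_closure_of by blast
      obtain \<epsilon> r where \<epsilon>: "0 < \<epsilon>" "\<epsilon> < \<beta>" "0 < r"
        and ball: "fball \<beta> T \<epsilon> (Z h) r \<subseteq> U"
        using openin_holder_minus_contains_ball[OF U(1) h(2) rde_path_holder_minus[OF h(1)] \<beta>(1)] by blast
      obtain \<eta> where \<eta>: "0 < \<eta>" "\<And>X z. \<lbrakk>X \<in> rough_paths \<beta> T; rough_dist \<beta> T (smooth_rough_path T h) X < \<eta>;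
          z \<in> sol_infty \<beta> T \<sigma> A \<xi> X\<rbrakk> \<Longrightarrow> holder_dist (\<beta> - \<epsilon>) T (Z h) z < r"
        using sol_infty_near_smooth[OF h(1) \<epsilon>] by blast
      let ?h = "smooth_rough_path T h"
      let ?V = "geometric_rough_paths \<beta> T \<inter> R.mball ?h \<eta>"
      have V: "openin ?G ?V"
        unfolding geometric_topology_def rough_topology_def by (intro openin_subtopology_Int2 R.openin_mball)
      have "?h \<in> geometric_rough_paths \<beta> T"
        using closure_of_subset[of "smooth_rough_path T ` (holder_paths 1 T :: (real \<Rightarrow> real^'d) set)" "rough_topology \<beta> T"] h(1) smooth_rough_path_\<beta>
        by (auto simp: geometric_rough_paths_def rough_topology_def)
      then have "?h \<in> ?V" using smooth_rough_path_\<beta>[OF h(1)] \<eta>(1) by simp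
      moreover from this have "?h \<in> topological_support ?G \<nu>" using supp_\<nu> by blast
      ultimately have "0 < emeasure \<nu> ?V"
        using V unfolding topological_support_def by blast
      have V_sets: "?V \<in> sets \<nu>" unfolding \<nu>(2) by (rule sets_borel_of[OF V])
      have VS: "?V \<inter> S \<in> sets (completion \<nu>)" and SC: "space \<nu> - S \<in> sets (completion \<nu>)"
        using sets.compl_sets[OF S_sets] sets.Int[OF sets_completionI_sets[OF V_sets] S_sets]
        by (simp_all add: space_completion)
      have "emeasure \<nu> ?V = emeasure (completion \<nu>) ?V" using V_sets by simp
      \<comment> \<open>Cutting the ball down to \<open>S\<close>, where \<open>\<I>\<close> is
        defined, costs at most the null set outside \<open>S\<close>.\<close>
      also have "\<dots> \<le> emeasure (completion \<nu>) ((?V \<inter> S) \<union> (space \<nu> - S))"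
        using sets.sets_into_space[OF V_sets] by (intro emeasure_mono sets.Un VS SC) auto
      also have "\<dots> \<le> emeasure (completion \<nu>) (?V \<inter> S) + emeasure (completion \<nu>) (space \<nu> - S)"
        by (intro emeasure_subadditive VS SC)
      also have "\<dots> = emeasure (completion \<nu>) (?V \<inter> S)" by (simp add: S_null)
      also have "\<dots> \<le> emeasure (completion \<nu>) (\<I> -` U \<inter> S)"
      proof (rule emeasure_mono)
        show "?V \<inter> S \<subseteq> \<I> -` U \<inter> S"
        proof
          fix X assume X: "X \<in> ?V \<inter> S"
          then have "\<I> X \<in> sol_infty \<beta> T \<sigma> A \<xi> X" using \<I>_sol by blast
          moreover from this have "holder_dist (\<beta> - \<epsilon>) T (Z h) (\<I> X) < r"
            using X by (intro \<eta>(2)) auto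
          ultimately have "\<I> X \<in> U" using ball by (auto simp: sol_infty_def)
          then show "X \<in> \<I> -` U \<inter> S" using X by blast
        qed
        have "\<I> -` U \<inter> S \<in> sets ?M"
          using measurable_sets[OF \<I>_measurable sets_borel_of[OF U(1)]] by (simp only: space_M)
        then show "\<I> -` U \<inter> S \<in> sets (completion \<nu>)"
          using S_sets sets_restrict_space_iff[of S "completion \<nu>"] sets.Int_space_eq2[OF S_sets] by metis
      qed
      finally show ?thesis
        using \<open>0 < emeasure \<nu> ?V\<close> measure_distr[OF U(1)] by simp
    qed
    moreover have "z \<in> topspace ?HM" using z by (simp add: in_closure_of)
    ultimately show "z \<in> ?supp" by (simp add: topological_support_def)
  qed
  ultimately show ?thesis by blast
qed

end

section \<open>Transfer to the hypotheses of the theorem\<close>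

lemma rde_solution_cong:
  assumes "\<And>x. x \<in> holder_paths_from \<beta> T \<xi> \<Longrightarrow> A x = A' x"
  shows "rde_solution \<beta> T \<sigma> A \<xi> X = rde_solution \<beta> T \<sigma> A' \<xi> X"
  unfolding rde_solution_def using assms by (intro ext) auto

text \<open>Brings continuity between the path spaces into the sequential, pointwise form that the
  locale assumes: the uniform distance dominates the distance at each time in [0,T].\<close>

lemma tendsto_of_continuous_map_cfunspace:
  fixes A :: "(real \<Rightarrow> 'a::real_normed_vector) \<Rightarrow> real \<Rightarrow> 'b::real_normed_vector"
  assumes cont: "continuous_map (subtopology (holder_topology e T) P)
      (mtopology_of (cfunspace (top_of_set {0..T}) euclidean_metric)) A"
    and P: "P \<subseteq> holder_paths e T" and x: "\<And>k::nat. x k \<in> P" "y \<in> P"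
    and lim: "(\<lambda>k. holder_dist e T (x k) y) \<longlonglongrightarrow> 0" and t: "0 \<le> t" "t \<le> T"
  shows "(\<lambda>k. A (x k) t) \<longlonglongrightarrow> A y t"
proof -
  let ?c = "cfunspace (top_of_set {0..T}) euclidean_metric :: (real \<Rightarrow> 'b) metric"
  interpret P: Metric_space "holder_paths e T" "holder_dist e T :: (real \<Rightarrow> 'a) \<Rightarrow> _" by (rule Metric_space_holder)
  have "limitin (subtopology (holder_topology e T) P) x y sequentially"
    unfolding limitin_subtopology holder_topology_def P.limit_metric_sequentially
  proof (intro conjI allI impI)
    fix \<epsilon> :: real assume "0 < \<epsilon>"
    then have "\<forall>\<^sub>F k in sequentially. holder_dist e T (x k) y < \<epsilon>" by (rule order_tendstoD(2)[OF lim])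
    then show "\<exists>N. \<forall>n\<ge>N. x n \<in> holder_paths e T \<and> holder_dist e T (x n) y < \<epsilon>"
      using x P unfolding eventually_sequentially by blast
  qed (use x P in auto)
  then have "limitin (mtopology_of ?c) (A \<circ> x) (A y) sequentially"
    by (rule continuous_map_limit[OF cont])
  then have "A y \<in> mspace ?c" and small: "\<And>\<epsilon>. 0 < \<epsilon> \<Longrightarrow> \<exists>N. \<forall>n\<ge>N. A (x n) \<in> mspace ?c \<and> mdist ?c (A (x n)) (A y) < \<epsilon>"
    unfolding mtopology_of_def Metric_space.limit_metric_sequentially[OF Metric_space_mspace_mdist] by auto
  show ?thesis
  proof (rule metric_LIMSEQ_I)
    fix \<epsilon> :: real assume "0 < \<epsilon>"
    then obtain N where N: "\<And>n. N \<le> n \<Longrightarrow> A (x n) \<in> mspace ?c \<and> mdist ?c (A (x n)) (A y) < \<epsilon>" using small by blast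
    have "dist (A (x n) t) (A y t) < \<epsilon>" if n: "N \<le> n" for n
    proof -
      have "mdist euclidean_metric (A (x n) t) (A y t) \<le> mdist ?c (A (x n)) (A y)"
        using N[OF n] \<open>A y \<in> mspace ?c\<close> t by (intro mdist_cfunspace_imp_mdist_le[OF _ _ order_refl]) auto
      then show ?thesis using N[OF n] by simp
    qed
    then show "\<exists>N. \<forall>n\<ge>N. dist (A (x n) t) (A y t) < \<epsilon>" by blast
  qed
qed

theorem theorem6p4:
  fixes T \<beta> \<gamma> \<beta>\<^sub>0 :: real
    and \<sigma> :: "(real^'n) \<times> (real^'n) \<Rightarrow> (real^'d) \<Rightarrow>\<^sub>L (real^'n)"
    and \<xi> :: "real^'n"
    and A A\<^sub>0 :: "(real \<Rightarrow> real^'n) \<Rightarrow> (real \<Rightarrow> real^'n)"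
    and F :: "real \<Rightarrow> real"
    and \<nu> :: "'d rough_path measure"
    and S :: "'d rough_path set"
    and \<I> :: "'d rough_path \<Rightarrow> real \<Rightarrow> real^'n"
  assumes T: "0 < T"
    and \<beta>: "1/3 < \<beta>" "\<beta> \<le> 1/2"
    and \<gamma>: "\<gamma> > 1 / \<beta>"
    and \<sigma>: "\<sigma> \<in> lip_class (\<gamma> - 1)"
    and A: "A \<in> holder_paths_from \<beta> T \<xi> \<rightarrow> mspace (cfunspace (top_of_set {0..T}) euclidean_metric)"
    and A_adapted: "\<And>t x y. \<lbrakk>0 \<le> t; t \<le> T; x \<in> holder_paths_from \<beta> T \<xi>; y \<in> holder_paths_from \<beta> T \<xi>;
          \<forall>s\<in>{0..t}. x s = y s\<rbrakk> \<Longrightarrow> \<forall>s\<in>{0..t}. A x s = A y s"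
    and \<beta>\<^sub>0: "1/3 < \<beta>\<^sub>0" "\<beta>\<^sub>0 < \<beta>"
    and A_extends: "\<And>x. x \<in> holder_paths_from \<beta> T \<xi> \<Longrightarrow> A\<^sub>0 x = A x"
    and A_continuous: "continuous_map
          (subtopology (holder_topology \<beta>\<^sub>0 T) (holder_paths_from \<beta>\<^sub>0 T \<xi>))
          (mtopology_of (cfunspace (top_of_set {0..T}) euclidean_metric)) A\<^sub>0"
    and F: "continuous_on {0..} F" "mono_on {0..} F" "\<And>u. 0 \<le> u \<Longrightarrow> 0 < F u"
    and A_variation: "\<And>x s t. \<lbrakk>x \<in> holder_paths_from \<beta>\<^sub>0 T \<xi>; 0 \<le> s; s \<le> t; t \<le> T\<rbrakk> \<Longrightarrow>
          p_variation 1 (A\<^sub>0 x) s t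
            \<le> ennreal (F (enn2real (p_variation (1 / \<beta>\<^sub>0) x s t))) * infty_variation x s t"
    and unique: "\<And>h. h \<in> holder_paths 1 T \<Longrightarrow>
          \<exists>\<^sub>\<le>\<^sub>1 p. rde_solution \<beta> T \<sigma> A \<xi> (smooth_rough_path T h) p"
    and \<nu>: "prob_space \<nu>" "sets \<nu> = sets (borel_of (geometric_topology \<beta> T))"
    and supp_\<nu>: "topological_support (geometric_topology \<beta> T) \<nu> = geometric_rough_paths \<beta> T"
    and S: "S \<subseteq> geometric_rough_paths \<beta> T" "emeasure (completion \<nu>) S = 1"
    and \<I>_measurable: "\<I> \<in> restrict_space (completion \<nu>) S \<rightarrow>\<^sub>M borel_of (holder_minus_topology \<beta> T)"
    and \<I>_sol: "\<And>X. X \<in> S \<Longrightarrow> \<I> X \<in> sol_infty \<beta> T \<sigma> A \<xi> X"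
  shows "topological_support (holder_minus_topology \<beta> T)
           (distr (restrict_space (completion \<nu>) S) (borel_of (holder_minus_topology \<beta> T)) \<I>)
       = holder_minus_topology \<beta> T closure_of {rde_path \<beta> T \<sigma> A \<xi> h | h. h \<in> holder_paths 1 T}"
proof -
  obtain \<alpha> B where \<sigma>': "0 < \<alpha>" "\<alpha> \<le> 1" "1 < \<beta> * (2 + \<alpha>)" "1 \<le> B"
    "\<And>x. norm (\<sigma> x) \<le> B" "\<And>x. \<sigma> differentiable (at x)"
    "\<And>x v. norm (frechet_derivative \<sigma> (at x) v) \<le> B * norm v"
    "\<And>x y v. norm (frechet_derivative \<sigma> (at x) v - frechet_derivative \<sigma> (at y) v)
        \<le> B * norm (x - y) powr \<alpha> * norm v"
    by (rule lip_class_regularity[OF \<beta> \<gamma> \<sigma>]) (rule that)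
  \<comment> \<open>The locale is instantiated with the extension \<open>A\<^sub>0\<close>.
    Solutions are \<beta>-Hoelder paths from \<xi>, where it agrees with \<open>A\<close>, so both
    maps define the same solutions, the same Z(h) and the same sets
    \<open>sol_infty\<close>.\<close>
  have sol: "rde_solution \<beta> T \<sigma> A\<^sub>0 \<xi> = rde_solution \<beta> T \<sigma> A \<xi>"
    by (intro ext rde_solution_cong[THEN fun_cong] A_extends)
  then have path: "rde_path \<beta> T \<sigma> A\<^sub>0 \<xi> = rde_path \<beta> T \<sigma> A \<xi>"
    by (intro ext) (simp only: rde_path_def)
  interpret path_dependent_rde T \<beta> \<beta>\<^sub>0 \<alpha> B \<sigma> \<xi> A\<^sub>0 F
  proof
    show "(\<lambda>k. A\<^sub>0 (x k) t) \<longlonglongrightarrow> A\<^sub>0 y t"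
      if "\<And>k::nat. x k \<in> holder_paths_from \<beta>\<^sub>0 T \<xi>" "y \<in> holder_paths_from \<beta>\<^sub>0 T \<xi>"
        "(\<lambda>k. holder_dist \<beta>\<^sub>0 T (x k) y) \<longlonglongrightarrow> 0" "0 \<le> t" "t \<le> T" for x y t
      by (rule tendsto_of_continuous_map_cfunspace[OF A_continuous _ that]) (auto simp: holder_paths_from_def)
    show "\<forall>s\<in>{0..t}. A\<^sub>0 x s = A\<^sub>0 y s"
      if "0 \<le> t" "t \<le> T" "x \<in> holder_paths_from \<beta> T \<xi>" "y \<in> holder_paths_from \<beta> T \<xi>" "\<forall>s\<in>{0..t}. x s = y s" for t x y
      using A_adapted[OF that] A_extends that(3,4) by simp
    show "\<exists>\<^sub>\<le>\<^sub>1 p. rde_solution \<beta> T \<sigma> A\<^sub>0 \<xi> (smooth_rough_path T h) p" if "h \<in> holder_paths 1 T" for h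
      unfolding sol by (rule unique[OF that])
  qed (use T \<beta> \<beta>\<^sub>0 \<sigma>' F A_variation in auto)
  have "sol_infty \<beta> T \<sigma> A\<^sub>0 \<xi> X = sol_infty \<beta> T \<sigma> A \<xi> X" for X
    unfolding sol_infty_def path ..
  then show ?thesis
    using support_of_solutions[OF \<nu> supp_\<nu> S \<I>_measurable] \<I>_sol unfolding path by blast
qed

end
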